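(* Let $(M^{n+1},\bar g,e^{-f}d\mu)$ be a complete smooth metric measure space with $\overline{\mathrm{Ric}}_f\ge k$, where $k$ is a positive constant. Then there is no complete two-sided $L_f$-stable $f$-minimal hypersurface $\Sigma$ immersed in $(M,\bar g)$ without boundary and with finite weighted volume (i.e. $\int_\Sigma e^{-f}d\sigma<\infty$), where $d\sigma$ denotes the volume element on $\Sigma$ determined by the metric induced from $(M,\bar g)$.
   Context: A smooth metric measure space $(M,\bar g,e^{-f}d\mu)$ is a Riemannian manifold $(M,\bar g)$ together with the weighted volume form $e^{-f}d\mu$, where $f$ is a smooth function on $M$ and $d\mu$ is the Riemannian volume element; it is complete if $(M,\bar g)$ is complete. Bars denote quantities of $(M,\bar g)$. $\overline{\mathrm{Ric}}_f:=\overline{\mathrm{Ric}}+\overline\nabla^2 f$, and $\overline{\mathrm{Ric}}_f\ge k$ means $\overline{\mathrm{Ric}}_f\ge k\,\bar g$. For an immersed hypersurface $\Sigma$ with the induced metric (also denoted $\bar g$) and unit normal $\nu$, set $A(X)=\overline\nabla_X\nu$ and $H=\mathrm{tr}\,A$. $\Sigma$ is $f$-minimal if $H=\langle\overline\nabla f,\nu\rangle$. $\Sigma$ is two-sided if it has a globally defined unit normal $\nu$. Completeness of $\Sigma$ is with respect to the induced metric. A two-sided $f$-minimal hypersurface $\Sigma$ is $L_f$-stable if for every compactly supported smooth function $\phi\in C_o^\infty(\Sigma)$, $$-\int_\Sigma\phi L_f\phi\, e^{-f}d\sigma=\int_\Sigma\left[|\nabla\phi|^2-\left(|A|^2+\overline{\mathrm{Ric}}_f(\nu,\nu)\right)\phi^2\right]e^{-f}d\sigma\ge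 0,$$ where $L_f=\Delta_f+|A|^2+\overline{\mathrm{Ric}}_f(\nu,\nu)$ and $\Delta_f u=\Delta u-\langle\nabla f,\nabla u\rangle$ is the weighted Laplacian on $\Sigma$. *)

theory Defs
  imports "HOL-Analysis.Analysis"
begin

section \<open>Smooth maps between open subsets of Euclidean spaces\<close>

primrec higher_differentiable_on ::
  "nat \<Rightarrow> 'a::euclidean_space set \<Rightarrow> ('a \<Rightarrow> 'b::euclidean_space) \<Rightarrow> bool" where
  "higher_differentiable_on 0 S f \<longleftrightarrow> continuous_on S f"
| "higher_differentiable_on (Suc k) S f \<longleftrightarrow>
     (\<forall>x\<in>S. f differentiable (at x)) \<and>
     (\<forall>v. higher_differentiable_on k S (\<lambda>x. frechet_derivative f (at x) v))"

text \<open>Used only for open \<open>S\<close>, where it says that \<open>f\<close> is of class \<open>C\<^sup>k\<close> for every \<open>k\<close>.\<close>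

definition smooth_on :: "'a::euclidean_space set \<Rightarrow> ('a \<Rightarrow> 'b::euclidean_space) \<Rightarrow> bool" where
  "smooth_on S f \<longleftrightarrow> (\<forall>k. higher_differentiable_on k S f)"


section \<open>Local Riemannian geometry in coordinates\<close>

text \<open>
  A local metric assigns to each point of an open subset of \<open>real ^ 'n\<close> a bilinear form. All objects
  below are the usual ones, expressed on constant (i.e. coordinate) vector fields, whose Lie
  brackets vanish.
\<close>

type_synonym 'n local_metric = "real^'n \<Rightarrow> real^'n \<Rightarrow> real^'n \<Rightarrow> real"

definition gram :: "('n::finite) local_metric \<Rightarrow> real^'n \<Rightarrow> real^'n^'n" where
  "gram G x = (\<chi> i j. G x (axis i 1) (axis j 1))"

definition gradient :: "('n::finite) local_metric \<Rightarrow> (real^'n \<Rightarrow> real) \<Rightarrow> real^'n \<Rightarrow> real^'n" where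
  "gradient G h x = (THE z. \<forall>w. G x z w = frechet_derivative h (at x) w)"

text \<open>
  \<open>christoffel G x u v\<close> is \<open>\<nabla>\<^sub>u v\<close> at \<open>x\<close> for the Levi-Civita connection and constant vector
  fields \<open>u\<close>, \<open>v\<close>; the defining equation is the Koszul formula.
\<close>

definition christoffel ::
  "('n::finite) local_metric \<Rightarrow> real^'n \<Rightarrow> real^'n \<Rightarrow> real^'n \<Rightarrow> real^'n" where
  "christoffel G x u v = (THE z. \<forall>w. 2 * G x z w =
       frechet_derivative (\<lambda>y. G y v w) (at x) u
     + frechet_derivative (\<lambda>y. G y u w) (at x) v
     - frechet_derivative (\<lambda>y. G y u v) (at x) w)"

text \<open>
  Covariant derivative, in direction \<open>u\<close>, of a vector field \<open>Y\<close> along a map \<open>F\<close> into the domain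
  of \<open>G\<close>. For \<open>F\<close> the identity this is the Levi-Civita connection itself.
\<close>

definition cov_deriv_along ::
  "('n::finite) local_metric \<Rightarrow> (real^('k::finite) \<Rightarrow> real^'n) \<Rightarrow> (real^'k \<Rightarrow> real^'n)
     \<Rightarrow> real^'k \<Rightarrow> real^'k \<Rightarrow> real^'n" where
  "cov_deriv_along G F Y x u =
     frechet_derivative Y (at x) u + christoffel G (F x) (frechet_derivative F (at x) u) (Y x)"

definition cov_deriv ::
  "('n::finite) local_metric \<Rightarrow> (real^'n \<Rightarrow> real^'n) \<Rightarrow> real^'n \<Rightarrow> real^'n \<Rightarrow> real^'n" where
  "cov_deriv G Y = cov_deriv_along G (\<lambda>x. x) Y"

text \<open>\<open>R(u, v) w = \<nabla>\<^sub>u \<nabla>\<^sub>v w - \<nabla>\<^sub>v \<nabla>\<^sub>u w\<close>; the term with \<open>[u, v]\<close> vanishes for constant fields.\<close>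

definition curvature ::
  "('n::finite) local_metric \<Rightarrow> real^'n \<Rightarrow> real^'n \<Rightarrow> real^'n \<Rightarrow> real^'n \<Rightarrow> real^'n" where
  "curvature G x u v w =
     cov_deriv G (\<lambda>y. cov_deriv G (\<lambda>_. w) y v) x u - cov_deriv G (\<lambda>y. cov_deriv G (\<lambda>_. w) y u) x v"

definition ricci :: "('n::finite) local_metric \<Rightarrow> real^'n \<Rightarrow> real^'n \<Rightarrow> real^'n \<Rightarrow> real" where
  "ricci G x v w = trace (matrix (\<lambda>u. curvature G x u v w))"

definition hessian ::
  "('n::finite) local_metric \<Rightarrow> (real^'n \<Rightarrow> real) \<Rightarrow> real^'n \<Rightarrow> real^'n \<Rightarrow> real^'n \<Rightarrow> real" where
  "hessian G h x u v =
     frechet_derivative (\<lambda>y. frechet_derivative h (at y) v) (at x) u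
     - frechet_derivative h (at x) (cov_deriv G (\<lambda>_. v) x u)"

definition bakry_emery_ricci ::
  "('n::finite) local_metric \<Rightarrow> (real^'n \<Rightarrow> real) \<Rightarrow> real^'n \<Rightarrow> real^'n \<Rightarrow> real^'n \<Rightarrow> real" where
  "bakry_emery_ricci G h x u v = ricci G x u v + hessian G h x u v"


section \<open>Smooth manifolds\<close>

text \<open>
  The values of \<open>cmap c\<close> outside \<open>cdom c\<close> are irrelevant. A manifold is given by a smooth atlas
  on an open subset \<open>points \<A>\<close> of a Hausdorff second countable space; charts map onto open subsets
  of \<open>real ^ 'n\<close>, so there is no boundary. Neither maximality of the atlas nor connectedness is
  required.
\<close>

record ('m, 'n) chart =
  cdom :: "'m set"
  cmap :: "'m \<Rightarrow> real^('n::finite)"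

definition cimg :: "('m, 'n::finite) chart \<Rightarrow> (real^'n) set" where
  "cimg c = cmap c ` cdom c"

definition cinv :: "('m, 'n::finite) chart \<Rightarrow> real^'n \<Rightarrow> 'm" where
  "cinv c = inv_into (cdom c) (cmap c)"

definition is_chart :: "('m::topological_space, 'n::finite) chart \<Rightarrow> bool" where
  "is_chart c \<longleftrightarrow> open (cdom c) \<and> open (cimg c) \<and>
     homeomorphism (cdom c) (cimg c) (cmap c) (cinv c)"

definition transition ::
  "('m, 'n::finite) chart \<Rightarrow> ('m, 'n) chart \<Rightarrow> real^'n \<Rightarrow> real^'n" where
  "transition c d = cmap d \<circ> cinv c"

definition smooth_atlas ::
  "('m::{t2_space,second_countable_topology}, 'n::finite) chart set \<Rightarrow> bool" where
  "smooth_atlas \<A> \<longleftrightarrow> (\<forall>c\<in>\<A>. is_chart c) \<and>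
     (\<forall>c\<in>\<A>. \<forall>d\<in>\<A>. smooth_on (cmap c ` (cdom c \<inter> cdom d)) (transition c d))"

definition points :: "('m, 'n::finite) chart set \<Rightarrow> 'm set" where
  "points \<A> = (\<Union>c\<in>\<A>. cdom c)"

text \<open>
  An arbitrary chart around \<open>p\<close>, used to evaluate quantities that do not depend on the chart.
\<close>

definition chart_at :: "('m, 'n::finite) chart set \<Rightarrow> 'm \<Rightarrow> ('m, 'n) chart" where
  "chart_at \<A> p = (SOME c. c \<in> \<A> \<and> p \<in> cdom c)"

definition smooth_fun :: "('m, 'n::finite) chart set \<Rightarrow> ('m \<Rightarrow> real) \<Rightarrow> bool" where
  "smooth_fun \<A> f \<longleftrightarrow> (\<forall>c\<in>\<A>. smooth_on (cimg c) (f \<circ> cinv c))"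

definition test_function ::
  "('m::topological_space, 'n::finite) chart set \<Rightarrow> ('m \<Rightarrow> real) \<Rightarrow> bool" where
  "test_function \<A> \<phi> \<longleftrightarrow> smooth_fun \<A> \<phi> \<and>
     (\<exists>K. compact K \<and> K \<subseteq> points \<A> \<and> (\<forall>p \<in> points \<A> - K. \<phi> p = 0))"


section \<open>Riemannian manifolds\<close>

text \<open>
  A Riemannian metric is given by its expression in each chart: \<open>g c x u v\<close> is the inner product at
  the point with \<open>c\<close>-coordinates \<open>x\<close> of the tangent vectors with \<open>c\<close>-components \<open>u\<close> and \<open>v\<close>. The
  last condition is the transformation law of a tensor of type \<open>(0, 2)\<close>.
\<close>

type_synonym ('m, 'n) metric = "('m, 'n) chart \<Rightarrow> 'n local_metric"

definition riemannian_metric ::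
  "('m, 'n::finite) chart set \<Rightarrow> ('m, 'n) metric \<Rightarrow> bool" where
  "riemannian_metric \<A> g \<longleftrightarrow>
     (\<forall>c\<in>\<A>. \<forall>x\<in>cimg c. bilinear (g c x) \<and> (\<forall>u v. g c x u v = g c x v u) \<and>
        (\<forall>u. u \<noteq> 0 \<longrightarrow> g c x u u > 0)) \<and>
     (\<forall>c\<in>\<A>. \<forall>u v. smooth_on (cimg c) (\<lambda>x. g c x u v)) \<and>
     (\<forall>c\<in>\<A>. \<forall>d\<in>\<A>. \<forall>x \<in> cmap c ` (cdom c \<inter> cdom d). \<forall>u v.
        g c x u v = g d (transition c d x)
          (frechet_derivative (transition c d) (at x) u)
          (frechet_derivative (transition c d) (at x) v))"

definition riemannian_manifold ::
  "('m::{t2_space,second_countable_topology}, 'n::finite) chart set \<Rightarrow> ('m, 'n) metric \<Rightarrow> bool" where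
  "riemannian_manifold \<A> g \<longleftrightarrow> smooth_atlas \<A> \<and> riemannian_metric \<A> g"

subsection \<open>Distance and completeness\<close>

definition pw_C1_curve ::
  "('m::topological_space, 'n::finite) chart set \<Rightarrow> (real \<Rightarrow> 'm) \<Rightarrow> bool" where
  "pw_C1_curve \<A> \<gamma> \<longleftrightarrow> continuous_on {0..1} \<gamma> \<and> \<gamma> ` {0..1} \<subseteq> points \<A> \<and>
     (\<forall>c\<in>\<A>. \<forall>a b. 0 \<le> a \<and> a \<le> b \<and> b \<le> 1 \<and> \<gamma> ` {a..b} \<subseteq> cdom c \<longrightarrow>
        (cmap c \<circ> \<gamma>) piecewise_C1_differentiable_on {a..b})"

definition speed ::
  "('m, 'n::finite) chart set \<Rightarrow> ('m, 'n) metric \<Rightarrow> (real \<Rightarrow> 'm) \<Rightarrow> real \<Rightarrow> real" where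
  "speed \<A> g \<gamma> t =
     (let c = chart_at \<A> (\<gamma> t); v = vector_derivative (cmap c \<circ> \<gamma>) (at t)
      in sqrt (g c (cmap c (\<gamma> t)) v v))"

definition curve_length ::
  "('m, 'n::finite) chart set \<Rightarrow> ('m, 'n) metric \<Rightarrow> (real \<Rightarrow> 'm) \<Rightarrow> ennreal" where
  "curve_length \<A> g \<gamma> = (\<integral>\<^sup>+ t\<in>{0..1}. ennreal (speed \<A> g \<gamma> t) \<partial>lborel)"

text \<open>The distance is \<open>\<infinity>\<close> between points of different connected components.\<close>

definition riemannian_dist ::
  "('m::topological_space, 'n::finite) chart set \<Rightarrow> ('m, 'n) metric \<Rightarrow> 'm \<Rightarrow> 'm \<Rightarrow> ennreal" where
  "riemannian_dist \<A> g p q =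
     (INF \<gamma> \<in> {\<gamma>. pw_C1_curve \<A> \<gamma> \<and> \<gamma> 0 = p \<and> \<gamma> 1 = q}. curve_length \<A> g \<gamma>)"

definition complete_manifold ::
  "('m::topological_space, 'n::finite) chart set \<Rightarrow> ('m, 'n) metric \<Rightarrow> bool" where
  "complete_manifold \<A> g \<longleftrightarrow>
     (\<forall>s. range s \<subseteq> points \<A> \<and>
          (\<forall>e>0. \<exists>N. \<forall>m\<ge>N. \<forall>n\<ge>N. riemannian_dist \<A> g (s m) (s n) < e) \<longrightarrow>
          (\<exists>p \<in> points \<A>. (\<lambda>n. riemannian_dist \<A> g (s n) p) \<longlonglongrightarrow> 0))"

subsection \<open>Volume\<close>

text \<open>
  The Riemannian volume is the Borel measure given in every chart by
  \<open>sqrt (det (g\<^sub>i\<^sub>j)) dx\<^sub>1 \<dots> dx\<^sub>n\<close>; it is unique because countably many charts cover.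
\<close>

definition riemannian_volume ::
  "('m::topological_space, 'n::finite) chart set \<Rightarrow> ('m, 'n) metric \<Rightarrow> 'm measure" where
  "riemannian_volume \<A> g = (THE \<mu>. sets \<mu> = sets (restrict_space borel (points \<A>)) \<and>
     (\<forall>c\<in>\<A>. \<forall>B\<in>sets borel. B \<subseteq> cdom c \<longrightarrow>
        emeasure \<mu> B = (\<integral>\<^sup>+ x \<in> cmap c ` B. ennreal (sqrt (det (gram (g c) x))) \<partial>lborel)))"

definition weighted_volume ::
  "('m::topological_space, 'n::finite) chart set \<Rightarrow> ('m, 'n) metric \<Rightarrow> ('m \<Rightarrow> real) \<Rightarrow> 'm measure"
  where
  "weighted_volume \<A> g f = density (riemannian_volume \<A> g) (\<lambda>p. ennreal (exp (- f p)))"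

subsection \<open>Smooth metric measure spaces\<close>

text \<open>The measure of the space, \<open>weighted_volume \<A> g f\<close>, is determined by the metric and \<open>f\<close>.\<close>

definition complete_smooth_metric_measure_space ::
  "('m::{t2_space,second_countable_topology}, 'n::finite) chart set \<Rightarrow> ('m, 'n) metric
     \<Rightarrow> ('m \<Rightarrow> real) \<Rightarrow> bool" where
  "complete_smooth_metric_measure_space \<A> g f \<longleftrightarrow>
     riemannian_manifold \<A> g \<and> complete_manifold \<A> g \<and> smooth_fun \<A> f"

definition Ric_f_ge ::
  "('m, 'n::finite) chart set \<Rightarrow> ('m, 'n) metric \<Rightarrow> ('m \<Rightarrow> real) \<Rightarrow> real \<Rightarrow> bool" where
  "Ric_f_ge \<A> g f k \<longleftrightarrow>
     (\<forall>c\<in>\<A>. \<forall>x\<in>cimg c. \<forall>u. bakry_emery_ricci (g c) (f \<circ> cinv c) x u u \<ge> k * g c x u u)"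


section \<open>Two-sided immersed hypersurfaces\<close>

text \<open>
  Throughout, \<open>\<S>\<close> is an atlas of the abstract manifold underlying the hypersurface and \<open>F\<close> is its
  immersion into the manifold with atlas \<open>\<A>\<close> and metric \<open>g\<close>.
\<close>

definition local_rep ::
  "('s, 'k::finite) chart \<Rightarrow> ('m, 'n::finite) chart \<Rightarrow> ('s \<Rightarrow> 'm) \<Rightarrow> real^'k \<Rightarrow> real^'n" where
  "local_rep c d F = cmap d \<circ> F \<circ> cinv c"

definition immersion ::
  "('s::topological_space, 'k::finite) chart set \<Rightarrow> ('m::topological_space, 'n::finite) chart set
     \<Rightarrow> ('s \<Rightarrow> 'm) \<Rightarrow> bool" where
  "immersion \<S> \<A> F \<longleftrightarrow>
     continuous_on (points \<S>) F \<and> F ` points \<S> \<subseteq> points \<A> \<and>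
     (\<forall>c\<in>\<S>. \<forall>d\<in>\<A>.
        smooth_on (cmap c ` (cdom c \<inter> F -` cdom d)) (local_rep c d F) \<and>
        (\<forall>x \<in> cmap c ` (cdom c \<inter> F -` cdom d).
           inj (frechet_derivative (local_rep c d F) (at x))))"

definition induced_metric ::
  "('m, 'n::finite) chart set \<Rightarrow> ('m, 'n) metric \<Rightarrow> ('s \<Rightarrow> 'm) \<Rightarrow> ('s, 'k::finite) metric" where
  "induced_metric \<A> g F c x u v =
     (let d = chart_at \<A> (F (cinv c x)); L = frechet_derivative (local_rep c d F) (at x)
      in g d (local_rep c d F x) (L u) (L v))"

text \<open>
  A vector field along \<open>F\<close> is given by its components: \<open>\<nu> p d\<close> are the components, in a chart \<open>d\<close>
  around \<open>F p\<close>, of a tangent vector at \<open>F p\<close>. The first condition is the transformation law of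
  tangent vectors.
\<close>

definition unit_normal ::
  "('s, 'k::finite) chart set \<Rightarrow> ('m, 'n::finite) chart set \<Rightarrow> ('m, 'n) metric \<Rightarrow> ('s \<Rightarrow> 'm)
     \<Rightarrow> ('s \<Rightarrow> ('m, 'n) chart \<Rightarrow> real^'n) \<Rightarrow> bool" where
  "unit_normal \<S> \<A> g F \<nu> \<longleftrightarrow>
     (\<forall>p \<in> points \<S>. \<forall>d\<in>\<A>. \<forall>e\<in>\<A>. F p \<in> cdom d \<inter> cdom e \<longrightarrow>
        \<nu> p e = frechet_derivative (transition d e) (at (cmap d (F p))) (\<nu> p d)) \<and>
     (\<forall>c\<in>\<S>. \<forall>d\<in>\<A>.
        smooth_on (cmap c ` (cdom c \<inter> F -` cdom d)) (\<lambda>x. \<nu> (cinv c x) d) \<and>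
        (\<forall>p \<in> cdom c \<inter> F -` cdom d.
           g d (cmap d (F p)) (\<nu> p d) (\<nu> p d) = 1 \<and>
           (\<forall>u. g d (cmap d (F p)) (\<nu> p d)
                  (frechet_derivative (local_rep c d F) (at (cmap c p)) u) = 0)))"

text \<open>
  The shape operator \<open>A(X) = \<nabla>\<^sub>X \<nu>\<close> at \<open>p\<close>, as an endomorphism of the tangent space of the
  hypersurface in the coordinates \<open>chart_at \<S> p\<close>; \<open>\<nabla>\<^sub>X \<nu>\<close> is tangent to the hypersurface and thus
  the image of a unique vector under the differential of \<open>F\<close>.
\<close>

definition shape_operator ::
  "('s, 'k::finite) chart set \<Rightarrow> ('m, 'n::finite) chart set \<Rightarrow> ('m, 'n) metric \<Rightarrow> ('s \<Rightarrow> 'm)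
     \<Rightarrow> ('s \<Rightarrow> ('m, 'n) chart \<Rightarrow> real^'n) \<Rightarrow> 's \<Rightarrow> real^'k \<Rightarrow> real^'k" where
  "shape_operator \<S> \<A> g F \<nu> p u =
     (let c = chart_at \<S> p; d = chart_at \<A> (F p); x = cmap c p; \<Phi> = local_rep c d F
      in THE w. frechet_derivative \<Phi> (at x) w
                  = cov_deriv_along (g d) \<Phi> (\<lambda>y. \<nu> (cinv c y) d) x u)"

definition mean_curvature ::
  "('s, 'k::finite) chart set \<Rightarrow> ('m, 'n::finite) chart set \<Rightarrow> ('m, 'n) metric \<Rightarrow> ('s \<Rightarrow> 'm)
     \<Rightarrow> ('s \<Rightarrow> ('m, 'n) chart \<Rightarrow> real^'n) \<Rightarrow> 's \<Rightarrow> real" where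
  "mean_curvature \<S> \<A> g F \<nu> p = trace (matrix (shape_operator \<S> \<A> g F \<nu> p))"

text \<open>\<open>\<bar>A\<bar>\<^sup>2 = h\<^sup>i\<^sup>j h(A \<partial>\<^sub>i, A \<partial>\<^sub>j)\<close>, where \<open>h\<close> is the induced metric.\<close>

definition shape_norm_sq ::
  "('s, 'k::finite) chart set \<Rightarrow> ('m, 'n::finite) chart set \<Rightarrow> ('m, 'n) metric \<Rightarrow> ('s \<Rightarrow> 'm)
     \<Rightarrow> ('s \<Rightarrow> ('m, 'n) chart \<Rightarrow> real^'n) \<Rightarrow> 's \<Rightarrow> real" where
  "shape_norm_sq \<S> \<A> g F \<nu> p =
     (let c = chart_at \<S> p; x = cmap c p; h = induced_metric \<A> g F c;
          A = shape_operator \<S> \<A> g F \<nu> p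
      in \<Sum>i\<in>UNIV. \<Sum>j\<in>UNIV. matrix_inv (gram h x) $ i $ j * h x (A (axis i 1)) (A (axis j 1)))"

definition f_minimal ::
  "('s, 'k::finite) chart set \<Rightarrow> ('m, 'n::finite) chart set \<Rightarrow> ('m, 'n) metric \<Rightarrow> ('m \<Rightarrow> real)
     \<Rightarrow> ('s \<Rightarrow> 'm) \<Rightarrow> ('s \<Rightarrow> ('m, 'n) chart \<Rightarrow> real^'n) \<Rightarrow> bool" where
  "f_minimal \<S> \<A> g f F \<nu> \<longleftrightarrow>
     (\<forall>p \<in> points \<S>. mean_curvature \<S> \<A> g F \<nu> p =
        (let d = chart_at \<A> (F p); y = cmap d (F p)
         in g d y (gradient (g d) (f \<circ> cinv d) y) (\<nu> p d)))"

definition grad_norm_sq ::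
  "('s, 'k::finite) chart set \<Rightarrow> ('s, 'k) metric \<Rightarrow> ('s \<Rightarrow> real) \<Rightarrow> 's \<Rightarrow> real" where
  "grad_norm_sq \<S> h \<phi> p =
     (let c = chart_at \<S> p; x = cmap c p; z = gradient (h c) (\<phi> \<circ> cinv c) x in h c x z z)"

definition Ric_f_normal ::
  "('m, 'n::finite) chart set \<Rightarrow> ('m, 'n) metric \<Rightarrow> ('m \<Rightarrow> real) \<Rightarrow> ('s \<Rightarrow> 'm)
     \<Rightarrow> ('s \<Rightarrow> ('m, 'n) chart \<Rightarrow> real^'n) \<Rightarrow> 's \<Rightarrow> real" where
  "Ric_f_normal \<A> g f F \<nu> p =
     (let d = chart_at \<A> (F p)
      in bakry_emery_ricci (g d) (f \<circ> cinv d) (cmap d (F p)) (\<nu> p d) (\<nu> p d))"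

text \<open>
  Stability is nonnegativity of the quadratic form \<open>- \<integral> \<phi> (L\<^sub>f \<phi>) e\<^sup>-\<^sup>f d\<sigma>\<close> on test functions, in its
  first-order form
  \<open>\<integral> (\<bar>\<nabla>\<phi>\<bar>\<^sup>2 - (\<bar>A\<bar>\<^sup>2 + Ric\<^sub>f(\<nu>, \<nu>)) \<phi>\<^sup>2) e\<^sup>-\<^sup>f d\<sigma>\<close>.
\<close>

definition L_f_stable ::
  "('s::topological_space, 'k::finite) chart set \<Rightarrow> ('m, 'n::finite) chart set \<Rightarrow> ('m, 'n) metric
     \<Rightarrow> ('m \<Rightarrow> real) \<Rightarrow> ('s \<Rightarrow> 'm) \<Rightarrow> ('s \<Rightarrow> ('m, 'n) chart \<Rightarrow> real^'n) \<Rightarrow> bool" where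
  "L_f_stable \<S> \<A> g f F \<nu> \<longleftrightarrow>
     (\<forall>\<phi>. test_function \<S> \<phi> \<longrightarrow>
        0 \<le> (\<integral>p. grad_norm_sq \<S> (induced_metric \<A> g F) \<phi> p
                 - (shape_norm_sq \<S> \<A> g F \<nu> p + Ric_f_normal \<A> g f F \<nu> p) * (\<phi> p)\<^sup>2
               \<partial>weighted_volume \<S> (induced_metric \<A> g F) (f \<circ> F)))"

definition finite_weighted_volume ::
  "('s::topological_space, 'k::finite) chart set \<Rightarrow> ('m, 'n::finite) chart set \<Rightarrow> ('m, 'n) metric
     \<Rightarrow> ('m \<Rightarrow> real) \<Rightarrow> ('s \<Rightarrow> 'm) \<Rightarrow> bool" where
  "finite_weighted_volume \<S> \<A> g f F \<longleftrightarrow>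
     emeasure (weighted_volume \<S> (induced_metric \<A> g F) (f \<circ> F)) (points \<S>) < \<infinity>"

end

theory Submission
  imports Defs
begin

text \<open>
  Completeness of a Riemannian manifold yields compactly supported smooth functions \<open>u\<close> with
  \<open>\<bar>du\<bar> \<le> 1\<close> which are arbitrarily large at some point \<open>p\<close>, hence arbitrarily large on a fixed
  neighbourhood \<open>W\<close> of \<open>p\<close>. Testing the stability of \<open>\<Sigma>\<close> with such a \<open>u\<close> gives
  \<open>k \<integral> u\<^sup>2 e\<^sup>-\<^sup>f d\<sigma> \<le> \<integral> \<bar>\<nabla>u\<bar>\<^sup>2 e\<^sup>-\<^sup>f d\<sigma> \<le> vol\<^sub>f(\<Sigma>)\<close>, because \<open>\<bar>A\<bar>\<^sup>2 + Ric\<^sub>f(\<nu>, \<nu>) \<ge> k\<close>; this contradicts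
  the finiteness of \<open>vol\<^sub>f(\<Sigma>)\<close> and the positivity of \<open>vol\<^sub>f(W)\<close>. The stability integrand is
  meaningful because \<open>\<bar>A\<bar>\<^sup>2\<close> and \<open>Ric\<^sub>f(\<nu>, \<nu>)\<close> do not depend on charts and are therefore continuous.

  The large functions are found without smoothing the distance function: if
  \<open>N(p) = sup u(p)\<close> were finite everywhere, then \<open>N\<close> would descend at a definite rate from every
  point, which is impossible on a complete space.
\<close>

subsection \<open>Calculus of smooth maps\<close>

text \<open>Members of the class in the supremum must stay smooth, compactly supported and of slope
  at most one under whatever the descent argument does to them. Two operations achieve this:
  composition with a function of slope in [0, 1] that vanishes at 0, and a smoothed maximum with an
  arbitrarily small loss. A maximum is available for finitely many functions only, which is why a
  compact shell around the point is used. The obstacle lies in the definitions.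
  \<open>chart_at\<close> may jump from point to point, so a quantity evaluated in it is not visibly
  measurable along \<Sigma>; naturality under local isometries is therefore proved for each
  ingredient, down to curvature and the derivative of the normal. The integral in
  \<open>L_f_stable\<close> has the default value 0 on a non-integrable function, so stability says
  something only once integrability is established. The Riemannian volume is a definite description
  and acquires its properties only after existence and uniqueness are proved, which costs the change
  of variables formula.\<close>

lemma higher_differentiable_on_cong:
  assumes "open S" "\<And>x. x \<in> S \<Longrightarrow> f x = g x"
  shows "higher_differentiable_on k S f \<longleftrightarrow> higher_differentiable_on k S g"
proof -
  have *: "higher_differentiable_on k S g"
    if "higher_differentiable_on k S f" "\<And>x. x \<in> S \<Longrightarrow> f x = g x" for f g
    using that
  proof (induction k arbitrary: f g)
    case 0
    then show ?case by (simp cong: continuous_on_cong)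
  next
    case (Suc k)
    have d: "f differentiable (at x)" if "x \<in> S" for x using Suc that by auto
    have d': "g differentiable (at x)" if "x \<in> S" for x
      using has_derivative_transform_within_open [where f=f and g=g, OF _ assms(1) that] d[OF that] Suc.prems(2)
      unfolding differentiable_def by blast
    have "frechet_derivative f (at x) = frechet_derivative g (at x)" if "x \<in> S" for x
      using frechet_derivative_transform_within_open[OF d assms(1)] Suc.prems(2) that by blast
    then have "higher_differentiable_on k S (\<lambda>x. frechet_derivative g (at x) v)" for v
      using Suc.IH[of "\<lambda>x. frechet_derivative f (at x) v" "\<lambda>x. frechet_derivative g (at x) v"] Suc.prems
      by simp
    then show ?case using d' by simp
  qed
  from *[of f g] *[of g f] assms(2) show ?thesis by auto
qed

text \<open>Lets an induction step exhibit the derivative in closed form as \<open>D\<close>; the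
  recursion itself speaks only of \<open>frechet_derivative\<close>.\<close>

lemma higher_differentiable_on_SucI:
  assumes "open S" "\<And>x. x \<in> S \<Longrightarrow> (f has_derivative D x) (at x)"
    "\<And>v. higher_differentiable_on k S (\<lambda>x. D x v)"
  shows "higher_differentiable_on (Suc k) S f"
proof -
  have "frechet_derivative f (at x) v = D x v" if "x \<in> S" for x v
    using assms(2)[OF that] frechet_derivative_at by metis
  then have "higher_differentiable_on k S (\<lambda>x. frechet_derivative f (at x) v)" for v
    by (rule iffD2[OF higher_differentiable_on_cong[OF assms(1)] assms(3)])
  then show ?thesis using assms(2) by (auto simp: differentiable_def)
qed

lemma higher_differentiable_on_SucD:
  assumes "higher_differentiable_on (Suc k) S f"
  shows "\<And>x. x \<in> S \<Longrightarrow> (f has_derivative frechet_derivative f (at x)) (at x)"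
    and "\<And>v. higher_differentiable_on k S (\<lambda>x. frechet_derivative f (at x) v)"
  using assms by (auto simp flip: frechet_derivative_works)

lemma higher_differentiable_on_SucD':
  "higher_differentiable_on (Suc k) S f \<Longrightarrow> higher_differentiable_on k S f"
proof (induction k arbitrary: f)
  case 0
  then show ?case
    by (auto intro!: differentiable_imp_continuous_on
        simp: differentiable_on_def differentiable_at_withinI)
qed auto

lemma higher_differentiable_on_subset:
  "higher_differentiable_on k S f \<Longrightarrow> T \<subseteq> S \<Longrightarrow> higher_differentiable_on k T f"
  by (induction k arbitrary: f) (auto intro: continuous_on_subset)

lemma higher_differentiable_on_const: "higher_differentiable_on k S (\<lambda>x. c)"
  by (induction k arbitrary: c) auto

lemma higher_differentiable_on_linear_compose:
  assumes "open S" "bounded_linear L" "higher_differentiable_on k S f"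
  shows "higher_differentiable_on k S (\<lambda>x. L (f x))"
  using assms(3)
proof (induction k arbitrary: f)
  case 0
  then show ?case using assms(2) by (simp add: bounded_linear.continuous_on)
next
  case (Suc k)
  show ?case
    by (rule higher_differentiable_on_SucI[OF assms(1) bounded_linear.has_derivative[OF assms(2)]])
      (use Suc higher_differentiable_on_SucD[OF Suc.prems] in auto)
qed

lemma higher_differentiable_on_add:
  assumes "open S" "higher_differentiable_on k S f" "higher_differentiable_on k S g"
  shows "higher_differentiable_on k S (\<lambda>x. f x + g x)"
  using assms(2,3)
proof (induction k arbitrary: f g)
  case 0
  then show ?case by (simp add: continuous_on_add)
next
  case (Suc k)
  note f = higher_differentiable_on_SucD[OF Suc.prems(1)]
  note g = higher_differentiable_on_SucD[OF Suc.prems(2)]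
  show ?case
    by (rule higher_differentiable_on_SucI[OF assms(1) has_derivative_add[OF f(1) g(1)]])
      (use Suc.IH[OF f(2) g(2)] in auto)
qed

lemma higher_differentiable_on_sum:
  assumes "open S" "\<And>i. i \<in> I \<Longrightarrow> higher_differentiable_on k S (f i)"
  shows "higher_differentiable_on k S (\<lambda>x. \<Sum>i\<in>I. f i x)"
  using assms(2)
  by (induction I rule: infinite_finite_induct)
     (auto intro!: higher_differentiable_on_add higher_differentiable_on_const assms(1))

lemma higher_differentiable_on_bilinear:
  assumes "open S" "bounded_bilinear B"
    "higher_differentiable_on k S f" "higher_differentiable_on k S g"
  shows "higher_differentiable_on k S (\<lambda>x. B (f x) (g x))"
  using assms(3,4)
proof (induction k arbitrary: f g)
  case 0
  then show ?case using assms(2) by (simp add: bounded_bilinear.continuous_on)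
next
  case (Suc k)
  note f = higher_differentiable_on_SucD[OF Suc.prems(1)]
  note g = higher_differentiable_on_SucD[OF Suc.prems(2)]
  note f' = higher_differentiable_on_SucD'[OF Suc.prems(1)]
  note g' = higher_differentiable_on_SucD'[OF Suc.prems(2)]
  show ?case
    by (rule higher_differentiable_on_SucI[OF assms(1) bounded_bilinear.FDERIV[OF assms(2) f(1) g(1)]])
      (use higher_differentiable_on_add[OF assms(1) Suc.IH[OF f' g(2)] Suc.IH[OF f(2) g']] in auto)
qed

lemma linear_Basis_expansion:
  fixes L :: "'a::euclidean_space \<Rightarrow> 'b::real_vector"
  assumes "linear L"
  shows "L v = (\<Sum>b\<in>Basis. (v \<bullet> b) *\<^sub>R L b)"
proof -
  have "L v = L (\<Sum>b\<in>Basis. (v \<bullet> b) *\<^sub>R b)" by (simp add: euclidean_representation)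
  also have "\<dots> = (\<Sum>b\<in>Basis. (v \<bullet> b) *\<^sub>R L b)"
    using assms by (simp add: linear_sum linear_scale)
  finally show ?thesis .
qed

text \<open>The chain rule gives the derivative of f at g x in a direction that moves with x,
  whereas the recursion controls fixed directions only. Expanding the moving direction in
  \<open>Basis\<close> leaves products of C^k functions, each with one factor to which the induction
  hypothesis for composites applies.\<close>

lemma higher_differentiable_on_compose:
  assumes "open S" "open T" "g ` S \<subseteq> T"
    "higher_differentiable_on k T f" "higher_differentiable_on k S g"
  shows "higher_differentiable_on k S (\<lambda>x. f (g x))"
  using assms(3-5)
proof (induction k arbitrary: f g)
  case 0
  then show ?case by (auto intro: continuous_on_compose2)
next
  case (Suc k)
  note f = higher_differentiable_on_SucD[OF Suc.prems(2)]
  note g = higher_differentiable_on_SucD[OF Suc.prems(3)]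
  have lin: "linear (frechet_derivative f (at (g x)))" if "x \<in> S" for x
    using f(1)[of "g x"] Suc.prems(1) that has_derivative_linear by blast
  have eq: "frechet_derivative f (at (g x)) (frechet_derivative g (at x) v)
     = (\<Sum>b\<in>Basis. (frechet_derivative g (at x) v \<bullet> b) *\<^sub>R frechet_derivative f (at (g x)) b)"
    if "x \<in> S" for x v
    by (rule linear_Basis_expansion[OF lin[OF that]])
  have "higher_differentiable_on k S
      (\<lambda>x. \<Sum>b\<in>Basis. (frechet_derivative g (at x) v \<bullet> b) *\<^sub>R frechet_derivative f (at (g x)) b)" for v
    by (intro higher_differentiable_on_sum assms(1)
        higher_differentiable_on_bilinear[OF _ bounded_bilinear_scaleR]
        higher_differentiable_on_linear_compose[OF _ bounded_linear_inner_left] g(2)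
        Suc.IH[OF Suc.prems(1) f(2)] higher_differentiable_on_SucD'[OF Suc.prems(3)])
  then have "higher_differentiable_on k S
      (\<lambda>x. frechet_derivative f (at (g x)) (frechet_derivative g (at x) v))" for v
    by (subst higher_differentiable_on_cong[OF assms(1) eq])
  then show ?case
    using Suc.prems(1) f(1) g(1)
    by (intro higher_differentiable_on_SucI[OF assms(1), where D="\<lambda>x v. frechet_derivative f (at (g x)) (frechet_derivative g (at x) v)"])
      (auto intro!: has_derivative_compose[OF g(1) f(1)])
qed

lemma higher_differentiable_on_local:
  assumes "\<And>x. x \<in> S \<Longrightarrow> \<exists>U. open U \<and> x \<in> U \<and> higher_differentiable_on k U f"
  shows "higher_differentiable_on k S f"
  using assms
proof (induction k arbitrary: f)
  case 0
  have "isCont f x" if x: "x \<in> S" for x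
  proof -
    obtain U where "open U" "x \<in> U" "continuous_on U f" using 0[OF x] by auto
    then show ?thesis by (simp add: continuous_on_eq_continuous_at)
  qed
  then show ?case by (simp add: continuous_at_imp_continuous_on)
next
  case (Suc k)
  show ?case
  proof (simp, intro conjI ballI allI)
    show "f differentiable at x" if "x \<in> S" for x using Suc.prems[OF that] by auto
    show "higher_differentiable_on k S (\<lambda>x. frechet_derivative f (at x) v)" for v
      by (rule Suc.IH) (use Suc.prems in fastforce)
  qed
qed

section \<open>Closure properties of smooth maps\<close>

lemma smooth_on_cong:
  "open S \<Longrightarrow> (\<And>x. x \<in> S \<Longrightarrow> f x = g x) \<Longrightarrow> smooth_on S f \<longleftrightarrow> smooth_on S g"
  unfolding smooth_on_def using higher_differentiable_on_cong by metis

lemma smooth_on_subset: "smooth_on S f \<Longrightarrow> T \<subseteq> S \<Longrightarrow> smooth_on T f"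
  unfolding smooth_on_def using higher_differentiable_on_subset by blast

lemma smooth_on_local:
  assumes "\<And>x. x \<in> S \<Longrightarrow> \<exists>U. open U \<and> x \<in> U \<and> smooth_on U f"
  shows "smooth_on S f"
  unfolding smooth_on_def
  using assms by (intro allI higher_differentiable_on_local) (auto simp: smooth_on_def)

lemma smooth_on_imp_continuous_on: "smooth_on S f \<Longrightarrow> continuous_on S f"
  unfolding smooth_on_def using higher_differentiable_on.simps(1) by blast

lemma smooth_on_has_derivative:
  "smooth_on S f \<Longrightarrow> x \<in> S \<Longrightarrow> (f has_derivative frechet_derivative f (at x)) (at x)"
  unfolding smooth_on_def using higher_differentiable_on_SucD(1) by blast

lemma smooth_on_linear_frechet:
  "smooth_on S f \<Longrightarrow> x \<in> S \<Longrightarrow> linear (frechet_derivative f (at x))"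
  using smooth_on_has_derivative has_derivative_linear by blast

lemma smooth_on_frechet_derivative:
  "smooth_on S f \<Longrightarrow> smooth_on S (\<lambda>x. frechet_derivative f (at x) v)"
  unfolding smooth_on_def by (rule allI, rule higher_differentiable_on_SucD(2), erule allE)

lemma smooth_onI_derivative:
  assumes "open S" "\<And>x. x \<in> S \<Longrightarrow> (f has_derivative D x) (at x)" "\<And>v. smooth_on S (\<lambda>x. D x v)"
  shows "smooth_on S f"
  unfolding smooth_on_def
proof
  fix k
  \<comment> \<open>Order k + 1 is proved and then lowered to k, so that k = 0 needs no separate
    continuity argument.\<close>
  show "higher_differentiable_on k S f"
    by (rule higher_differentiable_on_SucD', rule higher_differentiable_on_SucI[OF assms(1,2)])
      (use assms(3) in \<open>auto simp: smooth_on_def\<close>)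
qed

lemma smooth_on_const: "smooth_on S (\<lambda>x. c)"
  unfolding smooth_on_def using higher_differentiable_on_const by blast

lemma smooth_on_ident: "open S \<Longrightarrow> smooth_on S (\<lambda>x. x)"
  by (rule smooth_onI_derivative[where D="\<lambda>x v. v"]) (auto intro: smooth_on_const has_derivative_ident)

lemma smooth_on_linear_compose:
  "open S \<Longrightarrow> bounded_linear L \<Longrightarrow> smooth_on S f \<Longrightarrow> smooth_on S (\<lambda>x. L (f x))"
  unfolding smooth_on_def using higher_differentiable_on_linear_compose by blast

lemma smooth_on_add:
  "open S \<Longrightarrow> smooth_on S f \<Longrightarrow> smooth_on S g \<Longrightarrow> smooth_on S (\<lambda>x. f x + g x)"
  unfolding smooth_on_def using higher_differentiable_on_add by blast

lemma smooth_on_minus: "open S \<Longrightarrow> smooth_on S f \<Longrightarrow> smooth_on S (\<lambda>x. - f x)"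
  by (rule smooth_on_linear_compose[OF _ bounded_linear_minus[OF bounded_linear_ident]])

lemma smooth_on_diff:
  "open S \<Longrightarrow> smooth_on S f \<Longrightarrow> smooth_on S g \<Longrightarrow> smooth_on S (\<lambda>x. f x - g x)"
  using smooth_on_add[of S f "\<lambda>x. - g x"] smooth_on_minus[of S g] by simp

lemma smooth_on_sum:
  "open S \<Longrightarrow> (\<And>i. i \<in> I \<Longrightarrow> smooth_on S (f i)) \<Longrightarrow> smooth_on S (\<lambda>x. \<Sum>i\<in>I. f i x)"
  unfolding smooth_on_def using higher_differentiable_on_sum[of S I] by blast

lemma smooth_on_bilinear:
  "open S \<Longrightarrow> bounded_bilinear B \<Longrightarrow> smooth_on S f \<Longrightarrow> smooth_on S g \<Longrightarrow> smooth_on S (\<lambda>x. B (f x) (g x))"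
  unfolding smooth_on_def using higher_differentiable_on_bilinear by blast

lemmas smooth_on_mult = smooth_on_bilinear[OF _ bounded_bilinear_mult]
lemmas smooth_on_scaleR = smooth_on_bilinear[OF _ bounded_bilinear_scaleR]
lemmas smooth_on_inner_const = smooth_on_linear_compose[OF _ bounded_linear_inner_left]
lemmas smooth_on_vec_nth = smooth_on_linear_compose[OF _ bounded_linear_vec_nth]

lemma smooth_on_prod:
  fixes f :: "'i \<Rightarrow> 'a::euclidean_space \<Rightarrow> real"
  shows "open S \<Longrightarrow> (\<And>i. i \<in> I \<Longrightarrow> smooth_on S (f i)) \<Longrightarrow> smooth_on S (\<lambda>x. \<Prod>i\<in>I. f i x)"
  by (induction I rule: infinite_finite_induct) (auto intro!: smooth_on_const smooth_on_mult)

lemma smooth_on_vec_lambda: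
  fixes f :: "'n::finite \<Rightarrow> 'a::euclidean_space \<Rightarrow> real"
  assumes "open S" "\<And>i. smooth_on S (f i)"
  shows "smooth_on S (\<lambda>x. \<chi> i. f i x)"
proof -
  have "smooth_on S (\<lambda>x. \<Sum>i\<in>UNIV. f i x *\<^sub>R (axis i 1 :: real^'n))"
    by (intro smooth_on_sum smooth_on_scaleR smooth_on_const assms)
  moreover have "(\<Sum>i\<in>UNIV. f i x *\<^sub>R (axis i 1 :: real^'n)) = (\<chi> i. f i x)" for x :: 'a
    by (simp add: vec_eq_iff axis_def if_distrib cong: if_cong)
  ultimately show ?thesis by (simp only:)
qed

lemma smooth_on_det:
  fixes M :: "'a::euclidean_space \<Rightarrow> real^'n^'n"
  assumes "open S" "\<And>i j. smooth_on S (\<lambda>x. M x $ i $ j)"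
  shows "smooth_on S (\<lambda>x. det (M x))"
  unfolding det_def by (intro smooth_on_sum smooth_on_mult smooth_on_const smooth_on_prod assms)

lemma smooth_on_compose:
  "open S \<Longrightarrow> open T \<Longrightarrow> g ` S \<subseteq> T \<Longrightarrow> smooth_on T f \<Longrightarrow> smooth_on S g \<Longrightarrow> smooth_on S (\<lambda>x. f (g x))"
  unfolding smooth_on_def using higher_differentiable_on_compose by blast

text \<open>The derivative of the inverse is built from products of inverses, so each order follows
  from the one below.\<close>

lemma smooth_on_inverse_ident: "smooth_on (- {0::real}) inverse"
  unfolding smooth_on_def
proof
  fix k
  show "higher_differentiable_on k (- {0::real}) inverse"
  proof (induction k)
    case 0
    then show ?case by (auto intro!: continuous_intros)
  next
    case (Suc k)
    show ?case
      by (rule higher_differentiable_on_SucI[where D="\<lambda>x v. - (inverse x * v * inverse x)"])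
        (auto intro!: has_derivative_inverse'
          higher_differentiable_on_linear_compose[OF _ bounded_linear_minus[OF bounded_linear_ident]]
          higher_differentiable_on_bilinear[OF _ bounded_bilinear_mult] Suc higher_differentiable_on_const)
  qed
qed

lemma smooth_on_divide:
  fixes f g :: "'a::euclidean_space \<Rightarrow> real"
  assumes "open S" "smooth_on S f" "smooth_on S g" "\<And>x. x \<in> S \<Longrightarrow> g x \<noteq> 0"
  shows "smooth_on S (\<lambda>x. f x / g x)"
  unfolding divide_inverse
  by (intro smooth_on_mult smooth_on_compose[OF _ _ _ smooth_on_inverse_ident] assms) (use assms in auto)

lemma smooth_on_exp: "smooth_on UNIV (exp :: real \<Rightarrow> real)"
  unfolding smooth_on_def
proof
  fix k
  show "higher_differentiable_on k UNIV (exp :: real \<Rightarrow> real)"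
  proof (induction k)
    case 0
    then show ?case by (auto intro!: continuous_intros)
  next
    case (Suc k)
    show ?case
      by (rule higher_differentiable_on_SucI[where D="\<lambda>x v. v * exp x"])
        (auto intro!: derivative_eq_intros higher_differentiable_on_bilinear[OF _ bounded_bilinear_mult]
          Suc higher_differentiable_on_const)
  qed
qed

lemma smooth_on_ln: "smooth_on {0::real<..} ln"
  by (rule smooth_onI_derivative[where D="\<lambda>x v. v * inverse x"])
    (auto intro!: derivative_eq_intros smooth_on_mult smooth_on_const
      smooth_on_subset[OF smooth_on_inverse_ident] simp: divide_inverse)

lemma smooth_on_frechet_apply:
  assumes "open S" "smooth_on S f" "smooth_on S v"
  shows "smooth_on S (\<lambda>x. frechet_derivative f (at x) (v x))"
proof -
  have "smooth_on S (\<lambda>x. \<Sum>b\<in>Basis. (v x \<bullet> b) *\<^sub>R frechet_derivative f (at x) b)"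
    by (intro smooth_on_sum smooth_on_scaleR smooth_on_inner_const smooth_on_frechet_derivative assms)
  then show ?thesis
    by (rule iffD2[OF smooth_on_cong[OF assms(1)], rotated])
      (rule linear_Basis_expansion[OF smooth_on_linear_frechet[OF assms(2)]])
qed

subsection \<open>A smooth truncation\<close>

text \<open>The functions p(1/x) exp(-1/x), extended by 0 to x \<le> 0. The whole family is taken
  because it is closed under differentiation; the standard flat function is the case p = 1.\<close>

definition flat_poly :: "real poly \<Rightarrow> real \<Rightarrow> real" where
  "flat_poly p x = (if x > 0 then poly p (1 / x) * exp (- (1 / x)) else 0)"

text \<open>After the substitution t = 1/x this is the decay of a polynomial against the
  exponential.\<close>

lemma flat_poly_tendsto_0: "(flat_poly p \<longlongrightarrow> 0) (at_right 0)"
proof -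
  have "((\<lambda>t. \<Sum>i\<le>degree p. coeff p i * (t ^ i / exp t)) \<longlongrightarrow> (\<Sum>i\<le>degree p. coeff p i * 0)) at_top"
    by (intro tendsto_intros tendsto_power_div_exp_0)
  then have "((\<lambda>t. poly p t * exp (- t)) \<longlongrightarrow> 0) at_top"
    by (simp add: poly_altdef sum_distrib_right exp_minus divide_inverse mult.assoc)
  then have "((\<lambda>x. poly p (inverse x) * exp (- inverse x)) \<longlongrightarrow> 0) (at_right 0)"
    by (rule filterlim_compose[OF _ filterlim_inverse_at_top_right])
  then show ?thesis
    by (rule Lim_transform_eventually)
      (auto simp: flat_poly_def inverse_eq_divide eventually_at_right_less elim: eventually_mono
        intro!: eventually_at_rightI[of 0 1])
qed

text \<open>The polynomial X^2 (p - p') collects -p'(1/x)/x^2 from the polynomial factor and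
  p(1/x)/x^2 from the exponential.\<close>

lemma flat_poly_has_derivative:
  "(flat_poly p has_real_derivative flat_poly ([:0, 0, 1:] * (p - pderiv p)) x) (at x)"
proof -
  consider "x > 0" | "x < 0" | "x = 0" by linarith
  then show ?thesis
  proof cases
    case 1
    have "((\<lambda>x. poly p (1 / x) * exp (- (1 / x))) has_real_derivative
        flat_poly ([:0, 0, 1:] * (p - pderiv p)) x) (at x)"
      using 1 by (auto intro!: derivative_eq_intros DERIV_chain2[OF poly_DERIV]
          simp: flat_poly_def field_simps power2_eq_square)
    then show ?thesis
      by (rule has_field_derivative_transform_within_open[of _ _ _ "{0<..}"])
        (use 1 in \<open>auto simp: flat_poly_def\<close>)
  next
    case 2
    have "((\<lambda>x. 0) has_real_derivative 0) (at x)" by simp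
    then have "(flat_poly p has_real_derivative 0) (at x)"
      by (rule has_field_derivative_transform_within_open[of _ _ _ "{..<0}"])
        (use 2 in \<open>auto simp: flat_poly_def\<close>)
    then show ?thesis using 2 by (simp add: flat_poly_def)
  next
    case 3
    \<comment> \<open>For y > 0 the difference quotient at 0 is again a \<open>flat_poly\<close>,
      with X p in place of p, so its limit is already known.\<close>
    have "((\<lambda>y. flat_poly p y / y) \<longlongrightarrow> 0) (at_right 0)"
      using flat_poly_tendsto_0[of "[:0, 1:] * p"]
      by (rule Lim_transform_eventually)
        (auto simp: flat_poly_def intro!: eventually_at_rightI[of 0 1])
    moreover have "((\<lambda>y. flat_poly p y / y) \<longlongrightarrow> 0) (at_left 0)"
      by (rule Lim_transform_eventually[of "\<lambda>_. 0"])
        (auto simp: flat_poly_def intro!: eventually_at_leftI[of "-1"])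
    ultimately show ?thesis
      using 3 by (simp add: has_field_derivative_iff filterlim_at_split flat_poly_def)
  qed
qed

lemma smooth_on_flat_poly: "smooth_on UNIV (flat_poly p)"
  unfolding smooth_on_def
proof
  fix k
  show "higher_differentiable_on k UNIV (flat_poly p)"
  proof (induction k arbitrary: p)
    case 0
    then show ?case
      by (auto intro!: continuous_at_imp_continuous_on DERIV_isCont[OF flat_poly_has_derivative])
  next
    case (Suc k)
    show ?case
      by (rule higher_differentiable_on_SucI[where D="\<lambda>x v. flat_poly ([:0, 0, 1:] * (p - pderiv p)) x * v"])
        (auto intro!: higher_differentiable_on_bilinear[OF _ bounded_bilinear_mult] Suc
          higher_differentiable_on_const
          flat_poly_has_derivative[unfolded has_field_derivative_def, simplified])
  qed
qed

text \<open>The quotient F(1 - x) / (F(x) + F(1 - x)) for the standard flat F; its denominator never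
  vanishes because x and 1 - x are not both nonpositive.\<close>

lemma smooth_step_exists:
  obtains \<sigma> :: "real \<Rightarrow> real" where "smooth_on UNIV \<sigma>" "\<And>x. 0 \<le> \<sigma> x" "\<And>x. \<sigma> x \<le> 1"
    "\<And>x. x \<le> 0 \<Longrightarrow> \<sigma> x = 1" "\<And>x. x \<ge> 1 \<Longrightarrow> \<sigma> x = 0"
proof -
  let ?F = "flat_poly 1"
  have pos: "?F x \<ge> 0" "x > 0 \<Longrightarrow> ?F x > 0" "x \<le> 0 \<Longrightarrow> ?F x = 0" for x
    by (auto simp: flat_poly_def)
  have sum_pos: "?F x + ?F (1 - x) > 0" for x
    using pos(1)[of x] pos(1)[of "1 - x"] pos(2)[of x] pos(2)[of "1 - x"] by linarith
  have sm: "smooth_on UNIV (\<lambda>x. ?F (1 - x))"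
    by (intro smooth_on_compose[OF _ _ _ smooth_on_flat_poly] smooth_on_diff smooth_on_const
        smooth_on_ident) auto
  show ?thesis
  proof (rule that[of "\<lambda>x. ?F (1 - x) / (?F x + ?F (1 - x))"])
    show "smooth_on UNIV (\<lambda>x. ?F (1 - x) / (?F x + ?F (1 - x)))"
      by (intro smooth_on_divide smooth_on_add sm smooth_on_flat_poly)
        (auto simp: less_imp_neq[OF sum_pos, symmetric])
    show "0 \<le> ?F (1 - x) / (?F x + ?F (1 - x))" for x
      using sum_pos[of x] pos(1)[of "1 - x"] by simp
    show "?F (1 - x) / (?F x + ?F (1 - x)) \<le> 1" for x
      using sum_pos[of x] pos(1)[of x] by simp
    show "?F (1 - x) / (?F x + ?F (1 - x)) = 1" if "x \<le> 0" for x
      using that pos(2)[of "1 - x"] pos(3)[of x] by simp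
    show "?F (1 - x) / (?F x + ?F (1 - x)) = 0" if "x \<ge> 1" for x
      using that pos(3)[of "1 - x"] by simp
  qed
qed

text \<open>\<theta> is the antiderivative of a smooth step falling from 1 to 0 over
  [s - \<delta>, s]: the identity up to s - \<delta>, constant from s on. Slope in [0, 1] preserves
  gradient bounds under composition, and \<theta> 0 = 0 preserves compact support.\<close>

lemma smooth_truncation_exists:
  fixes s \<delta> :: real
  assumes "0 < \<delta>" "\<delta> \<le> s"
  obtains \<theta> \<theta>' :: "real \<Rightarrow> real" where "smooth_on UNIV \<theta>" "\<And>x. (\<theta> has_real_derivative \<theta>' x) (at x)"
    "\<And>x. 0 \<le> \<theta>' x" "\<And>x. \<theta>' x \<le> 1" "\<theta> 0 = 0" "\<And>x. x \<ge> s \<Longrightarrow> \<theta> x = \<theta> s" "s - \<delta> \<le> \<theta> s"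
proof -
  obtain \<sigma> :: "real \<Rightarrow> real" where \<sigma>: "smooth_on UNIV \<sigma>" "\<And>x. 0 \<le> \<sigma> x" "\<And>x. \<sigma> x \<le> 1"
    "\<And>x. x \<le> 0 \<Longrightarrow> \<sigma> x = 1" "\<And>x. x \<ge> 1 \<Longrightarrow> \<sigma> x = 0" using smooth_step_exists by metis
  define \<theta>' where "\<theta>' x = \<sigma> ((x - (s - \<delta>)) / \<delta>)" for x
  have sm: "smooth_on UNIV \<theta>'"
    unfolding \<theta>'_def
    by (intro smooth_on_compose[OF _ _ _ \<sigma>(1)] smooth_on_divide smooth_on_diff smooth_on_const
        smooth_on_ident) (use assms in auto)
  have "\<exists>F. \<forall>x. (-\<infinity>::ereal) < x \<longrightarrow> x < \<infinity> \<longrightarrow> (F has_vector_derivative \<theta>' x) (at x)"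
    by (rule einterval_antiderivative)
      (use smooth_on_imp_continuous_on[OF sm] in \<open>auto simp: continuous_on_eq_continuous_at\<close>)
  then obtain F where F: "(F has_real_derivative \<theta>' x) (at x)" for x
    by (auto simp: has_real_derivative_iff_has_vector_derivative)
  define \<theta> where "\<theta> x = F x - F 0" for x
  have d: "(\<theta> has_real_derivative \<theta>' x) (at x)" for x
    unfolding \<theta>_def using F by (auto intro!: derivative_eq_intros)
  have range: "0 \<le> \<theta>' x" "\<theta>' x \<le> 1" for x
    unfolding \<theta>'_def using \<sigma> by auto
  show ?thesis
  proof (rule that[of \<theta> \<theta>'])
    show "smooth_on UNIV \<theta>"
      by (rule smooth_onI_derivative[where D="\<lambda>x v. \<theta>' x * v"])
        (auto intro!: smooth_on_mult sm smooth_on_const d[unfolded has_field_derivative_def, simplified])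
    show "\<theta> x = \<theta> s" if "x \<ge> s" for x
    proof (cases "x = s")
      case False
      then have "s < x" using that by simp
      from MVT2[OF this d] obtain z where "z > s" "z < x" "\<theta> x - \<theta> s = (x - s) * \<theta>' z"
        by blast
      moreover have "\<theta>' z = 0"
        unfolding \<theta>'_def using \<open>z > s\<close> assms by (intro \<sigma>(5)) (auto simp: field_simps)
      ultimately show ?thesis by simp
    qed auto
    have "\<theta> (s - \<delta>) = s - \<delta>"
    proof (cases "s = \<delta>")
      case False
      then obtain z where "z > 0" "z < s - \<delta>" "\<theta> (s - \<delta>) - \<theta> 0 = (s - \<delta> - 0) * \<theta>' z"
        using MVT2[of 0 "s - \<delta>" \<theta> \<theta>'] d assms by auto
      moreover have "\<theta>' z = 1"
        unfolding \<theta>'_def using \<open>z < s - \<delta>\<close> assms by (intro \<sigma>(4)) (auto simp: field_simps)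
      ultimately show ?thesis by (simp add: \<theta>_def)
    qed (simp add: \<theta>_def)
    moreover have "\<theta> (s - \<delta>) \<le> \<theta> s"
      by (rule DERIV_nonneg_imp_nondecreasing) (use d range assms in force)+
    ultimately show "s - \<delta> \<le> \<theta> s" by simp
  qed (use d range in \<open>auto simp: \<theta>_def\<close>)
qed

subsection \<open>Symmetry of second derivatives\<close>

text \<open>Two applications of the mean value theorem, along u and then along v. The left-hand side
  does not change when u and v are exchanged, which is what makes it useful.\<close>

lemma second_difference_mean_value:
  fixes f :: "'a::euclidean_space \<Rightarrow> real"
  assumes "open S" "smooth_on S f" "h > 0"
    and S: "\<And>s t. 0 \<le> s \<Longrightarrow> s \<le> h \<Longrightarrow> 0 \<le> t \<Longrightarrow> t \<le> h \<Longrightarrow> x + s *\<^sub>R u + t *\<^sub>R v \<in> S"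
  obtains \<xi> \<eta> where "0 < \<xi>" "\<xi> < h" "0 < \<eta>" "\<eta> < h"
    "f (x + h *\<^sub>R u + h *\<^sub>R v) - f (x + h *\<^sub>R u) - f (x + h *\<^sub>R v) + f x
      = h * h * frechet_derivative (\<lambda>y. frechet_derivative f (at y) u) (at (x + \<xi> *\<^sub>R u + \<eta> *\<^sub>R v)) v"
proof -
  define \<phi> where "\<phi> s = f (x + s *\<^sub>R u + h *\<^sub>R v) - f (x + s *\<^sub>R u)" for s
  define D where "D = (\<lambda>y. frechet_derivative f (at y) u)"
  have S0: "x + s *\<^sub>R u \<in> S" if "0 \<le> s" "s \<le> h" for s
    using S[of s 0] that assms(3) by simp
  have aff: "((\<lambda>s. a + s *\<^sub>R u + b) has_derivative (\<lambda>k. k *\<^sub>R u)) (at s)" for a b u :: 'a and s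
    by (auto intro!: derivative_eq_intros)
  have line: "((\<lambda>s. g (a + s *\<^sub>R w + b)) has_real_derivative frechet_derivative g (at (a + s *\<^sub>R w + b)) w) (at s)"
    if "smooth_on S g" "a + s *\<^sub>R w + b \<in> S" for g a w b s
    using has_derivative_compose[OF aff smooth_on_has_derivative[OF that]]
      smooth_on_linear_frechet[OF that]
    by (simp add: has_field_derivative_def linear_scale mult_commute_abs)
  have d\<phi>: "(\<phi> has_real_derivative (D (x + s *\<^sub>R u + h *\<^sub>R v) - D (x + s *\<^sub>R u))) (at s)"
    if "0 \<le> s" "s \<le> h" for s
    unfolding \<phi>_def D_def
    using line[OF assms(2), of x s u "h *\<^sub>R v"] line[OF assms(2), of x s u 0] S0[OF that] S[OF that, of h] assms(3)
    by (auto intro!: derivative_eq_intros)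
  obtain \<xi> where \<xi>: "0 < \<xi>" "\<xi> < h"
    "\<phi> h - \<phi> 0 = (h - 0) * (D (x + \<xi> *\<^sub>R u + h *\<^sub>R v) - D (x + \<xi> *\<^sub>R u))"
    using MVT2[OF assms(3) d\<phi>] by blast
  have D: "smooth_on S D" unfolding D_def by (rule smooth_on_frechet_derivative[OF assms(2)])
  have d\<eta>: "((\<lambda>t. D (x + \<xi> *\<^sub>R u + t *\<^sub>R v)) has_real_derivative
     frechet_derivative D (at (x + \<xi> *\<^sub>R u + t *\<^sub>R v)) v) (at t)" if "0 \<le> t" "t \<le> h" for t
    using line[OF D, of "x + \<xi> *\<^sub>R u" t v 0] S[of \<xi> t] \<xi> that by simp
  obtain \<eta> where \<eta>: "0 < \<eta>" "\<eta> < h"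
    "D (x + \<xi> *\<^sub>R u + h *\<^sub>R v) - D (x + \<xi> *\<^sub>R u + 0 *\<^sub>R v)
      = (h - 0) * frechet_derivative D (at (x + \<xi> *\<^sub>R u + \<eta> *\<^sub>R v)) v"
    using MVT2[OF assms(3) d\<eta>] by blast
  show ?thesis
    by (rule that[OF \<xi>(1,2) \<eta>(1,2)]) (use \<xi>(3) \<eta>(3) in \<open>simp add: \<phi>_def D_def algebra_simps\<close>)
qed

text \<open>The symmetric second difference equals h^2 times either mixed derivative at some point
  near x. If the two mixed derivatives differed at x, continuity would keep each within half the gap
  of its value at x, and no common value would be left.\<close>

lemma second_derivative_symmetric_real:
  fixes f :: "'a::euclidean_space \<Rightarrow> real"
  assumes "open S" "smooth_on S f" "x \<in> S"
  shows "frechet_derivative (\<lambda>y. frechet_derivative f (at y) u) (at x) v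
       = frechet_derivative (\<lambda>y. frechet_derivative f (at y) v) (at x) u"
proof (rule ccontr)
  define A where "A u v y = frechet_derivative (\<lambda>y. frechet_derivative f (at y) u) (at y) v" for u v y
  assume "\<not> ?thesis"
  then have ne: "dist (A u v x) (A v u x) / 2 > 0" by (simp add: A_def)
  have cont: "isCont (A u v) x" for u v
    unfolding A_def
    using smooth_on_imp_continuous_on[OF smooth_on_frechet_derivative[OF smooth_on_frechet_derivative[OF assms(2)]]]
    using assms(1,3) continuous_on_eq_continuous_at by blast
  obtain r1 where r1: "r1 > 0" "\<And>y. dist y x < r1 \<Longrightarrow> dist (A u v y) (A u v x) < dist (A u v x) (A v u x) / 2"
    using cont[of u v] ne unfolding continuous_at_eps_delta by metis
  obtain r2 where r2: "r2 > 0" "\<And>y. dist y x < r2 \<Longrightarrow> dist (A v u y) (A v u x) < dist (A u v x) (A v u x) / 2"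
    using cont[of v u] ne unfolding continuous_at_eps_delta by metis
  obtain r3 where r3: "r3 > 0" "ball x r3 \<subseteq> S" using assms openE by blast
  define r where "r = min r1 (min r2 r3)"
  \<comment> \<open>The summand 1 keeps the denominator positive when u = v = 0 and makes the
    estimate \<open>near\<close> strict.\<close>
  define h where "h = r / (norm u + norm v + 1)"
  have r: "r > 0" using r1 r2 r3 by (simp add: r_def)
  have N: "norm u + norm v + 1 > 0" by (smt (verit) norm_ge_zero)
  have h: "h > 0" using r N by (simp add: h_def)
  have near: "norm (s *\<^sub>R u + t *\<^sub>R v) < r" if "0 \<le> s" "s \<le> h" "0 \<le> t" "t \<le> h" for s t
  proof -
    have "norm (s *\<^sub>R u + t *\<^sub>R v) \<le> s * norm u + t * norm v"
      using norm_triangle_ineq[of "s *\<^sub>R u" "t *\<^sub>R v"] that by simp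
    also have "\<dots> \<le> h * norm u + h * norm v"
      using that by (intro add_mono mult_right_mono) auto
    also have "\<dots> < h * (norm u + norm v + 1)" using h by (simp add: algebra_simps)
    finally show ?thesis using N by (simp add: h_def)
  qed
  have inS: "x + s *\<^sub>R u + t *\<^sub>R v \<in> S" if "0 \<le> s" "s \<le> h" "0 \<le> t" "t \<le> h" for s t
  proof -
    have "dist (x + s *\<^sub>R u + t *\<^sub>R v) x < r3"
      using near[OF that] by (simp add: r_def dist_norm add.assoc)
    then show ?thesis using r3(2) by (auto simp: dist_commute)
  qed
  have inS': "x + s *\<^sub>R v + t *\<^sub>R u \<in> S" if "0 \<le> s" "s \<le> h" "0 \<le> t" "t \<le> h" for s t
    using inS[OF that(3,4,1,2)] by (simp add: algebra_simps)
  obtain \<xi> \<eta> where 1: "0 < \<xi>" "\<xi> < h" "0 < \<eta>" "\<eta> < h"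
    "f (x + h *\<^sub>R u + h *\<^sub>R v) - f (x + h *\<^sub>R u) - f (x + h *\<^sub>R v) + f x = h * h * A u v (x + \<xi> *\<^sub>R u + \<eta> *\<^sub>R v)"
    using second_difference_mean_value[OF assms(1,2) h inS] unfolding A_def by blast
  obtain \<xi>' \<eta>' where 2: "0 < \<xi>'" "\<xi>' < h" "0 < \<eta>'" "\<eta>' < h"
    "f (x + h *\<^sub>R v + h *\<^sub>R u) - f (x + h *\<^sub>R v) - f (x + h *\<^sub>R u) + f x = h * h * A v u (x + \<xi>' *\<^sub>R v + \<eta>' *\<^sub>R u)"
    using second_difference_mean_value[OF assms(1,2) h inS'] unfolding A_def by blast
  have "h * h * A u v (x + \<xi> *\<^sub>R u + \<eta> *\<^sub>R v) = h * h * A v u (x + \<xi>' *\<^sub>R v + \<eta>' *\<^sub>R u)"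
    using 1(5) 2(5) by (simp add: algebra_simps)
  then have eq: "A u v (x + \<xi> *\<^sub>R u + \<eta> *\<^sub>R v) = A v u (x + \<xi>' *\<^sub>R v + \<eta>' *\<^sub>R u)" using h by simp
  have "dist (A u v (x + \<xi> *\<^sub>R u + \<eta> *\<^sub>R v)) (A u v x) < dist (A u v x) (A v u x) / 2"
    by (rule r1(2)) (use near[of \<xi> \<eta>] 1 in \<open>simp add: dist_norm r_def add.assoc\<close>)
  moreover have "dist (A v u (x + \<xi>' *\<^sub>R v + \<eta>' *\<^sub>R u)) (A v u x) < dist (A u v x) (A v u x) / 2"
    by (rule r2(2)) (use near[of \<eta>' \<xi>'] 2 in \<open>simp add: dist_norm r_def add.assoc add.commute[of "\<xi>' *\<^sub>R v"]\<close>)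
  ultimately show False
    using dist_triangle3[of "A u v x" "A v u x" "A u v (x + \<xi> *\<^sub>R u + \<eta> *\<^sub>R v)"]
    unfolding eq by linarith
qed

lemma frechet_derivative_inner:
  assumes "f differentiable (at x)"
  shows "frechet_derivative (\<lambda>y. f y \<bullet> b) (at x) v = frechet_derivative f (at x) v \<bullet> b"
  using has_derivative_inner_left[OF assms[unfolded frechet_derivative_works], of b]
  by (metis frechet_derivative_at)

lemma second_derivative_symmetric:
  fixes f :: "'a::euclidean_space \<Rightarrow> 'b::euclidean_space"
  assumes "open S" "smooth_on S f" "x \<in> S"
  shows "frechet_derivative (\<lambda>y. frechet_derivative f (at y) u) (at x) v
       = frechet_derivative (\<lambda>y. frechet_derivative f (at y) v) (at x) u"
proof (rule euclidean_eqI)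
  fix b :: 'b
  have diff: "g differentiable (at y)" if "smooth_on S g" "y \<in> S" for g :: "'a \<Rightarrow> 'b" and y
    using smooth_on_has_derivative[OF that] by (auto simp: differentiable_def)
  have "frechet_derivative (\<lambda>y. frechet_derivative (\<lambda>y. f y \<bullet> b) (at y) u) (at x) v
      = frechet_derivative (\<lambda>y. frechet_derivative f (at y) u) (at x) v \<bullet> b" for u v
  proof -
    have "frechet_derivative (\<lambda>y. frechet_derivative f (at y) u \<bullet> b) (at x)
        = frechet_derivative (\<lambda>y. frechet_derivative (\<lambda>y. f y \<bullet> b) (at y) u) (at x)"
      using diff[OF smooth_on_frechet_derivative[OF assms(2)] assms(3)] frechet_derivative_inner[OF diff[OF assms(2)]]
      by (intro frechet_derivative_transform_within_open[OF _ assms(1,3)]) (auto simp: differentiable_inner)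
    then show ?thesis
      using frechet_derivative_inner[OF diff[OF smooth_on_frechet_derivative[OF assms(2)] assms(3)]] by metis
  qed
  with second_derivative_symmetric_real[OF assms(1) smooth_on_inner_const[OF assms(1,2)] assms(3)]
  show "frechet_derivative (\<lambda>y. frechet_derivative f (at y) u) (at x) v \<bullet> b
       = frechet_derivative (\<lambda>y. frechet_derivative f (at y) v) (at x) u \<bullet> b" by metis
qed

subsection \<open>Smooth families of bilinear maps\<close>

lemma bilinear_Basis_expansion:
  fixes B :: "'a::euclidean_space \<Rightarrow> 'b::euclidean_space \<Rightarrow> 'c::real_vector"
  assumes "bilinear B"
  shows "B a b = (\<Sum>i\<in>Basis. \<Sum>j\<in>Basis. ((a \<bullet> i) * (b \<bullet> j)) *\<^sub>R B i j)"
proof -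
  have "B a b = (\<Sum>i\<in>Basis. (a \<bullet> i) *\<^sub>R B i b)"
    using assms by (intro linear_Basis_expansion) (simp add: bilinear_def)
  also have "\<dots> = (\<Sum>i\<in>Basis. (a \<bullet> i) *\<^sub>R (\<Sum>j\<in>Basis. (b \<bullet> j) *\<^sub>R B i j))"
    using assms by (intro sum.cong refl arg_cong[where f="(*\<^sub>R) _"] linear_Basis_expansion) (simp add: bilinear_def)
  finally show ?thesis by (simp add: scaleR_sum_right)
qed

lemma frechet_derivative_eqI: "(f has_derivative D) (at x) \<Longrightarrow> frechet_derivative f (at x) = D"
  using frechet_derivative_at by metis

lemma frechet_derivative_cong_open:
  assumes "open S" "x \<in> S" "\<And>y. y \<in> S \<Longrightarrow> f y = g y" "smooth_on S f"
  shows "frechet_derivative g (at x) = frechet_derivative f (at x)"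
  using frechet_derivative_transform_within_open[where f=f and g=g, OF _ assms(1,2,3)] smooth_on_has_derivative[OF assms(4,2)]
  by (metis differentiable_def)

lemma linear_axis_expansion:
  fixes f :: "real^'n \<Rightarrow> 'b::real_vector"
  assumes "linear f"
  shows "f w = (\<Sum>i\<in>UNIV. w $ i *\<^sub>R f (axis i 1))"
proof -
  have "f w = f (\<Sum>i\<in>UNIV. w $ i *\<^sub>R axis i 1)"
    using basis_expansion[of w] by (simp add: scalar_mult_eq_scaleR)
  also have "\<dots> = (\<Sum>i\<in>UNIV. w $ i *\<^sub>R f (axis i 1))"
    using assms by (simp add: linear_sum linear_scale)
  finally show ?thesis .
qed

lemma matrix_inv_inverse:
  fixes A :: "'a::field^'n^'n"
  assumes "det A \<noteq> 0"
  shows "A ** matrix_inv A = mat 1" "matrix_inv A ** A = mat 1"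
proof -
  have "\<exists>A'. A ** A' = mat 1 \<and> A' ** A = mat 1"
    using assms by (simp add: invertible_det_nz[symmetric] invertible_def)
  from someI_ex[OF this] show "A ** matrix_inv A = mat 1" "matrix_inv A ** A = mat 1"
    by (simp_all add: matrix_inv_def)
qed

text \<open>Metrics, Christoffel symbols, Ricci forms and differentials all come as forms known to
  be smooth only for fixed arguments. Bilinearity expands the arguments in \<open>Basis\<close>, and
  smoothness along moving points and moving arguments follows.\<close>

locale bilinear_family =
  fixes U :: "'a::euclidean_space set"
    and B :: "'a \<Rightarrow> 'b::euclidean_space \<Rightarrow> 'c::euclidean_space \<Rightarrow> 'd::euclidean_space"
  assumes open_dom: "open U"
    and bilinear: "\<And>y. y \<in> U \<Longrightarrow> bilinear (B y)"
    and smooth: "\<And>a b. smooth_on U (\<lambda>y. B y a b)"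
begin

lemma has_derivative_at_args:
  assumes "y \<in> U"
  shows "((\<lambda>y. B y a b) has_derivative
     (\<lambda>u. \<Sum>i\<in>Basis. \<Sum>j\<in>Basis. ((a \<bullet> i) * (b \<bullet> j)) *\<^sub>R frechet_derivative (\<lambda>y. B y i j) (at y) u)) (at y)"
proof -
  have "((\<lambda>y. \<Sum>i\<in>Basis. \<Sum>j\<in>Basis. ((a \<bullet> i) * (b \<bullet> j)) *\<^sub>R B y i j) has_derivative
     (\<lambda>u. \<Sum>i\<in>Basis. \<Sum>j\<in>Basis. ((a \<bullet> i) * (b \<bullet> j)) *\<^sub>R frechet_derivative (\<lambda>y. B y i j) (at y) u)) (at y)"
    by (intro has_derivative_sum has_derivative_scaleR_right smooth_on_has_derivative[OF smooth assms])
  then show ?thesis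
    by (rule has_derivative_transform_within_open[OF _ open_dom assms])
      (simp add: bilinear_Basis_expansion[OF bilinear, symmetric])
qed

lemma bilinear_derivative:
  assumes "y \<in> U"
  shows "bilinear (\<lambda>a b. frechet_derivative (\<lambda>y. B y a b) (at y) u)"
proof -
  define E where "E i j = frechet_derivative (\<lambda>y. B y i j) (at y) u" for i j
  have eq: "(\<lambda>a b. frechet_derivative (\<lambda>y. B y a b) (at y) u)
      = (\<lambda>a b. \<Sum>i\<in>Basis. \<Sum>j\<in>Basis. ((a \<bullet> i) * (b \<bullet> j)) *\<^sub>R E i j)"
    unfolding E_def by (intro ext fun_cong[OF frechet_derivative_eqI[OF has_derivative_at_args[OF assms]]])
  show ?thesis
    unfolding eq bilinear_def
    by (auto intro!: linearI simp: inner_add_left distrib_left distrib_right scaleR_add_left sum.distrib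
        scaleR_sum_right mult.assoc mult.left_commute)
qed

lemma has_derivative_apply:
  assumes "(\<phi> has_derivative \<phi>') (at x)" "\<phi> x \<in> U"
    "(a has_derivative a') (at x)" "(b has_derivative b') (at x)"
  shows "((\<lambda>x. B (\<phi> x) (a x) (b x)) has_derivative
    (\<lambda>u. frechet_derivative (\<lambda>y. B y (a x) (b x)) (at (\<phi> x)) (\<phi>' u)
       + B (\<phi> x) (a' u) (b x) + B (\<phi> x) (a x) (b' u))) (at x)"
proof -
  have "((\<lambda>x. \<Sum>i\<in>Basis. \<Sum>j\<in>Basis. ((a x \<bullet> i) * (b x \<bullet> j)) *\<^sub>R B (\<phi> x) i j) has_derivative
     (\<lambda>u. \<Sum>i\<in>Basis. \<Sum>j\<in>Basis. ((a x \<bullet> i) * (b x \<bullet> j)) *\<^sub>R frechet_derivative (\<lambda>y. B y i j) (at (\<phi> x)) (\<phi>' u)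
        + ((a x \<bullet> i) * (b' u \<bullet> j) + (a' u \<bullet> i) * (b x \<bullet> j)) *\<^sub>R B (\<phi> x) i j)) (at x)"
    by (intro has_derivative_sum has_derivative_scaleR has_derivative_mult has_derivative_inner_left assms
        has_derivative_compose[OF assms(1) smooth_on_has_derivative[OF smooth assms(2)]])
  moreover have "(\<Sum>i\<in>Basis. \<Sum>j\<in>Basis. ((a x \<bullet> i) * (b x \<bullet> j)) *\<^sub>R frechet_derivative (\<lambda>y. B y i j) (at (\<phi> x)) (\<phi>' u)
        + ((a x \<bullet> i) * (b' u \<bullet> j) + (a' u \<bullet> i) * (b x \<bullet> j)) *\<^sub>R B (\<phi> x) i j)
    = frechet_derivative (\<lambda>y. B y (a x) (b x)) (at (\<phi> x)) (\<phi>' u)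
       + B (\<phi> x) (a' u) (b x) + B (\<phi> x) (a x) (b' u)" for u
    by (subst frechet_derivative_eqI[OF has_derivative_at_args[OF assms(2)], of "a x" "b x"],
        subst bilinear_Basis_expansion[OF bilinear[OF assms(2)], of "a' u"],
        subst bilinear_Basis_expansion[OF bilinear[OF assms(2)], of "a x"])
      (simp add: sum.distrib scaleR_add_left)
  ultimately have *: "((\<lambda>x. \<Sum>i\<in>Basis. \<Sum>j\<in>Basis. ((a x \<bullet> i) * (b x \<bullet> j)) *\<^sub>R B (\<phi> x) i j) has_derivative
     (\<lambda>u. frechet_derivative (\<lambda>y. B y (a x) (b x)) (at (\<phi> x)) (\<phi>' u)
       + B (\<phi> x) (a' u) (b x) + B (\<phi> x) (a x) (b' u))) (at x)"
    by (simp only:)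
  have "\<forall>\<^sub>F y in at x. \<phi> y \<in> U"
    using has_derivative_continuous[OF assms(1)] topological_tendstoD[of \<phi> "\<phi> x" "at x" U] open_dom assms(2)
    by (simp add: continuous_at)
  then have ev: "\<forall>\<^sub>F y in at x. (\<Sum>i\<in>Basis. \<Sum>j\<in>Basis. ((a y \<bullet> i) * (b y \<bullet> j)) *\<^sub>R B (\<phi> y) i j) = B (\<phi> y) (a y) (b y)"
    by eventually_elim (rule bilinear_Basis_expansion[OF bilinear, symmetric])
  show ?thesis
    using * ev bilinear_Basis_expansion[OF bilinear[OF assms(2)], symmetric]
    by (rule has_derivative_transform_eventually) simp
qed

lemma smooth_on_apply:
  assumes "open V" "smooth_on V \<phi>" "\<phi> ` V \<subseteq> U" "smooth_on V a" "smooth_on V b"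
  shows "smooth_on V (\<lambda>x. B (\<phi> x) (a x) (b x))"
proof -
  have "smooth_on V (\<lambda>x. \<Sum>i\<in>Basis. \<Sum>j\<in>Basis. ((a x \<bullet> i) * (b x \<bullet> j)) *\<^sub>R B (\<phi> x) i j)"
    by (intro smooth_on_sum smooth_on_scaleR smooth_on_mult smooth_on_inner_const assms
        smooth_on_compose[OF assms(1) open_dom assms(3) smooth assms(2)])
  then show ?thesis
    by (rule iffD2[OF smooth_on_cong[OF assms(1)], rotated])
      (use assms(3) in \<open>auto intro: bilinear_Basis_expansion[OF bilinear]\<close>)
qed

end

text \<open>A linear family is treated as a bilinear one by letting a real second argument act as a
  scalar; the product rule is then read off at the constant scalar 1.\<close>

lemma linear_family_has_derivative:
  fixes L :: "'a::euclidean_space \<Rightarrow> 'b::euclidean_space \<Rightarrow> 'd::euclidean_space"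
  assumes "open U" "\<And>y. y \<in> U \<Longrightarrow> linear (L y)" "\<And>a. smooth_on U (\<lambda>y. L y a)"
    "(\<phi> has_derivative \<phi>') (at x)" "\<phi> x \<in> U" "(a has_derivative a') (at x)"
  shows "((\<lambda>x. L (\<phi> x) (a x)) has_derivative
    (\<lambda>u. frechet_derivative (\<lambda>y. L y (a x)) (at (\<phi> x)) (\<phi>' u) + L (\<phi> x) (a' u))) (at x)"
proof -
  interpret bilinear_family U "\<lambda>y a (b::real). b *\<^sub>R L y a"
    using assms(1-3) by unfold_locales
      (auto simp: bilinear_def linear_iff algebra_simps intro!: smooth_on_scaleR smooth_on_const)
  show ?thesis
    using has_derivative_apply[OF assms(4-6), of "\<lambda>_. 1" "\<lambda>_. 0"] by simp
qed

subsection \<open>The Levi-Civita connection in coordinates\<close>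

locale local_riemannian = bilinear_family U G for U and G :: "('n::finite) local_metric" +
  assumes sym: "\<And>x u v. x \<in> U \<Longrightarrow> G x u v = G x v u"
    and pos: "\<And>x u. x \<in> U \<Longrightarrow> u \<noteq> 0 \<Longrightarrow> G x u u > 0"
begin

lemmas metric_linear = bilinear[THEN bilinear_ladd] bilinear[THEN bilinear_radd]
  bilinear[THEN bilinear_lmul] bilinear[THEN bilinear_rmul] bilinear[THEN bilinear_lsub]
  bilinear[THEN bilinear_rsub] bilinear[THEN bilinear_lneg] bilinear[THEN bilinear_rneg]
  bilinear[THEN bilinear_lzero] bilinear[THEN bilinear_rzero]

lemma nonneg: "x \<in> U \<Longrightarrow> G x u u \<ge> 0"
  using pos[of x u] metric_linear(9)[of x] by (cases "u = 0") auto

lemma metric_eqI: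
  assumes "x \<in> U" "\<And>w. G x z w = G x z' w"
  shows "z = z'"
proof (rule ccontr)
  assume "z \<noteq> z'"
  then have "G x (z - z') (z - z') > 0" using pos assms(1) by simp
  moreover have "G x (z - z') (z - z') = 0" using assms by (simp add: metric_linear)
  ultimately show False by simp
qed

text \<open>Gives meaning to the definite descriptions in \<open>gradient\<close> and
  \<open>christoffel\<close>. The map taking z to the coordinates of \<open>G x z\<close> is
  injective by definiteness, hence onto by dimension.\<close>

lemma riesz_ex1:
  assumes "x \<in> U" "linear l"
  shows "\<exists>!z. \<forall>w. G x z w = l w"
proof -
  define T where "T z = (\<Sum>b\<in>Basis. G x z b *\<^sub>R b)" for z
  have lin: "linear T"
    unfolding T_def by (intro linearI)
      (simp_all add: metric_linear assms algebra_simps sum.distrib scaleR_sum_right)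
  have Tb: "T z \<bullet> b = G x z b" if "b \<in> Basis" for z b
    using that by (simp add: T_def inner_sum_left inner_Basis if_distrib sum.delta cong: if_cong)
  have eq: "\<And>w. G x z w = l' w" if "\<And>b. b \<in> Basis \<Longrightarrow> G x z b = l' b" "linear l'" for z l'
    using linear_eq_stdbasis[OF _ that(2), of "G x z"] bilinear[OF assms(1)] that(1)
    by (auto simp: bilinear_def)
  have "inj T"
  proof (rule injI)
    fix z z' assume "T z = T z'"
    then have "G x z b = G x z' b" if "b \<in> Basis" for b
      using Tb[OF that, of z] Tb[OF that, of z'] by simp
    then have "G x z w = G x z' w" for w
      using bilinear[OF assms(1)] by (intro eq[of z "G x z'" w]) (auto simp: bilinear_def)
    then show "z = z'" by (rule metric_eqI[OF assms(1)])
  qed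
  then have "surj T" by (simp add: linear_injective_imp_surjective[OF lin])
  then obtain z where "T z = (\<Sum>b\<in>Basis. l b *\<^sub>R b)" by (metis surjD)
  then have "G x z b = l b" if "b \<in> Basis" for b
    using Tb[OF that, of z] that by (simp add: inner_sum_left inner_Basis if_distrib sum.delta cong: if_cong)
  then have "\<forall>w. G x z w = l w" using eq[of z l] assms(2) by blast
  then show ?thesis using metric_eqI[OF assms(1)] by (metis)
qed

lemma gram_mult_vec: "x \<in> U \<Longrightarrow> gram G x *v z = (\<chi> i. G x z (axis i 1))"
proof -
  assume x: "x \<in> U"
  have "linear (\<lambda>z. G x z (axis i 1))" for i using bilinear[OF x] by (simp add: bilinear_def)
  then have "G x z (axis i 1) = (\<Sum>j\<in>UNIV. z $ j * G x (axis i 1) (axis j 1))" for i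
    using linear_axis_expansion[of "\<lambda>z. G x z (axis i 1)" z] sym[OF x] by simp
  then show ?thesis by (simp add: vec_eq_iff matrix_vector_mult_def gram_def mult.commute)
qed

text \<open>A vector in the kernel of the Gram matrix is orthogonal to every coordinate vector,
  hence zero.\<close>

lemma det_gram_nonzero: "x \<in> U \<Longrightarrow> det (gram G x) \<noteq> 0"
proof -
  assume x: "x \<in> U"
  have "z = 0" if "gram G x *v z = 0" for z
  proof (rule metric_eqI[OF x])
    fix w
    have "linear (G x z)" using bilinear[OF x] by (simp add: bilinear_def)
    moreover have "G x z (axis i 1) = 0" for i
      using that gram_mult_vec[OF x, of z] by (simp add: vec_eq_iff)
    ultimately have "G x z w = 0"
      using linear_axis_expansion[of "G x z" w] by simp
    then show "G x z w = G x 0 w" by (simp add: metric_linear x)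
  qed
  then show ?thesis
    by (metis invertible_det_nz invertible_left_inverse matrix_left_invertible_ker)
qed

lemma smooth_on_gram: "smooth_on U (\<lambda>x. gram G x $ i $ j)"
  by (simp add: gram_def smooth)

text \<open>Pairing with the coordinate vectors makes z the solution of a linear system with the
  Gram matrix, and Cramer's rule writes its components as quotients of smooth determinants.\<close>

lemma smooth_on_riesz:
  assumes "\<And>w. smooth_on U (\<lambda>x. l x w)" "\<And>x w. x \<in> U \<Longrightarrow> G x (z x) w = l x w"
  shows "smooth_on U z"
proof -
  let ?z = "\<lambda>x. \<chi> k. det (\<chi> i j. if j = k then (\<chi> i. l x (axis i 1)) $ i else gram G x $ i $ j) / det (gram G x)"
  have "smooth_on U (\<lambda>x. if j = k then (\<chi> i. l x (axis i 1)) $ i else gram G x $ i $ j)" for i j k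
    by (cases "j = k") (simp_all add: smooth_on_gram assms(1))
  then have "smooth_on U ?z"
    by (intro smooth_on_vec_lambda smooth_on_divide smooth_on_det open_dom det_gram_nonzero smooth_on_gram)
      simp_all
  moreover have "z x = ?z x" if "x \<in> U" for x
    using cramer[OF det_gram_nonzero[OF that]] gram_mult_vec[OF that, of "z x"] assms(2)[OF that] by simp
  ultimately show ?thesis using smooth_on_cong[OF open_dom, of z ?z] by blast
qed

text \<open>The j-th column of the inverse Gram matrix represents the functional taking w to its
  j-th component, so \<open>smooth_on_riesz\<close> applies column by column.\<close>

lemma smooth_on_matrix_inv_gram: "smooth_on U (\<lambda>x. matrix_inv (gram G x) $ i $ j)"
proof -
  note inv = matrix_inv_inverse(1)[OF det_gram_nonzero]
  have "smooth_on U (\<lambda>x. matrix_inv (gram G x) *v axis j 1)"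
  proof (rule smooth_on_riesz[where l="\<lambda>x w. w $ j"])
    fix x w assume x: "x \<in> U"
    let ?z = "matrix_inv (gram G x) *v axis j 1"
    have "gram G x *v ?z = axis j 1"
      by (simp add: matrix_vector_mul_assoc inv[OF x])
    then have "(\<chi> i. G x ?z (axis i 1)) = axis j 1"
      unfolding gram_mult_vec[OF x, of ?z] .
    then have "G x ?z (axis i 1) = axis j 1 $ i" for i
      by (metis vec_lambda_beta)
    then have *: "G x ?z (axis i 1) = axis i 1 $ j" for i
      by (simp only: axis_def vec_lambda_beta) auto
    have "linear (G x ?z)" using bilinear[OF x] by (simp add: bilinear_def)
    moreover have "linear (\<lambda>w::real^'n. w $ j)" by (rule bounded_linear.linear[OF bounded_linear_vec_nth])
    ultimately have "G x ?z = (\<lambda>w. w $ j)"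
      by (rule linear_eq_stdbasis) (use * in \<open>auto simp: Basis_vec_def\<close>)
    then show "G x ?z w = w $ j" by simp
  qed (rule smooth_on_const)
  then have "smooth_on U (\<lambda>x. (matrix_inv (gram G x) *v axis j 1) $ i)"
    by (rule smooth_on_vec_nth[OF open_dom])
  then show ?thesis by (simp add: matrix_vector_mult_basis column_def)
qed

abbreviation "\<Gamma> \<equiv> christoffel G"
abbreviation "dG x a b u \<equiv> frechet_derivative (\<lambda>y. G y a b) (at x) u"

lemmas dmetric_linear = bilinear_derivative[THEN bilinear_ladd] bilinear_derivative[THEN bilinear_radd]
  bilinear_derivative[THEN bilinear_lmul] bilinear_derivative[THEN bilinear_rmul]

lemma dmetric_linear': "x \<in> U \<Longrightarrow> linear (\<lambda>u. dG x a b u)"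
  using smooth_on_linear_frechet[OF smooth] by simp

lemma dmetric_sym: "x \<in> U \<Longrightarrow> dG x a b u = dG x b a u"
  using frechet_derivative_cong_open[OF open_dom, of x "\<lambda>y. G y a b" "\<lambda>y. G y b a"] smooth sym by metis

lemma christoffel: "x \<in> U \<Longrightarrow> 2 * G x (\<Gamma> x u v) w = dG x v w u + dG x u w v - dG x u v w"
proof -
  assume x: "x \<in> U"
  have "linear (\<lambda>w. (dG x v w u + dG x u w v - dG x u v w) / 2)"
    using dmetric_linear'[OF x, of u v] by (auto intro!: linearI simp: dmetric_linear x linear_add linear_scale algebra_simps add_divide_distrib diff_divide_distrib)
  from riesz_ex1[OF x this] have "\<exists>!z. \<forall>w. 2 * G x z w = dG x v w u + dG x u w v - dG x u v w"
    by (simp add: field_simps)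
  from theI'[OF this] show ?thesis unfolding christoffel_def by blast
qed

text \<open>Linearity is clear after pairing with any w, where the Koszul expression is visibly
  linear, and descends to \<Gamma> because the metric separates vectors.\<close>

lemma bilinear_christoffel: "x \<in> U \<Longrightarrow> bilinear (\<Gamma> x)"
proof -
  assume x: "x \<in> U"
  note lin = dmetric_linear'[OF x, THEN linear_add] dmetric_linear'[OF x, THEN linear_scale]
  have eq: "z = \<Gamma> x u v" if "\<And>w. 2 * G x z w = dG x v w u + dG x u w v - dG x u v w" for z u v
    using that christoffel[OF x, of u v] by (intro metric_eqI[OF x]) (metis mult_left_cancel zero_neq_numeral)
  show ?thesis
    unfolding bilinear_def
    by (intro conjI allI linearI eq[symmetric])
      (auto simp: metric_linear dmetric_linear lin x distrib_left christoffel mult.left_commute[of 2] algebra_simps)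
qed

lemma smooth_on_christoffel: "smooth_on U (\<lambda>x. \<Gamma> x u v)"
proof (rule smooth_on_riesz[where l="\<lambda>x w. (dG x v w u + dG x u w v - dG x u v w) / 2"])
  show "smooth_on U (\<lambda>x. (dG x v w u + dG x u w v - dG x u v w) / 2)" for w
    by (intro smooth_on_divide smooth_on_diff smooth_on_add smooth_on_frechet_derivative smooth open_dom
        smooth_on_const) auto
  show "G x (\<Gamma> x u v) w = (dG x v w u + dG x u w v - dG x u v w) / 2" if "x \<in> U" for x w
    using christoffel[OF that, of u v w] by simp
qed

lemma metric_compatible_self: "x \<in> U \<Longrightarrow> 2 * G x (\<Gamma> x u v) v = dG x v v u"
  by (simp add: christoffel)

end

sublocale local_riemannian \<subseteq> chr: bilinear_family U "christoffel G"
  by unfold_locales (auto intro: open_dom bilinear_christoffel smooth_on_christoffel)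

context local_riemannian
begin

lemma cov_deriv_const: "cov_deriv G (\<lambda>_. w) x u = \<Gamma> x u w"
  by (simp add: cov_deriv_def cov_deriv_along_def)

abbreviation "d\<Gamma> x a b u \<equiv> frechet_derivative (\<lambda>y. \<Gamma> y a b) (at x) u"

lemma curvature_eq:
  "curvature G x u v w = d\<Gamma> x v w u - d\<Gamma> x u w v + \<Gamma> x u (\<Gamma> x v w) - \<Gamma> x v (\<Gamma> x u w)"
  by (simp add: curvature_def cov_deriv_const) (simp add: cov_deriv_def cov_deriv_along_def)

lemma linear_curvature:
  assumes "x \<in> U"
  shows "linear (\<lambda>u. curvature G x u v w)" "bilinear (\<lambda>v w. curvature G x u v w)"
proof -
  note lin = chr.bilinear_derivative[OF assms] chr.bilinear[OF assms]
  have dir: "linear (\<lambda>u. d\<Gamma> x a b u)" for a b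
    using smooth_on_linear_frechet[OF chr.smooth assms] by simp
  note simps = lin[THEN bilinear_ladd] lin[THEN bilinear_radd] lin[THEN bilinear_lmul] lin[THEN bilinear_rmul]
    linear_add[OF dir] linear_scale[OF dir]
  show "linear (\<lambda>u. curvature G x u v w)" "bilinear (\<lambda>v w. curvature G x u v w)"
    unfolding curvature_eq bilinear_def
    by (auto intro!: linearI simp: simps algebra_simps)
qed

lemma smooth_on_curvature: "smooth_on U (\<lambda>x. curvature G x u v w)"
  unfolding curvature_eq
  by (intro smooth_on_diff smooth_on_add smooth_on_frechet_derivative chr.smooth
      chr.smooth_on_apply open_dom smooth_on_ident smooth_on_const) auto

lemma ricci_eq: "ricci G x v w = (\<Sum>i\<in>UNIV. curvature G x (axis i 1) v w $ i)"
  by (simp add: ricci_def trace_def matrix_def)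

lemma bilinear_ricci: "x \<in> U \<Longrightarrow> bilinear (ricci G x)"
proof -
  assume x: "x \<in> U"
  note B = linear_curvature(2)[OF x]
  show ?thesis
    unfolding bilinear_def[of "ricci G x"] ricci_eq
    by (auto intro!: linearI simp: bilinear_ladd[OF B] bilinear_radd[OF B] bilinear_lmul[OF B]
        bilinear_rmul[OF B] sum.distrib sum_distrib_left)
qed

lemma smooth_on_ricci: "smooth_on U (\<lambda>x. ricci G x v w)"
  unfolding ricci_eq by (intro smooth_on_sum smooth_on_vec_nth smooth_on_curvature open_dom)

lemma bilinear_hessian:
  assumes "smooth_on U h" "x \<in> U"
  shows "bilinear (hessian G h x)"
proof -
  interpret L: bilinear_family U "\<lambda>y a (b::real). b *\<^sub>R frechet_derivative h (at y) a"
    using smooth_on_linear_frechet[OF assms(1)] smooth_on_frechet_derivative[OF assms(1)] open_dom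
    by unfold_locales
      (auto simp: bilinear_def linear_iff algebra_simps intro!: smooth_on_mult smooth_on_const)
  have 1: "linear (\<lambda>v. frechet_derivative (\<lambda>y. frechet_derivative h (at y) v) (at x) u)" for u
    using L.bilinear_derivative[OF assms(2), of u] by (auto simp: bilinear_def dest: spec[of _ 1])
  have 2: "linear (\<lambda>u. frechet_derivative (\<lambda>y. frechet_derivative h (at y) v) (at x) u)" for v
    using smooth_on_linear_frechet[OF smooth_on_frechet_derivative[OF assms(1)] assms(2)] by simp
  have 3: "linear (frechet_derivative h (at x))" by (rule smooth_on_linear_frechet[OF assms])
  show ?thesis
    unfolding bilinear_def hessian_def cov_deriv_const
    by (auto intro!: linearI simp: linear_add[OF 1] linear_add[OF 2] linear_add[OF 3]
        linear_scale[OF 1] linear_scale[OF 2] linear_scale[OF 3]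
        bilinear_ladd[OF chr.bilinear] bilinear_radd[OF chr.bilinear]
        bilinear_lmul[OF chr.bilinear] bilinear_rmul[OF chr.bilinear] assms(2) algebra_simps)
qed

lemma smooth_on_hessian: "smooth_on U h \<Longrightarrow> smooth_on U (\<lambda>x. hessian G h x u v)"
  unfolding hessian_def cov_deriv_const
  by (intro smooth_on_diff smooth_on_frechet_derivative smooth_on_frechet_apply open_dom chr.smooth)

lemma bilinear_family_bakry_emery:
  assumes "smooth_on U h"
  shows "bilinear_family U (bakry_emery_ricci G h)"
proof
  show "bilinear (bakry_emery_ricci G h x)" if "x \<in> U" for x
    using bilinear_ricci[OF that] bilinear_hessian[OF assms that]
    unfolding bilinear_def bakry_emery_ricci_def
    by (auto intro!: linear_compose_add)
  show "smooth_on U (\<lambda>x. bakry_emery_ricci G h x u v)" for u v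
    unfolding bakry_emery_ricci_def
    by (intro smooth_on_add smooth_on_ricci smooth_on_hessian assms open_dom)
qed (rule open_dom)

text \<open>The derivative of the metric coefficients along \<Phi> is absorbed by the Christoffel
  term, by the Koszul formula with two equal arguments.\<close>

lemma metric_compatible:
  assumes "(\<Phi> has_derivative \<Phi>') (at x)" "\<Phi> x \<in> U" "(Y has_derivative Y') (at x)"
  shows "((\<lambda>x. G (\<Phi> x) (Y x) (Y x)) has_derivative
    (\<lambda>u. 2 * G (\<Phi> x) (cov_deriv_along G \<Phi> Y x u) (Y x))) (at x)"
proof -
  have "cov_deriv_along G \<Phi> Y x u = Y' u + \<Gamma> (\<Phi> x) (\<Phi>' u) (Y x)" for u
    using frechet_derivative_eqI[OF assms(1)] frechet_derivative_eqI[OF assms(3)]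
    by (simp add: cov_deriv_along_def)
  then have "2 * G (\<Phi> x) (cov_deriv_along G \<Phi> Y x u) (Y x)
     = dG (\<Phi> x) (Y x) (Y x) (\<Phi>' u) + G (\<Phi> x) (Y' u) (Y x) + G (\<Phi> x) (Y x) (Y' u)" for u
    using metric_compatible_self[OF assms(2), of "\<Phi>' u" "Y x"] sym[OF assms(2), of "Y x" "Y' u"]
    by (simp add: metric_linear assms(2) distrib_left)
  then show ?thesis using has_derivative_apply[OF assms(1,2) assms(3) assms(3)] by simp
qed

lemma smooth_on_cov_deriv_along:
  assumes "open V" "smooth_on V \<Phi>" "\<Phi> ` V \<subseteq> U" "smooth_on V Y"
  shows "smooth_on V (\<lambda>x. cov_deriv_along G \<Phi> Y x u)"
  unfolding cov_deriv_along_def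
  by (intro smooth_on_add smooth_on_frechet_derivative chr.smooth_on_apply assms)

lemma linear_cov_deriv_along:
  assumes "smooth_on V \<Phi>" "\<Phi> ` V \<subseteq> U" "smooth_on V Y" "x \<in> V"
  shows "linear (cov_deriv_along G \<Phi> Y x)"
proof -
  note lin = smooth_on_linear_frechet[OF assms(1,4)] smooth_on_linear_frechet[OF assms(3,4)]
  have "\<Phi> x \<in> U" using assms by auto
  then show ?thesis
    unfolding cov_deriv_along_def
    by (auto intro!: linearI simp: linear_add[OF lin(1)] linear_add[OF lin(2)] linear_scale[OF lin(1)]
        linear_scale[OF lin(2)] bilinear_ladd[OF chr.bilinear] bilinear_lmul[OF chr.bilinear] algebra_simps)
qed

end

subsection \<open>Behaviour under local isometries\<close>

text \<open>Chart transitions are the intended instances. Proving the laws for a map T between two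
  coordinate metrics of equal dimension settles the coordinate independence of every tensor at
  once.\<close>

locale local_isometry = dom: local_riemannian U G + cod: local_riemannian U' G'
  for U U' and G G' :: "('n::finite) local_metric" +
  fixes T :: "real^'n \<Rightarrow> real^'n"
  assumes smooth_T: "smooth_on U T" and maps_T: "T ` U \<subseteq> U'"
    and isometry: "\<And>x u v. x \<in> U \<Longrightarrow>
      G x u v = G' (T x) (frechet_derivative T (at x) u) (frechet_derivative T (at x) v)"
begin

abbreviation "D x u \<equiv> frechet_derivative T (at x) u"
abbreviation "D2 x u v \<equiv> frechet_derivative (\<lambda>y. D y v) (at x) u"

lemma T_in: "x \<in> U \<Longrightarrow> T x \<in> U'"
  using maps_T by auto

lemma linear_D: "x \<in> U \<Longrightarrow> linear (D x)"
  by (rule smooth_on_linear_frechet[OF smooth_T])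

lemma D_derivative: "x \<in> U \<Longrightarrow> ((\<lambda>y. D y v) has_derivative (\<lambda>u. D2 x u v)) (at x)"
  by (rule smooth_on_has_derivative[OF smooth_on_frechet_derivative[OF smooth_T]])

lemma D2_sym: "x \<in> U \<Longrightarrow> D2 x u v = D2 x v u"
  by (rule second_derivative_symmetric[OF dom.open_dom smooth_T])

lemma inj_D: "x \<in> U \<Longrightarrow> inj (D x)"
proof -
  assume x: "x \<in> U"
  have "u = 0" if "D x u = 0" for u
    using that isometry[OF x, of u u] dom.pos[OF x, of u] cod.metric_linear(9)[OF T_in[OF x]] by force
  then show ?thesis using linear_injective_0[OF linear_D[OF x]] by blast
qed

lemma surj_D: "x \<in> U \<Longrightarrow> surj (D x)"
  using linear_injective_imp_surjective[OF linear_D inj_D] by simp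

lemma dmetric_pullback:
  assumes x: "x \<in> U"
  shows "dom.dG x a b u = cod.dG (T x) (D x a) (D x b) (D x u) + G' (T x) (D2 x u a) (D x b) + G' (T x) (D x a) (D2 x u b)"
proof -
  have "((\<lambda>y. G' (T y) (D y a) (D y b)) has_derivative
     (\<lambda>u. cod.dG (T x) (D x a) (D x b) (D x u) + G' (T x) (D2 x u a) (D x b) + G' (T x) (D x a) (D2 x u b))) (at x)"
    by (rule cod.has_derivative_apply[OF smooth_on_has_derivative[OF smooth_T x] T_in[OF x]
        D_derivative[OF x] D_derivative[OF x]])
  then have "((\<lambda>y. G y a b) has_derivative
     (\<lambda>u. cod.dG (T x) (D x a) (D x b) (D x u) + G' (T x) (D2 x u a) (D x b) + G' (T x) (D x a) (D2 x u b))) (at x)"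
    by (rule has_derivative_transform_within_open[OF _ dom.open_dom x]) (simp add: isometry)
  then show ?thesis by (rule fun_cong[OF frechet_derivative_eqI])
qed

text \<open>Since D is onto, it is enough to pair with vectors D w and compare the two Koszul
  formulas. Of the six second derivative terms produced by the pullback, four cancel by symmetry of
  second derivatives and two combine into the inhomogeneous term.\<close>

lemma christoffel_law:
  assumes x: "x \<in> U"
  shows "D x (dom.\<Gamma> x u v) = D2 x u v + cod.\<Gamma> (T x) (D x u) (D x v)"
proof (rule cod.metric_eqI[OF T_in[OF x]])
  fix w'
  obtain w where w: "w' = D x w" using surj_D[OF x] by (metis surjD)
  note Tx = T_in[OF x]
  have "2 * G' (T x) (D x (dom.\<Gamma> x u v)) w' = 2 * G x (dom.\<Gamma> x u v) w"
    by (simp add: isometry[OF x] w)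
  also have "\<dots> = dom.dG x v w u + dom.dG x u w v - dom.dG x u v w"
    by (rule dom.christoffel[OF x])
  also have "\<dots> = 2 * G' (T x) (cod.\<Gamma> (T x) (D x u) (D x v)) w' + 2 * G' (T x) (D2 x u v) w'"
    unfolding cod.christoffel[OF Tx] dmetric_pullback[OF x] w
    using D2_sym[OF x, of v u] D2_sym[OF x, of w u] D2_sym[OF x, of w v]
      cod.sym[OF Tx, of "D x v" "D2 x u w"] cod.sym[OF Tx, of "D x u" "D2 x v w"]
    by simp
  finally show "G' (T x) (D x (dom.\<Gamma> x u v)) w' = G' (T x) (D2 x u v + cod.\<Gamma> (T x) (D x u) (D x v)) w'"
    by (simp add: cod.metric_linear Tx)
qed

lemma D_family_derivative:
  assumes "(\<phi> has_derivative \<phi>') (at x)" "\<phi> x \<in> U" "(a has_derivative a') (at x)"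
  shows "((\<lambda>x. D (\<phi> x) (a x)) has_derivative (\<lambda>u. D2 (\<phi> x) (\<phi>' u) (a x) + D (\<phi> x) (a' u))) (at x)"
  using linear_family_has_derivative[OF dom.open_dom linear_D smooth_on_frechet_derivative[OF smooth_T] assms]
  by simp

text \<open>Obtained by differentiating the Christoffel law in the direction u. Everything after the
  first two summands on the right is, as a whole, symmetric in u and v, so it drops out of the
  curvature, which antisymmetrises this identity.\<close>

lemma curvature_law_aux:
  assumes x: "x \<in> U"
  shows "D x (dom.d\<Gamma> x v w u + dom.\<Gamma> x u (dom.\<Gamma> x v w))
    = cod.d\<Gamma> (T x) (D x v) (D x w) (D x u) + cod.\<Gamma> (T x) (D x u) (cod.\<Gamma> (T x) (D x v) (D x w))
      + frechet_derivative (\<lambda>y. D2 y v w) (at x) u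
      + cod.\<Gamma> (T x) (D2 x u v) (D x w) + cod.\<Gamma> (T x) (D x v) (D2 x u w) + cod.\<Gamma> (T x) (D x u) (D2 x v w)"
proof -
  note Tx = T_in[OF x]
  have d1: "((\<lambda>y. D y (dom.\<Gamma> y v w)) has_derivative (\<lambda>u. D2 x u (dom.\<Gamma> x v w) + D x (dom.d\<Gamma> x v w u))) (at x)"
    by (rule D_family_derivative[OF has_derivative_ident x smooth_on_has_derivative[OF dom.chr.smooth x]])
  have d2: "((\<lambda>y. D y (dom.\<Gamma> y v w)) has_derivative
      (\<lambda>u. frechet_derivative (\<lambda>y. D2 y v w) (at x) u
       + (cod.d\<Gamma> (T x) (D x v) (D x w) (D x u) + cod.\<Gamma> (T x) (D2 x u v) (D x w) + cod.\<Gamma> (T x) (D x v) (D2 x u w)))) (at x)"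
  proof (rule has_derivative_transform_within_open[OF _ dom.open_dom x])
    show "((\<lambda>y. D2 y v w + cod.\<Gamma> (T y) (D y v) (D y w)) has_derivative
      (\<lambda>u. frechet_derivative (\<lambda>y. D2 y v w) (at x) u
       + (cod.d\<Gamma> (T x) (D x v) (D x w) (D x u) + cod.\<Gamma> (T x) (D2 x u v) (D x w) + cod.\<Gamma> (T x) (D x v) (D2 x u w)))) (at x)"
      by (intro has_derivative_add cod.chr.has_derivative_apply smooth_on_has_derivative[OF smooth_T x] Tx
          D_derivative[OF x]
          smooth_on_has_derivative[OF smooth_on_frechet_derivative[OF smooth_on_frechet_derivative[OF smooth_T]] x])
  qed (simp add: christoffel_law)
  have "D2 x u (dom.\<Gamma> x v w) + D x (dom.d\<Gamma> x v w u) = frechet_derivative (\<lambda>y. D2 y v w) (at x) u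
       + (cod.d\<Gamma> (T x) (D x v) (D x w) (D x u) + cod.\<Gamma> (T x) (D2 x u v) (D x w) + cod.\<Gamma> (T x) (D x v) (D2 x u w))"
    by (rule fun_cong[OF has_derivative_unique[OF d1 d2]])
  then show ?thesis
    by (simp add: linear_add[OF linear_D[OF x]] christoffel_law[OF x] bilinear_radd[OF cod.chr.bilinear[OF Tx]] algebra_simps)
qed

lemma curvature_law:
  assumes x: "x \<in> U"
  shows "D x (curvature G x u v w) = curvature G' (T x) (D x u) (D x v) (D x w)"
proof -
  have "frechet_derivative (\<lambda>y. D2 y v w) (at x) u = frechet_derivative (\<lambda>y. D2 y u w) (at x) v"
    by (rule second_derivative_symmetric[OF dom.open_dom smooth_on_frechet_derivative[OF smooth_T] x])
  moreover have "curvature G x u v w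
     = (dom.d\<Gamma> x v w u + dom.\<Gamma> x u (dom.\<Gamma> x v w)) - (dom.d\<Gamma> x u w v + dom.\<Gamma> x v (dom.\<Gamma> x u w))"
    by (simp add: dom.curvature_eq)
  ultimately show ?thesis
    using D2_sym[OF x, of u v]
    by (simp only: linear_diff[OF linear_D[OF x]] curvature_law_aux[OF x]) (simp add: cod.curvature_eq)
qed

text \<open>Naturality of the curvature says that the endomorphisms whose traces are taken are
  conjugate by D.\<close>

lemma ricci_law:
  assumes x: "x \<in> U"
  shows "ricci G x v w = ricci G' (T x) (D x v) (D x w)"
proof -
  let ?J = "matrix (D x)" and ?R = "matrix (\<lambda>u. curvature G x u v w)"
    and ?R' = "matrix (\<lambda>u. curvature G' (T x) u (D x v) (D x w))"
  have J: "invertible ?J"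
    using matrix_invertible[OF linear_D[OF x]] inj_D[OF x] surj_D[OF x] linear_D[OF x]
    by (metis inj_on_id2 linear_injective_left_inverse linear_surjective_right_inverse linear_inverse_left)
  then obtain K where K: "?J ** K = mat 1" "K ** ?J = mat 1" by (auto simp: invertible_def)
  have "?R' ** ?J = ?J ** ?R"
    using matrix_compose[OF linear_D[OF x] cod.linear_curvature(1)[OF T_in[OF x]]]
      matrix_compose[OF dom.linear_curvature(1)[OF x] linear_D[OF x]]
    by (simp add: o_def curvature_law[OF x])
  then have "?R' = ?J ** ?R ** K"
    by (metis K(1) matrix_mul_assoc matrix_mul_rid)
  then have "trace ?R' = trace (?R ** (K ** ?J))"
    by (metis matrix_mul_assoc trace_mul_sym)
  then show ?thesis by (simp add: ricci_def K)
qed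

lemma frechet_pullback:
  assumes "smooth_on U' h" "\<And>y. y \<in> U \<Longrightarrow> h (T y) = k y" "x \<in> U"
  shows "frechet_derivative k (at x) v = frechet_derivative h (at (T x)) (D x v)"
proof -
  have "(k has_derivative (\<lambda>v. frechet_derivative h (at (T x)) (D x v))) (at x)"
    by (rule has_derivative_transform_within_open[OF _ dom.open_dom assms(3,2)])
      (rule has_derivative_compose[OF smooth_on_has_derivative[OF smooth_T assms(3)]
        smooth_on_has_derivative[OF assms(1) T_in[OF assms(3)]]])
  then show ?thesis by (simp add: frechet_derivative_eqI)
qed

text \<open>Differentiating h after T twice produces a second derivative of T, which is cancelled
  exactly by the inhomogeneous term of the Christoffel law.\<close>

lemma hessian_law:
  assumes "smooth_on U' h" "\<And>y. y \<in> U \<Longrightarrow> h (T y) = k y" "x \<in> U"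
  shows "hessian G k x u v = hessian G' h (T x) (D x u) (D x v)"
proof -
  note fk = frechet_pullback[OF assms(1,2)]
  have "((\<lambda>y. frechet_derivative h (at (T y)) (D y v)) has_derivative
      (\<lambda>u. frechet_derivative (\<lambda>y. frechet_derivative h (at y) (D x v)) (at (T x)) (D x u)
        + frechet_derivative h (at (T x)) (D2 x u v))) (at x)"
    by (rule linear_family_has_derivative[OF cod.open_dom smooth_on_linear_frechet[OF assms(1)]
        smooth_on_frechet_derivative[OF assms(1)] smooth_on_has_derivative[OF smooth_T assms(3)]
        T_in[OF assms(3)] D_derivative[OF assms(3)]])
  then have "((\<lambda>y. frechet_derivative k (at y) v) has_derivative
      (\<lambda>u. frechet_derivative (\<lambda>y. frechet_derivative h (at y) (D x v)) (at (T x)) (D x u)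
        + frechet_derivative h (at (T x)) (D2 x u v))) (at x)"
    by (rule has_derivative_transform_within_open[OF _ dom.open_dom assms(3)]) (simp add: fk)
  from frechet_derivative_eqI[OF this] show ?thesis
    by (simp add: hessian_def dom.cov_deriv_const cod.cov_deriv_const fk[OF _ assms(3)] christoffel_law[OF assms(3)]
        linear_add[OF smooth_on_linear_frechet[OF assms(1) T_in[OF assms(3)]]])
qed

lemma bakry_emery_law:
  assumes "smooth_on U' h" "\<And>y. y \<in> U \<Longrightarrow> h (T y) = k y" "x \<in> U"
  shows "bakry_emery_ricci G k x u v = bakry_emery_ricci G' h (T x) (D x u) (D x v)"
  by (simp add: bakry_emery_ricci_def ricci_law[OF assms(3)] hessian_law[OF assms])

text \<open>\<Psi> and Z are required to match the images of \<Phi> and Y only in value and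
  derivative at x: representations in two charts agree merely on the overlap.\<close>

lemma cov_deriv_along_law:
  assumes "(\<Phi> has_derivative \<Phi>') (at x)" "\<Phi> x \<in> U" "(Y has_derivative Y') (at x)"
    and \<Psi>: "frechet_derivative \<Psi> (at x) = frechet_derivative (\<lambda>y. T (\<Phi> y)) (at x)" "\<Psi> x = T (\<Phi> x)"
    and Z: "frechet_derivative Z (at x) = frechet_derivative (\<lambda>y. D (\<Phi> y) (Y y)) (at x)" "Z x = D (\<Phi> x) (Y x)"
  shows "cov_deriv_along G' \<Psi> Z x u = D (\<Phi> x) (cov_deriv_along G \<Phi> Y x u)"
proof -
  have 1: "frechet_derivative \<Psi> (at x) u = D (\<Phi> x) (\<Phi>' u)"
    unfolding \<Psi> using frechet_derivative_eqI[OF has_derivative_compose[OF assms(1) smooth_on_has_derivative[OF smooth_T assms(2)]]]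
    by simp
  have 2: "frechet_derivative Z (at x) u = D2 (\<Phi> x) (\<Phi>' u) (Y x) + D (\<Phi> x) (Y' u)"
    unfolding Z using frechet_derivative_eqI[OF D_family_derivative[OF assms(1-3)]] by simp
  show ?thesis
    unfolding cov_deriv_along_def 1 2 \<Psi>(2) Z(2) frechet_derivative_eqI[OF assms(1)] frechet_derivative_eqI[OF assms(3)]
    by (simp add: linear_add[OF linear_D[OF assms(2)]] christoffel_law[OF assms(2)])
qed

end

subsection \<open>Charts\<close>

lemma is_chartD:
  assumes "is_chart c"
  shows "open (cdom c)" "open (cimg c)" "continuous_on (cdom c) (cmap c)" "continuous_on (cimg c) (cinv c)"
    and "\<And>x. x \<in> cimg c \<Longrightarrow> cinv c x \<in> cdom c" "\<And>x. x \<in> cimg c \<Longrightarrow> cmap c (cinv c x) = x"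
    and "\<And>p. p \<in> cdom c \<Longrightarrow> cmap c p \<in> cimg c" "\<And>p. p \<in> cdom c \<Longrightarrow> cinv c (cmap c p) = p"
proof -
  have H: "homeomorphism (cdom c) (cimg c) (cmap c) (cinv c)" using assms by (simp add: is_chart_def)
  show "open (cdom c)" "open (cimg c)" using assms by (simp_all add: is_chart_def)
  show "continuous_on (cdom c) (cmap c)" "continuous_on (cimg c) (cinv c)"
    "\<And>x. x \<in> cimg c \<Longrightarrow> cmap c (cinv c x) = x" "\<And>p. p \<in> cdom c \<Longrightarrow> cinv c (cmap c p) = p"
    using H unfolding homeomorphism_def by blast+
  show "\<And>x. x \<in> cimg c \<Longrightarrow> cinv c x \<in> cdom c" using H unfolding homeomorphism_def by blast
  show "\<And>p. p \<in> cdom c \<Longrightarrow> cmap c p \<in> cimg c" by (simp add: cimg_def)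
qed

lemma smooth_atlas_is_chart: "smooth_atlas \<A> \<Longrightarrow> c \<in> \<A> \<Longrightarrow> is_chart c"
  by (simp add: smooth_atlas_def)

lemma chart_image_Int:
  assumes "is_chart c"
  shows "cmap c ` (cdom c \<inter> W) = {x \<in> cimg c. cinv c x \<in> W}"
proof (intro equalityI subsetI)
  fix x assume "x \<in> {x \<in> cimg c. cinv c x \<in> W}"
  then show "x \<in> cmap c ` (cdom c \<inter> W)"
    using is_chartD[OF assms] by (intro image_eqI[of _ _ "cinv c x"]) auto
qed (use is_chartD[OF assms] in auto)

lemma open_chart_preimage:
  assumes "is_chart c" "open W" "continuous_on (cdom c) F"
  shows "open (cmap c ` (cdom c \<inter> F -` W))"
proof -
  have "continuous_on (cimg c) (\<lambda>x. F (cinv c x))"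
    using is_chartD(4,5)[OF assms(1)] by (intro continuous_on_compose2[OF assms(3)]) auto
  from continuous_open_preimage[OF this is_chartD(2)[OF assms(1)] assms(2)]
  show ?thesis unfolding chart_image_Int[OF assms(1)] by (simp add: vimage_def Int_def)
qed

lemma open_chart_overlap:
  "is_chart c \<Longrightarrow> open W \<Longrightarrow> open (cmap c ` (cdom c \<inter> W))"
  using open_chart_preimage[of c W "\<lambda>p. p"] by simp

lemma open_points: "smooth_atlas \<A> \<Longrightarrow> open (points \<A>)"
  unfolding points_def by (auto simp: smooth_atlas_def is_chart_def)

lemma cdom_subset_points: "c \<in> \<A> \<Longrightarrow> cdom c \<subseteq> points \<A>"
  by (auto simp: points_def)

lemma chart_at:
  assumes "p \<in> points \<A>"
  shows "chart_at \<A> p \<in> \<A>" "p \<in> cdom (chart_at \<A> p)"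
proof -
  have "\<exists>c. c \<in> \<A> \<and> p \<in> cdom c" using assms by (auto simp: points_def)
  from someI_ex[OF this] show "chart_at \<A> p \<in> \<A>" "p \<in> cdom (chart_at \<A> p)"
    by (simp_all add: chart_at_def)
qed

lemma transition_in:
  assumes "is_chart c" "is_chart d" "x \<in> cmap c ` (cdom c \<inter> cdom d)"
  shows "transition c d x \<in> cmap d ` (cdom d \<inter> cdom c)" "cinv d (transition c d x) = cinv c x"
  using assms is_chartD[OF assms(1)] is_chartD[OF assms(2)] by (auto simp: transition_def)

text \<open>One chart per point suffices, and it may depend on the point. This freedom is needed for
  quantities along the immersion, where a target chart has to be kept fixed near each point.\<close>

lemma continuous_on_pointsI:
  assumes "smooth_atlas \<A>"
    and "\<And>p. p \<in> points \<A> \<Longrightarrow> \<exists>c\<in>\<A>. \<exists>V r. open V \<and> V \<subseteq> cimg c \<and> p \<in> cdom c \<and> cmap c p \<in> V \<and>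
      continuous_on V r \<and> (\<forall>x\<in>V. q (cinv c x) = r x)"
  shows "continuous_on (points \<A>) q"
proof -
  have "isCont q p" if p: "p \<in> points \<A>" for p
  proof -
    obtain c V r where c: "c \<in> \<A>" "open V" "V \<subseteq> cimg c" "p \<in> cdom c" "cmap c p \<in> V" "continuous_on V r"
      "\<And>x. x \<in> V \<Longrightarrow> q (cinv c x) = r x" using assms(2)[OF p] by blast
    note C = is_chartD[OF smooth_atlas_is_chart[OF assms(1) c(1)]]
    define W where "W = cdom c \<inter> cmap c -` V"
    have "open W" unfolding W_def Int_commute[of "cdom c"]
      using continuous_open_preimage[OF C(3,1) c(2)] by (simp add: Int_commute)
    moreover have "continuous_on W (\<lambda>q. r (cmap c q))"
      by (rule continuous_on_compose2[OF c(6) continuous_on_subset[OF C(3)]]) (auto simp: W_def)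
    moreover have "r (cmap c p') = q p'" if "p' \<in> W" for p'
      using c(7)[of "cmap c p'"] that C(8)[of p'] by (simp add: W_def)
    ultimately have "continuous_on W q" using continuous_on_cong[of W W] by (metis (no_types, lifting))
    with \<open>open W\<close> show ?thesis using c(4,5) by (auto simp: W_def continuous_on_eq_continuous_at)
  qed
  then show ?thesis by (simp add: continuous_at_imp_continuous_on)
qed

lemma smooth_fun_continuous_on:
  assumes "smooth_atlas \<A>" "smooth_fun \<A> f"
  shows "continuous_on (points \<A>) f"
proof (rule continuous_on_pointsI[OF assms(1)])
  fix p assume "p \<in> points \<A>"
  then obtain c where c: "c \<in> \<A>" "p \<in> cdom c" by (auto simp: points_def)
  note C = is_chartD[OF smooth_atlas_is_chart[OF assms(1) c(1)]]
  show "\<exists>c\<in>\<A>. \<exists>V r. open V \<and> V \<subseteq> cimg c \<and> p \<in> cdom c \<and> cmap c p \<in> V \<and>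
      continuous_on V r \<and> (\<forall>x\<in>V. f (cinv c x) = r x)"
    by (rule bexI[OF _ c(1)], rule exI[of _ "cimg c"], rule exI[of _ "f \<circ> cinv c"])
      (use c C assms(2) smooth_on_imp_continuous_on[of "cimg c" "f \<circ> cinv c"] in \<open>auto simp: smooth_fun_def\<close>)
qed

lemma smooth_fun_transition:
  assumes "is_chart c" "is_chart d" "y \<in> cmap c ` (cdom c \<inter> cdom d)"
  shows "(f \<circ> cinv d) (transition c d y) = (f \<circ> cinv c) y"
  using transition_in[OF assms] by simp

subsection \<open>Riemannian manifolds\<close>

locale riemannian =
  fixes \<A> :: "('m::{t2_space,second_countable_topology}, 'n::finite) chart set" and g :: "('m, 'n) metric"
  assumes manifold: "riemannian_manifold \<A> g"
begin

lemma atlas: "smooth_atlas \<A>"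
  using manifold by (simp add: riemannian_manifold_def)

lemma chart: "c \<in> \<A> \<Longrightarrow> is_chart c"
  using atlas by (simp add: smooth_atlas_def)

lemmas chartD = is_chartD[OF chart]

lemma local_riemannian_chart: "c \<in> \<A> \<Longrightarrow> local_riemannian (cimg c) (g c)"
  using manifold chartD(2)[of c]
  by unfold_locales (auto simp: riemannian_manifold_def riemannian_metric_def)

lemma local_isometry_transition:
  assumes "c \<in> \<A>" "d \<in> \<A>"
  shows "local_isometry (cmap c ` (cdom c \<inter> cdom d)) (cimg d) (g c) (g d) (transition c d)"
proof -
  interpret c: local_riemannian "cimg c" "g c" by (rule local_riemannian_chart[OF assms(1)])
  interpret d: local_riemannian "cimg d" "g d" by (rule local_riemannian_chart[OF assms(2)])
  have sub: "cmap c ` (cdom c \<inter> cdom d) \<subseteq> cimg c" by (auto simp: cimg_def)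
  show ?thesis
  proof
    show "open (cmap c ` (cdom c \<inter> cdom d))"
      by (intro open_chart_overlap chart assms chartD(1))
    show "smooth_on (cmap c ` (cdom c \<inter> cdom d)) (transition c d)"
      using atlas assms unfolding smooth_atlas_def by blast
    show "transition c d ` cmap c ` (cdom c \<inter> cdom d) \<subseteq> cimg d"
      using transition_in(1)[OF chart chart, OF assms] unfolding cimg_def by blast
    show "g c x u v = g d (transition c d x) (frechet_derivative (transition c d) (at x) u)
        (frechet_derivative (transition c d) (at x) v)"
      if "x \<in> cmap c ` (cdom c \<inter> cdom d)" for x u v
      using manifold that assms unfolding riemannian_manifold_def riemannian_metric_def by blast
    show "smooth_on (cmap c ` (cdom c \<inter> cdom d)) (\<lambda>x. g c x u v)" for u v
      by (rule smooth_on_subset[OF c.smooth sub])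
    fix x assume "x \<in> cmap c ` (cdom c \<inter> cdom d)"
    then have x: "x \<in> cimg c" using sub by auto
    show "bilinear (g c x)" by (rule c.bilinear[OF x])
    show "g c x u v = g c x v u" for u v by (rule c.sym[OF x])
    show "0 < g c x u u" if "u \<noteq> 0" for u by (rule c.pos[OF x that])
  qed
qed

end

subsection \<open>Immersed hypersurfaces and their induced metric\<close>

lemma linear_inj_nonzero:
  assumes "linear L" "inj L" "u \<noteq> 0"
  shows "L u \<noteq> 0"
  using assms linear_injective_0 by blast

locale immersed = riemannian \<A> g
  for \<A> :: "('m::{t2_space,second_countable_topology}, 'b::finite) chart set" and g :: "('m, 'b) metric" +
  fixes \<S> :: "('s::{t2_space,second_countable_topology}, 'a::finite) chart set" and F :: "'s \<Rightarrow> 'm"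
  assumes source_atlas: "smooth_atlas \<S>" and immersion: "immersion \<S> \<A> F"
begin

abbreviation "h \<equiv> (induced_metric \<A> g F :: ('s, 'a) metric)"
abbreviation "V c d \<equiv> cmap c ` (cdom c \<inter> F -` cdom d)"
abbreviation "\<Phi> c d \<equiv> local_rep c d F"
abbreviation "D\<Phi> c d x u \<equiv> frechet_derivative (local_rep c d F) (at x) u"

lemma source_chart: "c \<in> \<S> \<Longrightarrow> is_chart c"
  using source_atlas by (simp add: smooth_atlas_def)

lemmas source_chartD = is_chartD[OF source_chart]

lemma V_eq: "c \<in> \<S> \<Longrightarrow> V c d = {x \<in> cimg c. F (cinv c x) \<in> cdom d}"
  using chart_image_Int[OF source_chart, of c "F -` cdom d"] by simp

lemma F_in: "p \<in> points \<S> \<Longrightarrow> F p \<in> points \<A>"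
  using immersion by (auto simp: immersion_def)

lemma continuous_F: "continuous_on (points \<S>) F"
  using immersion by (auto simp: immersion_def)

lemma open_V: "c \<in> \<S> \<Longrightarrow> d \<in> \<A> \<Longrightarrow> open (V c d)"
  using continuous_on_subset[OF continuous_F cdom_subset_points]
  by (intro open_chart_preimage source_chart chartD(1))

lemma smooth_\<Phi>: "c \<in> \<S> \<Longrightarrow> d \<in> \<A> \<Longrightarrow> smooth_on (V c d) (\<Phi> c d)"
  using immersion by (auto simp: immersion_def)

lemma inj_D\<Phi>: "c \<in> \<S> \<Longrightarrow> d \<in> \<A> \<Longrightarrow> x \<in> V c d \<Longrightarrow> inj (frechet_derivative (\<Phi> c d) (at x))"
  using immersion unfolding immersion_def by blast

lemma linear_D\<Phi>: "c \<in> \<S> \<Longrightarrow> d \<in> \<A> \<Longrightarrow> x \<in> V c d \<Longrightarrow> linear (frechet_derivative (\<Phi> c d) (at x))"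
  by (rule smooth_on_linear_frechet[OF smooth_\<Phi>])

lemma \<Phi>_in: "c \<in> \<S> \<Longrightarrow> d \<in> \<A> \<Longrightarrow> x \<in> V c d \<Longrightarrow> \<Phi> c d x \<in> cimg d"
  using V_eq[of c d] chartD(7)[of d] by (auto simp: local_rep_def)

lemma \<Phi>_change_target:
  assumes "c \<in> \<S>" "d \<in> \<A>" "e \<in> \<A>" "x \<in> V c d" "x \<in> V c e"
  shows "\<Phi> c d x \<in> cmap d ` (cdom d \<inter> cdom e)" "\<Phi> c e x = transition d e (\<Phi> c d x)"
proof -
  have "F (cinv c x) \<in> cdom d" "F (cinv c x) \<in> cdom e" using assms V_eq[OF assms(1)] by auto
  then show "\<Phi> c d x \<in> cmap d ` (cdom d \<inter> cdom e)" "\<Phi> c e x = transition d e (\<Phi> c d x)"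
    using chartD(8)[OF assms(2)] by (auto simp: local_rep_def transition_def)
qed

lemma D\<Phi>_change_target:
  assumes "c \<in> \<S>" "d \<in> \<A>" "e \<in> \<A>" "x \<in> V c d" "x \<in> V c e"
  shows "((\<lambda>y. transition d e (\<Phi> c d y)) has_derivative
      (\<lambda>u. frechet_derivative (transition d e) (at (\<Phi> c d x)) (D\<Phi> c d x u))) (at x)"
    and "frechet_derivative (\<Phi> c e) (at x) = frechet_derivative (\<lambda>y. transition d e (\<Phi> c d y)) (at x)"
    and "D\<Phi> c e x u = frechet_derivative (transition d e) (at (\<Phi> c d x)) (D\<Phi> c d x u)"
proof -
  interpret T: local_isometry "cmap d ` (cdom d \<inter> cdom e)" "cimg e" "g d" "g e" "transition d e"
    by (rule local_isometry_transition[OF assms(2,3)])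
  let ?D = "\<lambda>u. frechet_derivative (transition d e) (at (\<Phi> c d x)) (D\<Phi> c d x u)"
  show 1: "((\<lambda>y. transition d e (\<Phi> c d y)) has_derivative ?D) (at x)"
    by (rule has_derivative_compose[OF smooth_on_has_derivative[OF smooth_\<Phi>[OF assms(1,2)] assms(4)]
        smooth_on_has_derivative[OF T.smooth_T \<Phi>_change_target(1)[OF assms]]])
  have 2: "(\<Phi> c e has_derivative ?D) (at x)"
    by (rule has_derivative_transform_within_open[OF 1, of "V c d \<inter> V c e"])
      (use assms open_V \<Phi>_change_target(2)[OF assms(1-3)] in auto)
  show "frechet_derivative (\<Phi> c e) (at x) = frechet_derivative (\<lambda>y. transition d e (\<Phi> c d y)) (at x)"
    unfolding frechet_derivative_eqI[OF 1] frechet_derivative_eqI[OF 2] ..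
  show "D\<Phi> c e x u = ?D u" unfolding frechet_derivative_eqI[OF 2] ..
qed

lemma \<Phi>_change_source:
  assumes "c \<in> \<S>" "c' \<in> \<S>" "d \<in> \<A>" "x \<in> V c d" "x \<in> cmap c ` (cdom c \<inter> cdom c')"
  shows "transition c c' x \<in> V c' d" "\<Phi> c d x = \<Phi> c' d (transition c c' x)"
proof -
  note t = transition_in[OF source_chart source_chart assms(5), OF assms(1,2)]
  have "F (cinv c x) \<in> cdom d" using assms(4) V_eq[OF assms(1)] by auto
  then show "transition c c' x \<in> V c' d" "\<Phi> c d x = \<Phi> c' d (transition c c' x)"
    using t unfolding V_eq[OF assms(2)] by (auto simp: local_rep_def cimg_def)
qed

lemma open_source_overlap: "c \<in> \<S> \<Longrightarrow> c' \<in> \<S> \<Longrightarrow> open (cmap c ` (cdom c \<inter> cdom c'))"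
  by (intro open_chart_overlap source_chart source_chartD(1))

lemma smooth_transition: "c \<in> \<S> \<Longrightarrow> c' \<in> \<S> \<Longrightarrow> smooth_on (cmap c ` (cdom c \<inter> cdom c')) (transition c c')"
  using source_atlas by (simp add: smooth_atlas_def)

lemma D\<Phi>_change_source:
  assumes "c \<in> \<S>" "c' \<in> \<S>" "d \<in> \<A>" "x \<in> V c d" "x \<in> cmap c ` (cdom c \<inter> cdom c')"
  shows "D\<Phi> c d x u = D\<Phi> c' d (transition c c' x) (frechet_derivative (transition c c') (at x) u)"
proof -
  have "((\<lambda>y. \<Phi> c' d (transition c c' y)) has_derivative
      (\<lambda>u. D\<Phi> c' d (transition c c' x) (frechet_derivative (transition c c') (at x) u))) (at x)"
    by (rule has_derivative_compose[OF smooth_on_has_derivative[OF smooth_transition[OF assms(1,2)] assms(5)]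
        smooth_on_has_derivative[OF smooth_\<Phi>[OF assms(2,3)] \<Phi>_change_source(1)[OF assms]]])
  then have "(\<Phi> c d has_derivative
      (\<lambda>u. D\<Phi> c' d (transition c c' x) (frechet_derivative (transition c c') (at x) u))) (at x)"
    by (rule has_derivative_transform_within_open[of _ _ _ _ "V c d \<inter> cmap c ` (cdom c \<inter> cdom c')"])
      (use assms open_V open_source_overlap \<Phi>_change_source(2)[OF assms(1-3)] in auto)
  then show ?thesis by (simp add: frechet_derivative_eqI)
qed

lemma target_chart:
  assumes "c \<in> \<S>" "x \<in> cimg c"
  obtains d where "d = chart_at \<A> (F (cinv c x))" "d \<in> \<A>" "x \<in> V c d"
proof
  have "F (cinv c x) \<in> points \<A>"
    using source_chartD(5)[OF assms] F_in cdom_subset_points[OF assms(1)] by blast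
  from chart_at[OF this] show "chart_at \<A> (F (cinv c x)) \<in> \<A>" "x \<in> V c (chart_at \<A> (F (cinv c x)))"
    using V_eq[OF assms(1)] assms(2) by auto
qed auto

text \<open>The definition picks the target chart anew at every x. Being free to keep one chart d
  fixed near a point is what makes the metric coefficients visibly smooth.\<close>

lemma induced_metric_eq:
  assumes "c \<in> \<S>" "d \<in> \<A>" "x \<in> V c d"
  shows "h c x u v = g d (\<Phi> c d x) (D\<Phi> c d x u) (D\<Phi> c d x v)"
proof -
  have "x \<in> cimg c" using assms(3) by (auto simp: cimg_def)
  then obtain e where e: "e = chart_at \<A> (F (cinv c x))" "e \<in> \<A>" "x \<in> V c e" using target_chart[OF assms(1)] by metis
  interpret T: local_isometry "cmap e ` (cdom e \<inter> cdom d)" "cimg d" "g e" "g d" "transition e d"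
    by (rule local_isometry_transition[OF e(2) assms(2)])
  note * = assms(1) e(2) assms(2) e(3) assms(3)
  have "h c x u v = g e (\<Phi> c e x) (D\<Phi> c e x u) (D\<Phi> c e x v)"
    by (simp add: induced_metric_def e(1) Let_def)
  also have "\<dots> = g d (\<Phi> c d x) (D\<Phi> c d x u) (D\<Phi> c d x v)"
    using T.isometry[OF \<Phi>_change_target(1)[OF *]] \<Phi>_change_target(2)[OF *] D\<Phi>_change_target(3)[OF *] by simp
  finally show ?thesis .
qed

text \<open>Makes everything proved in the locale \<open>riemannian\<close> available for the
  hypersurface itself.\<close>

lemma riemannian_manifold_induced: "riemannian_manifold \<S> h"
  unfolding riemannian_manifold_def riemannian_metric_def
proof (intro conjI ballI allI impI source_atlas)
  fix c x assume c: "c \<in> \<S>" and x: "x \<in> cimg c"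
  obtain d where d: "d \<in> \<A>" "x \<in> V c d" using target_chart[OF c x] by metis
  interpret d: local_riemannian "cimg d" "g d" by (rule local_riemannian_chart[OF d(1)])
  note lin = linear_D\<Phi>[OF c d] and im = \<Phi>_in[OF c d]
  show "bilinear (h c x)"
    unfolding bilinear_def induced_metric_eq[OF c d]
    by (auto intro!: linearI simp: linear_add[OF lin] linear_scale[OF lin] d.metric_linear[OF im])
  show "h c x u v = h c x v u" for u v
    unfolding induced_metric_eq[OF c d] by (rule d.sym[OF im])
  show "h c x u u > 0" if "u \<noteq> 0" for u
    unfolding induced_metric_eq[OF c d] by (intro d.pos[OF im] linear_inj_nonzero[OF lin inj_D\<Phi>[OF c d] that])
next
  fix c u v assume c: "c \<in> \<S>"
  show "smooth_on (cimg c) (\<lambda>x. h c x u v)"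
  proof (rule smooth_on_local)
    fix x assume x: "x \<in> cimg c"
    obtain d where d: "d \<in> \<A>" "x \<in> V c d" using target_chart[OF c x] by metis
    interpret d: local_riemannian "cimg d" "g d" by (rule local_riemannian_chart[OF d(1)])
    have "smooth_on (V c d) (\<lambda>x. g d (\<Phi> c d x) (D\<Phi> c d x u) (D\<Phi> c d x v))"
      using \<Phi>_in[OF c d(1)]
      by (intro d.smooth_on_apply open_V smooth_\<Phi> smooth_on_frechet_derivative c d) auto
    then have "smooth_on (V c d) (\<lambda>x. h c x u v)"
      by (subst smooth_on_cong[OF open_V[OF c d(1)] induced_metric_eq[OF c d(1)]])
    then show "\<exists>U. open U \<and> x \<in> U \<and> smooth_on U (\<lambda>x. h c x u v)"
      using d open_V[OF c d(1)] by blast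
  qed
next
  fix c c' x u v assume c: "c \<in> \<S>" "c' \<in> \<S>" and x: "x \<in> cmap c ` (cdom c \<inter> cdom c')"
  then have "x \<in> cimg c" by (auto simp: cimg_def)
  then obtain d where d: "d \<in> \<A>" "x \<in> V c d" using target_chart[OF c(1)] by metis
  show "h c x u v = h c' (transition c c' x) (frechet_derivative (transition c c') (at x) u)
          (frechet_derivative (transition c c') (at x) v)"
    unfolding induced_metric_eq[OF c(1) d] induced_metric_eq[OF c(2) d(1) \<Phi>_change_source(1)[OF c d x]]
      D\<Phi>_change_source[OF c d x] \<Phi>_change_source(2)[OF c d x] ..
qed

end

subsection \<open>Traces of bilinear forms\<close>

text \<open>The trace of B with respect to the inner product H: the inverse Gram matrix of H
  contracted with B. |A|^2 is the trace of the form <A u, A v>.\<close>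

definition trace_form :: "(real^'n \<Rightarrow> real^'n \<Rightarrow> real) \<Rightarrow> (real^'n \<Rightarrow> real^('n::finite) \<Rightarrow> real) \<Rightarrow> real" where
  "trace_form H B = (\<Sum>i\<in>UNIV. \<Sum>j\<in>UNIV.
     matrix_inv (\<chi> i j. H (axis i 1) (axis j 1)) $ i $ j * B (axis i 1) (axis j 1))"

lemma form_matrix_pullback:
  fixes b :: "real^'n \<Rightarrow> real^'n \<Rightarrow> real" and J :: "real^'n \<Rightarrow> real^'n"
  assumes "bilinear b"
  shows "(\<chi> i j. b (J (axis i 1)) (J (axis j 1)))
    = transpose (matrix J) ** (\<chi> i j. b (axis i 1) (axis j 1)) ** matrix J"
proof -
  have "b u v = (\<Sum>l\<in>UNIV. (\<Sum>k\<in>UNIV. u $ k * b (axis k 1) (axis l 1)) * v $ l)" for u v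
  proof -
    have "b u v = (\<Sum>l\<in>UNIV. v $ l *\<^sub>R b u (axis l 1))"
      using assms by (intro linear_axis_expansion) (simp add: bilinear_def)
    also have "\<dots> = (\<Sum>l\<in>UNIV. v $ l *\<^sub>R (\<Sum>k\<in>UNIV. u $ k *\<^sub>R b (axis k 1) (axis l 1)))"
      using assms by (intro sum.cong refl arg_cong[where f="(*\<^sub>R) _"] linear_axis_expansion[of "\<lambda>u. b u _"])
        (simp add: bilinear_def)
    finally show ?thesis by (simp add: mult.commute)
  qed
  from this[of "J (axis _ 1)" "J (axis _ 1)"] show ?thesis
    by (simp add: vec_eq_iff matrix_matrix_mult_def transpose_def matrix_def)
qed

lemma trace_form_eq_trace:
  "trace_form H B = trace (matrix_inv (\<chi> i j. H (axis i 1) (axis j 1)) ** transpose (\<chi> i j. B (axis i 1) (axis j 1)))"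
  by (simp add: trace_form_def trace_def matrix_matrix_mult_def transpose_def)

lemma matrix_inv_eqI:
  fixes A B :: "'a::field^'n^'n"
  assumes "A ** B = mat 1"
  shows "matrix_inv A = B"
proof -
  have "B ** A = mat 1" using assms by (simp add: matrix_left_right_inverse)
  then have "\<exists>A'. A ** A' = mat 1 \<and> A' ** A = mat 1" using assms by blast
  from someI_ex[OF this] have "matrix_inv A ** A = mat 1" by (simp add: matrix_inv_def)
  then have "matrix_inv A = matrix_inv A ** (A ** B)" by (simp add: assms)
  also have "\<dots> = B" by (simp add: matrix_mul_assoc \<open>matrix_inv A ** A = mat 1\<close>)
  finally show ?thesis .
qed

lemma linear_inj_matrix_inverse:
  fixes J :: "real^'n \<Rightarrow> real^'n"
  assumes "linear J" "inj J"
  obtains K where "matrix J ** K = mat 1" "K ** matrix J = mat 1"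
proof -
  obtain L where L: "linear L" "L \<circ> J = id" using linear_injective_left_inverse[OF assms] by blast
  then have "matrix L ** matrix J = mat 1"
    using matrix_compose[OF assms(1) L(1)] by (simp add: matrix_id_mat_1)
  then show ?thesis using that[of "matrix L"] matrix_left_right_inverse by blast
qed

text \<open>Both Gram matrices change by congruence with the matrix of J, so the inverse picks up
  the inverse congruence; the factors meet cyclically under the trace and cancel.\<close>

lemma trace_form_change:
  fixes J :: "real^'n \<Rightarrow> real^'n"
  assumes "linear J" "inj J" "bilinear H'" "bilinear B'"
    and det: "det (\<chi> i j. H' (axis i 1) (axis j 1)) \<noteq> 0"
    and H: "\<And>u v. H u v = H' (J u) (J v)" and B: "\<And>u v. B u v = B' (J u) (J v)"
  shows "trace_form H B = trace_form H' B'"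
proof -
  obtain K where K: "matrix J ** K = mat 1" "K ** matrix J = mat 1"
    using linear_inj_matrix_inverse[OF assms(1,2)] by metis
  define J' where "J' = matrix J"
  define M where "M = (\<chi> i j. H' (axis i 1) (axis j 1))"
  define N where "N = (\<chi> i j. B' (axis i 1) (axis j 1))"
  note K' = K[folded J'_def] arg_cong[OF K(1), of transpose, unfolded matrix_transpose_mul, folded J'_def]
     arg_cong[OF K(2), of transpose, unfolded matrix_transpose_mul, folded J'_def]
  note inv = matrix_inv_inverse[OF det, folded M_def]
  have MJ: "(\<chi> i j. H (axis i 1) (axis j 1)) = transpose J' ** M ** J'"
    "(\<chi> i j. B (axis i 1) (axis j 1)) = transpose J' ** N ** J'"
    unfolding H B M_def N_def J'_def by (rule form_matrix_pullback[OF assms(3)], rule form_matrix_pullback[OF assms(4)])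
  have "(transpose J' ** M ** J') ** (K ** matrix_inv M ** transpose K) = mat 1"
  proof -
    have "(transpose J' ** M ** J') ** (K ** matrix_inv M ** transpose K)
       = transpose J' ** (M ** (J' ** K) ** matrix_inv M) ** transpose K"
      by (simp add: matrix_mul_assoc)
    then show ?thesis using K' inv by (simp add: transpose_mat)
  qed
  then have i: "matrix_inv (transpose J' ** M ** J') = K ** matrix_inv M ** transpose K"
    by (rule matrix_inv_eqI)
  have "trace_form H B = trace ((K ** matrix_inv M ** transpose K) ** (transpose J' ** transpose N ** J'))"
    unfolding trace_form_eq_trace MJ i by (simp add: matrix_transpose_mul transpose_transpose matrix_mul_assoc)
  also have "\<dots> = trace (K ** (matrix_inv M ** (transpose K ** transpose J') ** transpose N ** J'))"
    by (simp add: matrix_mul_assoc)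
  also have "\<dots> = trace ((matrix_inv M ** transpose N ** J') ** K)"
    using K' by (subst trace_mul_sym) (simp add: transpose_mat)
  also have "\<dots> = trace_form H' B'"
    using K' by (simp add: trace_form_eq_trace M_def N_def flip: matrix_mul_assoc)
  finally show ?thesis .
qed

text \<open>The form is only semidefinite, so B v v may vanish and the usual minimising parameter be
  missing. In that case an affine function of t stays nonnegative, which forces its slope to
  vanish.\<close>

lemma psd_Cauchy_Schwarz:
  fixes B :: "'a::real_vector \<Rightarrow> 'a \<Rightarrow> real"
  assumes "bilinear B" "\<And>u v. B u v = B v u" "\<And>u. 0 \<le> B u u"
  shows "(B u v)\<^sup>2 \<le> B u u * B v v"
proof -
  note b = bilinear_ladd[OF assms(1)] bilinear_radd[OF assms(1)] bilinear_lmul[OF assms(1)] bilinear_rmul[OF assms(1)]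
  have q: "0 \<le> B u u + 2 * t * B u v + t\<^sup>2 * B v v" for t
    using assms(3)[of "u + t *\<^sub>R v"] assms(2)[of v u] by (simp add: b power2_eq_square algebra_simps)
  show ?thesis
  proof (cases "B v v = 0")
    case True
    have "B u v = 0"
    proof (rule ccontr)
      assume "B u v \<noteq> 0"
      \<comment> \<open>This t gives the affine function the value -1.\<close>
      then show False using q[of "- (B u u + 1) / (2 * B u v)"] True by (simp add: field_simps)
    qed
    then show ?thesis using True by simp
  next
    case False
    then have "B v v > 0" using assms(3)[of v] by simp
    then show ?thesis using q[of "- B u v / B v v"] by (simp add: power2_eq_square field_simps)
  qed
qed

text \<open>Splitting off the rank one form \<open>B(\<cdot>, e\<^sub>k) B(\<cdot>, e\<^sub>k) / B(e\<^sub>k, e\<^sub>k)\<close> kills one diagonal entry of \<open>B\<close>.\<close>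

lemma psd_sum_nonneg:
  fixes B :: "real^'n \<Rightarrow> real^'n \<Rightarrow> real" and C :: "'n \<Rightarrow> 'n \<Rightarrow> real"
  assumes C: "\<And>r. 0 \<le> (\<Sum>i\<in>UNIV. \<Sum>j\<in>UNIV. C i j * (r i * r j))"
    and "bilinear B" "\<And>u v. B u v = B v u" "\<And>u. 0 \<le> B u u"
  shows "0 \<le> (\<Sum>i\<in>UNIV. \<Sum>j\<in>UNIV. C i j * B (axis i 1) (axis j 1))"
  using assms(2-)
proof (induction "card {i. B (axis i 1) (axis i 1) \<noteq> 0}" arbitrary: B rule: less_induct)
  case less
  note CS = psd_Cauchy_Schwarz[OF less.prems]
  note b = bilinear_ladd[OF less.prems(1)] bilinear_radd[OF less.prems(1)] bilinear_lmul[OF less.prems(1)] bilinear_rmul[OF less.prems(1)]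
  show ?case
  proof (cases "\<forall>i. B (axis i 1) (axis i 1) = 0")
    case True
    then have "B (axis i 1) (axis j 1) = 0" for i j
      using CS[of "axis i 1" "axis j 1"] by simp
    then show ?thesis by simp
  next
    case False
    then obtain k where k: "B (axis k 1) (axis k 1) \<noteq> 0" by blast
    define e :: "real^'n" where "e = axis k 1"
    have e: "B e e > 0" using k less.prems(3)[of e] by (simp add: e_def)
    define B' where "B' u v = B u v - B u e * B v e / B e e" for u v
    have "bilinear B'"
      unfolding bilinear_def B'_def
      by (auto intro!: linearI simp: b algebra_simps add_divide_distrib)
    moreover have "B' u v = B' v u" for u v
      using less.prems(2) by (simp add: B'_def mult.commute)
    moreover have "0 \<le> B' u u" for u
      using CS[of u e] e by (simp add: B'_def field_simps power2_eq_square)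
    moreover have "card {i. B' (axis i 1) (axis i 1) \<noteq> 0} < card {i. B (axis i 1) (axis i 1) \<noteq> 0}"
    proof (rule psubset_card_mono)
      have "B' u u \<le> B u u" for u using e by (simp add: B'_def)
      then have "{i. B' (axis i 1) (axis i 1) \<noteq> 0} \<subseteq> {i. B (axis i 1) (axis i 1) \<noteq> 0}"
        using \<open>\<And>u. 0 \<le> B' u u\<close> by (metis (mono_tags, lifting) Collect_mono order_antisym)
      moreover have "B' (axis k 1) (axis k 1) = 0" using e by (simp add: B'_def e_def)
      ultimately show "{i. B' (axis i 1) (axis i 1) \<noteq> 0} \<subset> {i. B (axis i 1) (axis i 1) \<noteq> 0}"
        using k by blast
    qed simp
    ultimately have "0 \<le> (\<Sum>i\<in>UNIV. \<Sum>j\<in>UNIV. C i j * B' (axis i 1) (axis j 1))"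
      using less.hyps[of B'] by blast
    also have "\<dots> = (\<Sum>i\<in>UNIV. \<Sum>j\<in>UNIV. C i j * B (axis i 1) (axis j 1))
       - (\<Sum>i\<in>UNIV. \<Sum>j\<in>UNIV. C i j * (B (axis i 1) e * B (axis j 1) e)) / B e e"
      by (simp add: B'_def right_diff_distrib sum_subtractf sum_divide_distrib)
    finally show ?thesis
      using C[of "\<lambda>i. B (axis i 1) e"] e by (smt (verit) divide_nonneg_pos)
  qed
qed

text \<open>Supplies the hypothesis of \<open>psd_sum_nonneg\<close>: with z the inverse Gram matrix
  applied to r, the quadratic form of that inverse at r is G x z z.\<close>

lemma (in local_riemannian) trace_form_nonneg:
  assumes x: "x \<in> U" and B: "bilinear B" "\<And>u v. B u v = B v u" "\<And>u. 0 \<le> B u u"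
  shows "0 \<le> trace_form (G x) B"
  unfolding trace_form_def gram_def[symmetric]
proof (rule psd_sum_nonneg[OF _ B])
  fix r :: "'n \<Rightarrow> real"
  let ?r = "\<chi> i. r i" and ?M = "matrix_inv (gram G x)"
  let ?z = "?M *v ?r"
  have "gram G x *v ?z = ?r"
    by (simp add: matrix_vector_mul_assoc matrix_inv_inverse[OF det_gram_nonzero[OF x]])
  then have "(\<chi> i. G x ?z (axis i 1)) = ?r" unfolding gram_mult_vec[OF x] .
  then have r: "G x ?z (axis i 1) = r i" for i by (simp add: vec_eq_iff)
  have "G x ?z ?z = (\<Sum>i\<in>UNIV. ?z $ i *\<^sub>R G x ?z (axis i 1))"
    using bilinear[OF x] by (intro linear_axis_expansion) (simp add: bilinear_def)
  also have "\<dots> = (\<Sum>i\<in>UNIV. \<Sum>j\<in>UNIV. ?M $ i $ j * (r i * r j))"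
    unfolding r by (simp add: matrix_vector_mult_def sum_distrib_left sum_distrib_right mult_ac)
  finally show "0 \<le> (\<Sum>i\<in>UNIV. \<Sum>j\<in>UNIV. ?M $ i $ j * (r i * r j))"
    using nonneg[OF x, of ?z] by simp
qed

subsection \<open>The potential of the stability operator\<close>

locale hypersurface = immersed \<A> g \<S> F
  for \<A> :: "('m::{t2_space,second_countable_topology}, 'b::finite) chart set" and g :: "('m, 'b) metric"
    and \<S> :: "('s::{t2_space,second_countable_topology}, 'a::finite) chart set" and F :: "'s \<Rightarrow> 'm" +
  fixes \<nu> :: "'s \<Rightarrow> ('m, 'b) chart \<Rightarrow> real^'b"
  assumes normal: "unit_normal \<S> \<A> g F \<nu>" and codim: "CARD('b) = CARD('a) + 1"
begin

abbreviation "Y c d \<equiv> (\<lambda>x. \<nu> (cinv c x) d)"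
abbreviation "E c d x u \<equiv> cov_deriv_along (g d) (\<Phi> c d) (Y c d) x u"

lemma smooth_Y: "c \<in> \<S> \<Longrightarrow> d \<in> \<A> \<Longrightarrow> smooth_on (V c d) (Y c d)"
  using normal unfolding unit_normal_def by blast

lemma Y_normal:
  assumes "c \<in> \<S>" "d \<in> \<A>" "x \<in> V c d"
  shows "g d (\<Phi> c d x) (Y c d x) (Y c d x) = 1" "g d (\<Phi> c d x) (Y c d x) (D\<Phi> c d x u) = 0"
proof -
  obtain p where p: "p \<in> cdom c \<inter> F -` cdom d" "x = cmap c p" using assms(3) by auto
  have "cinv c x = p" using source_chartD(8)[OF assms(1)] p by auto
  then have "cmap d (F p) = \<Phi> c d x" by (simp add: local_rep_def)
  moreover have "g d (cmap d (F p)) (\<nu> p d) (\<nu> p d) = 1 \<and>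
           (\<forall>u. g d (cmap d (F p)) (\<nu> p d) (D\<Phi> c d (cmap c p) u) = 0)"
    using normal assms p(1) unfolding unit_normal_def by blast
  ultimately show "g d (\<Phi> c d x) (Y c d x) (Y c d x) = 1" "g d (\<Phi> c d x) (Y c d x) (D\<Phi> c d x u) = 0"
    using p(2) \<open>cinv c x = p\<close> by simp_all
qed

lemma Y_change_target:
  assumes "c \<in> \<S>" "d \<in> \<A>" "e \<in> \<A>" "x \<in> V c d" "x \<in> V c e"
  shows "Y c e x = frechet_derivative (transition d e) (at (\<Phi> c d x)) (Y c d x)"
proof -
  have x: "x \<in> cimg c" "F (cinv c x) \<in> cdom d" "F (cinv c x) \<in> cdom e"
    using assms(4,5) unfolding V_eq[OF assms(1)] by auto
  then have "cinv c x \<in> points \<S>"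
    using source_chartD(5)[OF assms(1)] cdom_subset_points[OF assms(1)] by auto
  moreover have "cmap d (F (cinv c x)) = \<Phi> c d x" by (simp add: local_rep_def)
  ultimately show ?thesis using normal assms(2,3) x unfolding unit_normal_def by (metis IntI)
qed

text \<open>Differentiate the constant length of the normal.\<close>

lemma E_orthogonal:
  assumes "c \<in> \<S>" "d \<in> \<A>" "x \<in> V c d"
  shows "g d (\<Phi> c d x) (E c d x u) (Y c d x) = 0"
proof -
  interpret d: local_riemannian "cimg d" "g d" by (rule local_riemannian_chart[OF assms(2)])
  have "((\<lambda>x. g d (\<Phi> c d x) (Y c d x) (Y c d x)) has_derivative (\<lambda>u. 2 * g d (\<Phi> c d x) (E c d x u) (Y c d x))) (at x)"
    by (rule d.metric_compatible[OF smooth_on_has_derivative[OF smooth_\<Phi> assms(3)] \<Phi>_in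
        smooth_on_has_derivative[OF smooth_Y assms(3)]]) (use assms in auto)
  then have "((\<lambda>x. 1) has_derivative (\<lambda>u. 2 * g d (\<Phi> c d x) (E c d x u) (Y c d x))) (at x)"
    by (rule has_derivative_transform_within_open[OF _ open_V[OF assms(1,2)] assms(3)])
      (rule Y_normal(1)[OF assms(1,2)])
  from has_derivative_unique[OF this has_derivative_const] show ?thesis by (auto dest: fun_cong[of _ _ u])
qed

text \<open>Codimension one enters here: the image of the differential lies in the hyperplane
  orthogonal to \<nu> and has the same dimension, so it is that hyperplane.\<close>

lemma E_tangent:
  assumes "c \<in> \<S>" "d \<in> \<A>" "x \<in> V c d"
  obtains w where "D\<Phi> c d x w = E c d x u"
proof -
  interpret d: local_riemannian "cimg d" "g d" by (rule local_riemannian_chart[OF assms(2)])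
  note y = \<Phi>_in[OF assms]
  define n where "n = Y c d x"
  define a where "a = (\<Sum>b\<in>Basis. g d (\<Phi> c d x) b n *\<^sub>R b)"
  have a: "g d (\<Phi> c d x) z n = a \<bullet> z" for z
  proof -
    have "g d (\<Phi> c d x) z n = (\<Sum>b\<in>Basis. (z \<bullet> b) *\<^sub>R g d (\<Phi> c d x) b n)"
      using d.bilinear[OF y] by (intro linear_Basis_expansion) (simp add: bilinear_def)
    then show ?thesis
      by (simp only: a_def inner_sum_left inner_scaleR_left) (simp add: inner_commute mult.commute)
  qed
  have "a \<noteq> 0" using a[of n] Y_normal(1)[OF assms] by (auto simp: n_def)
  then have "dim {z. a \<bullet> z = 0} = CARD('a)"
    using codim by (simp add: dim_hyperplane)
  moreover have "dim (range (frechet_derivative (\<Phi> c d) (at x))) = CARD('a)"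
    using dim_image_eq[OF linear_D\<Phi>[OF assms], of UNIV] inj_D\<Phi>[OF assms] by simp
  moreover have "range (frechet_derivative (\<Phi> c d) (at x)) \<subseteq> {z. a \<bullet> z = 0}"
  proof clarify
    fix u
    show "a \<bullet> D\<Phi> c d x u = 0"
      using Y_normal(2)[OF assms, of u] d.sym[OF y, of n] a[of "D\<Phi> c d x u"] unfolding n_def by simp
  qed
  ultimately have "range (frechet_derivative (\<Phi> c d) (at x)) = {z. a \<bullet> z = 0}"
    by (intro subspace_dim_equal linear_subspace_image[OF linear_D\<Phi>[OF assms]] subspace_UNIV subspace_hyperplane)
      simp_all
  moreover have "E c d x u \<in> {z. a \<bullet> z = 0}"
    using E_orthogonal[OF assms] a unfolding n_def by simp
  ultimately show ?thesis using that by (metis imageE)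
qed

text \<open>The description of the shape operator is proper: existence is tangency of the derivative
  of \<nu>, uniqueness is injectivity of the differential.\<close>

lemma shape_operator_derivative:
  assumes "p \<in> points \<S>" and "c = chart_at \<S> p" "d = chart_at \<A> (F p)" "x = cmap c p"
  shows "c \<in> \<S>" "d \<in> \<A>" "p \<in> cdom c" "x \<in> V c d" "D\<Phi> c d x (shape_operator \<S> \<A> g F \<nu> p u) = E c d x u"
proof -
  show c: "c \<in> \<S>" "p \<in> cdom c" using chart_at[OF assms(1)] assms by auto
  show d: "d \<in> \<A>" using chart_at[OF F_in[OF assms(1)]] assms by auto
  show x: "x \<in> V c d" using chart_at[OF F_in[OF assms(1)]] c assms by auto
  obtain w where w: "D\<Phi> c d x w = E c d x u" using E_tangent[OF c(1) d x] by metis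
  have "\<exists>!w. D\<Phi> c d x w = E c d x u"
    using w inj_D\<Phi>[OF c(1) d x] by (metis injD)
  from theI'[OF this] show "D\<Phi> c d x (shape_operator \<S> \<A> g F \<nu> p u) = E c d x u"
    unfolding shape_operator_def Let_def assms(2-4) .
qed

text \<open>|A|^2 without the shape operator: the differential of F carries A u to the covariant
  derivative of \<nu>, so inner products can be taken in the ambient metric. The charts c and d are
  free, and for fixed charts the expression is smooth in x.\<close>

definition sff_norm_sq where
  "sff_norm_sq c d x = trace_form (h c x) (\<lambda>u v. g d (\<Phi> c d x) (E c d x u) (E c d x v))"

lemma shape_norm_sq_chart_at:
  assumes "p \<in> points \<S>" and "c = chart_at \<S> p" "d = chart_at \<A> (F p)" "x = cmap c p"
  shows "shape_norm_sq \<S> \<A> g F \<nu> p = sff_norm_sq c d x"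
proof -
  note s = shape_operator_derivative[OF assms]
  show ?thesis
    unfolding shape_norm_sq_def Let_def sff_norm_sq_def trace_form_def gram_def assms(2)[symmetric] assms(4)[symmetric]
      induced_metric_eq[OF s(1,2,4)] s(5) ..
qed

lemma bilinear_EE:
  assumes "c \<in> \<S>" "d \<in> \<A>" "x \<in> V c d"
  shows "bilinear (\<lambda>u v. g d (\<Phi> c d x) (E c d x u) (E c d x v))"
proof -
  interpret d: local_riemannian "cimg d" "g d" by (rule local_riemannian_chart[OF assms(2)])
  have lin: "linear (\<lambda>u. E c d x u)"
    using d.linear_cov_deriv_along[OF smooth_\<Phi>[OF assms(1,2)] _ smooth_Y[OF assms(1,2)] assms(3)]
      \<Phi>_in[OF assms(1,2)] by auto
  show ?thesis
    unfolding bilinear_def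
    by (auto intro!: linearI simp: linear_add[OF lin] linear_scale[OF lin] d.metric_linear[OF \<Phi>_in[OF assms]])
qed

text \<open>A change of target chart transports the derivative of \<nu> by the isometry between the
  coordinate metrics, which leaves every inner product in the trace unchanged.\<close>

lemma sff_change_target:
  assumes "c \<in> \<S>" "d \<in> \<A>" "e \<in> \<A>" "x \<in> V c d" "x \<in> V c e"
  shows "sff_norm_sq c d x = sff_norm_sq c e x"
proof -
  interpret T: local_isometry "cmap d ` (cdom d \<inter> cdom e)" "cimg e" "g d" "g e" "transition d e"
    by (rule local_isometry_transition[OF assms(2,3)])
  note \<Phi> = smooth_on_has_derivative[OF smooth_\<Phi>[OF assms(1,2)] assms(4)]
  note Y = smooth_on_has_derivative[OF smooth_Y[OF assms(1,2)] assms(4)]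
  note in_dom = \<Phi>_change_target(1)[OF assms]
  note Z = T.D_family_derivative[OF \<Phi> in_dom Y]
  have "(Y c e has_derivative (\<lambda>u. T.D2 (\<Phi> c d x) (D\<Phi> c d x u) (Y c d x) + T.D (\<Phi> c d x) (frechet_derivative (Y c d) (at x) u))) (at x)"
    by (rule has_derivative_transform_within_open[OF Z, of "V c d \<inter> V c e"])
      (use assms open_V Y_change_target[OF assms(1-3)] in auto)
  then have "frechet_derivative (Y c e) (at x) = frechet_derivative (\<lambda>y. T.D (\<Phi> c d y) (Y c d y)) (at x)"
    unfolding frechet_derivative_eqI[OF Z] by (rule frechet_derivative_eqI)
  from T.cov_deriv_along_law[OF \<Phi> in_dom Y D\<Phi>_change_target(2)[OF assms] \<Phi>_change_target(2)[OF assms] this Y_change_target[OF assms]]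
  show ?thesis
    unfolding sff_norm_sq_def by (simp add: \<Phi>_change_target(2)[OF assms] T.isometry[OF in_dom])
qed

text \<open>Only the directions of differentiation are reparametrised here, so both forms in the
  trace are pulled back by the same linear map.\<close>

lemma sff_change_source:
  assumes "c \<in> \<S>" "c' \<in> \<S>" "d \<in> \<A>" "x \<in> V c d" "x \<in> cmap c ` (cdom c \<inter> cdom c')"
  shows "sff_norm_sq c d x = sff_norm_sq c' d (transition c c' x)"
proof -
  interpret S: riemannian \<S> h by unfold_locales (rule riemannian_manifold_induced)
  interpret T: local_isometry "cmap c ` (cdom c \<inter> cdom c')" "cimg c'" "h c" "h c'" "transition c c'"
    by (rule S.local_isometry_transition[OF assms(1,2)])
  let ?\<tau> = "transition c c'"
  note V' = \<Phi>_change_source(1)[OF assms]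
  have YY: "Y c' d (?\<tau> y) = Y c d y" if "y \<in> cmap c ` (cdom c \<inter> cdom c')" for y
    using transition_in(2)[OF source_chart source_chart that, OF assms(1,2)] by simp
  have "((\<lambda>y. Y c' d (?\<tau> y)) has_derivative
      (\<lambda>u. frechet_derivative (Y c' d) (at (?\<tau> x)) (T.D x u))) (at x)"
    by (rule has_derivative_compose[OF smooth_on_has_derivative[OF T.smooth_T assms(5)]
        smooth_on_has_derivative[OF smooth_Y[OF assms(2,3)] V']])
  then have "(Y c d has_derivative (\<lambda>u. frechet_derivative (Y c' d) (at (?\<tau> x)) (T.D x u))) (at x)"
    by (rule has_derivative_transform_within_open[OF _ open_source_overlap[OF assms(1,2)] assms(5) YY])
  then have E: "E c d x u = E c' d (?\<tau> x) (T.D x u)" for u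
    unfolding cov_deriv_along_def
    by (simp add: frechet_derivative_eqI D\<Phi>_change_source[OF assms] \<Phi>_change_source(2)[OF assms] YY[OF assms(5)])
  have x': "?\<tau> x \<in> cimg c'" by (rule T.T_in[OF assms(5)])
  show ?thesis
    unfolding sff_norm_sq_def
  proof (rule trace_form_change[OF T.linear_D[OF assms(5)] T.inj_D[OF assms(5)] T.cod.bilinear[OF x']
        bilinear_EE[OF assms(2,3) V']])
    show "det (\<chi> i j. h c' (?\<tau> x) (axis i 1) (axis j 1)) \<noteq> 0"
      using T.cod.det_gram_nonzero[OF x'] by (simp add: gram_def)
  qed (simp_all add: T.isometry[OF assms(5)] E \<Phi>_change_source(2)[OF assms])
qed

text \<open>Two independent exchanges, of the source chart and then of the target chart, lead from
  the charts picked at the point to arbitrary ones.\<close>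

lemma shape_norm_sq_chart:
  assumes "c \<in> \<S>" "d \<in> \<A>" "x \<in> V c d"
  shows "shape_norm_sq \<S> \<A> g F \<nu> (cinv c x) = sff_norm_sq c d x"
proof -
  let ?p = "cinv c x"
  let ?c = "chart_at \<S> ?p" and ?d = "chart_at \<A> (F ?p)"
  have xc: "x \<in> cimg c" using assms(3) by (auto simp: cimg_def)
  then have p: "?p \<in> cdom c" "?p \<in> points \<S>"
    using source_chartD(5)[OF assms(1)] cdom_subset_points[OF assms(1)] by auto
  note s = shape_operator_derivative[OF p(2) refl refl refl]
  have x: "cmap c ?p = x" using source_chartD(6)[OF assms(1) xc] .
  have F: "F ?p \<in> cdom ?d" by (rule chart_at(2)[OF F_in[OF p(2)]])
  have xd: "x \<in> V c ?d" using F xc unfolding V_eq[OF assms(1)] by simp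
  have ov: "x \<in> cmap c ` (cdom c \<inter> cdom ?c)" using p(1) s(3) x by (metis IntI image_eqI)
  have "shape_norm_sq \<S> \<A> g F \<nu> ?p = sff_norm_sq ?c ?d (cmap ?c ?p)"
    by (rule shape_norm_sq_chart_at[OF p(2) refl refl refl])
  also have "\<dots> = sff_norm_sq c ?d x"
    using sff_change_source[OF assms(1) s(1) s(2) xd ov] by (simp add: transition_def)
  also have "\<dots> = sff_norm_sq c d x"
    by (rule sff_change_target[OF assms(1) s(2) assms(2) xd assms(3)])
  finally show ?thesis .
qed

lemma shape_norm_sq_nonneg:
  assumes "p \<in> points \<S>"
  shows "0 \<le> shape_norm_sq \<S> \<A> g F \<nu> p"
proof -
  interpret S: riemannian \<S> h by unfold_locales (rule riemannian_manifold_induced)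
  note s = shape_operator_derivative[OF assms refl refl refl]
  let ?c = "chart_at \<S> p" and ?d = "chart_at \<A> (F p)"
  interpret c: local_riemannian "cimg ?c" "h ?c" by (rule S.local_riemannian_chart[OF s(1)])
  interpret d: local_riemannian "cimg ?d" "g ?d" by (rule local_riemannian_chart[OF s(2)])
  note y = \<Phi>_in[OF s(1,2,4)]
  show ?thesis
    unfolding shape_norm_sq_chart_at[OF assms refl refl refl] sff_norm_sq_def
    using s(4) by (intro c.trace_form_nonneg bilinear_EE s(1,2,4) d.sym[OF y] d.nonneg[OF y]) (auto simp: cimg_def)
qed

lemma smooth_on_sff_norm_sq:
  assumes "c \<in> \<S>" "d \<in> \<A>"
  shows "smooth_on (V c d) (sff_norm_sq c d)"
proof -
  interpret S: riemannian \<S> h by unfold_locales (rule riemannian_manifold_induced)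
  interpret c: local_riemannian "cimg c" "h c" by (rule S.local_riemannian_chart[OF assms(1)])
  interpret d: local_riemannian "cimg d" "g d" by (rule local_riemannian_chart[OF assms(2)])
  have sub: "V c d \<subseteq> cimg c" by (auto simp: cimg_def)
  have im: "\<Phi> c d ` V c d \<subseteq> cimg d" using \<Phi>_in[OF assms] by blast
  show ?thesis
    unfolding sff_norm_sq_def trace_form_def gram_def[symmetric]
    by (intro smooth_on_sum smooth_on_mult smooth_on_subset[OF c.smooth_on_matrix_inv_gram sub] open_V assms
        d.smooth_on_apply d.smooth_on_cov_deriv_along smooth_\<Phi> smooth_Y im)
qed

context
  fixes f :: "'m \<Rightarrow> real" assumes smooth_f: "smooth_fun \<A> f"
begin

lemma Ric_f_normal_chart:
  assumes "c \<in> \<S>" "d \<in> \<A>" "x \<in> V c d"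
  shows "Ric_f_normal \<A> g f F \<nu> (cinv c x)
    = bakry_emery_ricci (g d) (f \<circ> cinv d) (\<Phi> c d x) (Y c d x) (Y c d x)"
proof -
  let ?p = "cinv c x"
  let ?d = "chart_at \<A> (F ?p)"
  have xc: "x \<in> cimg c" using assms(3) by (auto simp: cimg_def)
  then have "?p \<in> points \<S>"
    using source_chartD(5)[OF assms(1)] cdom_subset_points[OF assms(1)] by auto
  note d = chart_at[OF F_in[OF this]]
  have xd: "x \<in> V c ?d" using d xc unfolding V_eq[OF assms(1)] by simp
  interpret T: local_isometry "cmap d ` (cdom d \<inter> cdom ?d)" "cimg ?d" "g d" "g ?d" "transition d ?d"
    by (rule local_isometry_transition[OF assms(2) d(1)])
  note * = assms(1,2) d(1) assms(3) xd
  have "smooth_on (cimg ?d) (f \<circ> cinv ?d)" using smooth_f d(1) by (simp add: smooth_fun_def)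
  note law = T.bakry_emery_law[OF this smooth_fun_transition[OF chart[OF assms(2)] chart[OF d(1)]]
      \<Phi>_change_target(1)[OF *], of "Y c d x" "Y c d x", folded Y_change_target[OF *] \<Phi>_change_target(2)[OF *]]
  have "cmap ?d (F ?p) = \<Phi> c ?d x" by (simp add: local_rep_def)
  then show ?thesis
    unfolding Ric_f_normal_def Let_def using law by (simp add: o_def)
qed

text \<open>Near p the charts chosen at p are kept fixed, where the chart formulas for both summands
  are smooth. Measurability of the stability integrand, and its boundedness on compact sets, rest on
  this.\<close>

lemma continuous_on_stability_potential:
  "continuous_on (points \<S>) (\<lambda>p. shape_norm_sq \<S> \<A> g F \<nu> p + Ric_f_normal \<A> g f F \<nu> p)"
proof (rule continuous_on_pointsI[OF source_atlas])
  fix p assume p: "p \<in> points \<S>"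
  note s = shape_operator_derivative[OF p refl refl refl]
  define c d where "c = chart_at \<S> p" and "d = chart_at \<A> (F p)"
  note s = s[folded c_def d_def]
  interpret d: local_riemannian "cimg d" "g d" by (rule local_riemannian_chart[OF s(2)])
  have "smooth_on (cimg d) (f \<circ> cinv d)" using smooth_f s(2) by (simp add: smooth_fun_def)
  then interpret R: bilinear_family "cimg d" "bakry_emery_ricci (g d) (f \<circ> cinv d)"
    by (rule d.bilinear_family_bakry_emery)
  have im: "\<Phi> c d ` V c d \<subseteq> cimg d" using \<Phi>_in[OF s(1,2)] by blast
  have "smooth_on (V c d) (\<lambda>x. sff_norm_sq c d x
      + bakry_emery_ricci (g d) (f \<circ> cinv d) (\<Phi> c d x) (Y c d x) (Y c d x))"
    by (intro smooth_on_add smooth_on_sff_norm_sq R.smooth_on_apply open_V smooth_\<Phi> smooth_Y im s(1,2))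
  then show "\<exists>c\<in>\<S>. \<exists>V r. open V \<and> V \<subseteq> cimg c \<and> p \<in> cdom c \<and> cmap c p \<in> V \<and>
      continuous_on V r \<and> (\<forall>x\<in>V. shape_norm_sq \<S> \<A> g F \<nu> (cinv c x) + Ric_f_normal \<A> g f F \<nu> (cinv c x) = r x)"
    by (intro bexI[OF _ s(1)] exI[of _ "V c d"] exI conjI ballI)
      (use s open_V shape_norm_sq_chart[OF s(1,2)] Ric_f_normal_chart[OF s(1,2)] in
        \<open>auto intro: smooth_on_imp_continuous_on simp: cimg_def\<close>)
qed

text \<open>|A|^2 drops out by nonnegativity, and the curvature bound is applied to a vector of
  length 1.\<close>

lemma stability_potential_ge:
  assumes "Ric_f_ge \<A> g f k" "p \<in> points \<S>"
  shows "k \<le> shape_norm_sq \<S> \<A> g F \<nu> p + Ric_f_normal \<A> g f F \<nu> p"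
proof -
  note s = shape_operator_derivative[OF assms(2) refl refl refl]
  let ?c = "chart_at \<S> p" and ?d = "chart_at \<A> (F p)"
  have p: "cinv ?c (cmap ?c p) = p" using source_chartD(8) s by metis
  have "k * g ?d (\<Phi> ?c ?d (cmap ?c p)) (Y ?c ?d (cmap ?c p)) (Y ?c ?d (cmap ?c p))
    \<le> bakry_emery_ricci (g ?d) (f \<circ> cinv ?d) (\<Phi> ?c ?d (cmap ?c p)) (Y ?c ?d (cmap ?c p)) (Y ?c ?d (cmap ?c p))"
    using assms(1) \<Phi>_in[OF s(1,2,4)] s(2) unfolding Ric_f_ge_def by blast
  then have "k \<le> Ric_f_normal \<A> g f F \<nu> p"
    unfolding Y_normal(1)[OF s(1,2,4)] using Ric_f_normal_chart[OF s(1,2,4)] p by simp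
  then show ?thesis using shape_norm_sq_nonneg[OF assms(2)] by simp
qed

end

end

section \<open>Continuity along curves and piecewise C^1 maps\<close>

lemma (in bilinear_family) continuous_on_apply:
  assumes "continuous_on V \<phi>" "\<phi> ` V \<subseteq> U" "continuous_on V a" "continuous_on V b"
  shows "continuous_on V (\<lambda>x. B (\<phi> x) (a x) (b x))"
proof -
  have "continuous_on V (\<lambda>x. \<Sum>i\<in>Basis. \<Sum>j\<in>Basis. ((a x \<bullet> i) * (b x \<bullet> j)) *\<^sub>R B (\<phi> x) i j)"
    by (intro continuous_intros assms continuous_on_compose2[OF smooth_on_imp_continuous_on[OF smooth] assms(1,2)])
  then show ?thesis
    by (rule continuous_on_eq) (use assms(2) in \<open>auto intro: bilinear_Basis_expansion[OF bilinear, symmetric]\<close>)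
qed

lemma piecewise_C1_differentiable_on_cong:
  fixes f h :: "real \<Rightarrow> 'a::real_normed_vector"
  assumes "f piecewise_C1_differentiable_on {a..b}" "\<And>t. t \<in> {a..b} \<Longrightarrow> f t = h t"
  shows "h piecewise_C1_differentiable_on {a..b}"
proof -
  have cont: "continuous_on {a..b} f"
    using assms(1) by (simp add: piecewise_C1_differentiable_on_def)
  obtain N where "finite N" "f C1_differentiable_on {a..b} - N"
    using assms(1) by (auto simp: piecewise_C1_differentiable_on_def)
  then obtain D where ND: "finite N" "\<And>t. t \<in> {a..b} - N \<Longrightarrow> (f has_vector_derivative D t) (at t)"
    "continuous_on ({a..b} - N) D" unfolding C1_differentiable_on_def by blast
  \<comment> \<open>The endpoints join the exceptional set because the derivatives are two-sided,
    while h is known only on the interval.\<close>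
  have "h C1_differentiable_on {a..b} - (N \<union> {a, b})"
    unfolding C1_differentiable_on_def
  proof (intro exI conjI ballI)
    fix t assume t: "t \<in> {a..b} - (N \<union> {a, b})"
    show "(h has_vector_derivative D t) (at t)"
      by (rule has_vector_derivative_transform_within_open[OF ND(2), of _ "{a<..<b}"]) (use t assms(2) in auto)
  qed (rule continuous_on_subset[OF ND(3)], auto)
  then show ?thesis
    using ND(1) continuous_on_eq[OF cont assms(2)] unfolding piecewise_C1_differentiable_on_def
    by (intro conjI exI[of _ "N \<union> {a, b}"]) auto
qed

subsection \<open>The gradient\<close>

context local_riemannian
begin

lemma gradient:
  assumes "smooth_on U k" "x \<in> U"
  shows "G x (gradient G k x) w = frechet_derivative k (at x) w"
  using theI'[OF riesz_ex1[OF assms(2) smooth_on_linear_frechet[OF assms]]]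
  unfolding gradient_def by blast

lemma smooth_on_gradient: "smooth_on U k \<Longrightarrow> smooth_on U (gradient G k)"
  by (rule smooth_on_riesz[where l="\<lambda>x w. frechet_derivative k (at x) w"])
    (auto intro: smooth_on_frechet_derivative gradient)

text \<open>Testing the bound on the gradient itself gives a^2 \<le> a for its squared length
  a.\<close>

lemma gradient_norm_le:
  assumes "smooth_on U k" "x \<in> U" "\<And>v. (frechet_derivative k (at x) v)\<^sup>2 \<le> G x v v"
  shows "G x (gradient G k x) (gradient G k x) \<le> 1"
proof (rule ccontr)
  let ?a = "G x (gradient G k x) (gradient G k x)"
  assume "\<not> ?a \<le> 1"
  moreover have "?a\<^sup>2 \<le> ?a" using assms(3)[of "gradient G k x"] gradient[OF assms(1,2)] by simp
  ultimately show False by (simp add: power2_eq_square)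
qed

end

text \<open>Both sides have the same inner product with every D w, since differentials pull
  back.\<close>

lemma (in local_isometry) gradient_law:
  assumes "smooth_on U' k'" "smooth_on U k" "\<And>y. y \<in> U \<Longrightarrow> k' (T y) = k y" "x \<in> U"
  shows "D x (gradient G k x) = gradient G' k' (T x)"
proof (rule cod.metric_eqI[OF T_in[OF assms(4)]])
  fix w'
  obtain w where w: "w' = D x w" using surj_D[OF assms(4)] by (metis surjD)
  show "G' (T x) (D x (gradient G k x)) w' = G' (T x) (gradient G' k' (T x)) w'"
    unfolding w isometry[OF assms(4), symmetric] dom.gradient[OF assms(2,4)]
      cod.gradient[OF assms(1) T_in[OF assms(4)]]
    by (rule frechet_pullback[OF assms(1,3,4)])
qed

context riemannian
begin

lemma smooth_fun_chart: "smooth_fun \<A> u \<Longrightarrow> c \<in> \<A> \<Longrightarrow> smooth_on (cimg c) (u \<circ> cinv c)"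
  by (simp add: smooth_fun_def)

lemma cinv_in_points: "c \<in> \<A> \<Longrightarrow> x \<in> cimg c \<Longrightarrow> cinv c x \<in> points \<A>"
  using chartD(5) cdom_subset_points by blast

lemma grad_norm_sq_chart:
  assumes "smooth_fun \<A> u" "c \<in> \<A>" "x \<in> cimg c"
  shows "grad_norm_sq \<A> g u (cinv c x) =
    g c x (gradient (g c) (u \<circ> cinv c) x) (gradient (g c) (u \<circ> cinv c) x)"
proof -
  let ?c = "chart_at \<A> (cinv c x)"
  note c' = chart_at[OF cinv_in_points[OF assms(2,3)]]
  have x: "x \<in> cmap c ` (cdom c \<inter> cdom ?c)"
    using c' assms(3) chartD(5)[OF assms(2)] by (simp add: chart_image_Int[OF chart[OF assms(2)]])
  interpret T: local_isometry "cmap c ` (cdom c \<inter> cdom ?c)" "cimg ?c" "g c" "g ?c" "transition c ?c"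
    by (rule local_isometry_transition[OF assms(2) c'(1)])
  have sm: "smooth_on (cmap c ` (cdom c \<inter> cdom ?c)) (u \<circ> cinv c)"
    by (rule smooth_on_subset[OF smooth_fun_chart[OF assms(1,2)]]) (auto simp: cimg_def)
  from T.gradient_law[OF smooth_fun_chart[OF assms(1) c'(1)] sm
      smooth_fun_transition[OF chart[OF assms(2)] chart[OF c'(1)]] x]
  show ?thesis
    by (simp add: grad_norm_sq_def Let_def T.isometry[OF x] transition_def o_def)
qed

lemma continuous_on_grad_norm_sq:
  assumes "smooth_fun \<A> u"
  shows "continuous_on (points \<A>) (grad_norm_sq \<A> g u)"
proof (rule continuous_on_pointsI[OF atlas])
  fix p assume "p \<in> points \<A>"
  then obtain c where c: "c \<in> \<A>" "p \<in> cdom c" by (auto simp: points_def)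
  interpret c: local_riemannian "cimg c" "g c" by (rule local_riemannian_chart[OF c(1)])
  have "smooth_on (cimg c) (\<lambda>x. g c x (gradient (g c) (u \<circ> cinv c) x) (gradient (g c) (u \<circ> cinv c) x))"
    by (intro c.smooth_on_apply c.open_dom smooth_on_ident c.smooth_on_gradient smooth_fun_chart assms c(1)) auto
  then show "\<exists>c\<in>\<A>. \<exists>V r. open V \<and> V \<subseteq> cimg c \<and> p \<in> cdom c \<and> cmap c p \<in> V \<and>
      continuous_on V r \<and> (\<forall>x\<in>V. grad_norm_sq \<A> g u (cinv c x) = r x)"
    by (intro bexI[OF _ c(1)] exI[of _ "cimg c"] conjI ballI grad_norm_sq_chart[OF assms c(1)]
        exI[of _ "\<lambda>x. g c x (gradient (g c) (u \<circ> cinv c) x) (gradient (g c) (u \<circ> cinv c) x)"])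
      (use c c.open_dom chartD(7)[OF c(1)] in \<open>auto intro: smooth_on_imp_continuous_on\<close>)
qed

text \<open>The bound |du| \<le> 1 is put on the differential rather than on its metric dual, which
  suits the chain rule and the transformation between charts.\<close>

definition short :: "('m \<Rightarrow> real) \<Rightarrow> bool" where
  "short u \<longleftrightarrow> smooth_fun \<A> u \<and>
     (\<forall>c\<in>\<A>. \<forall>x\<in>cimg c. \<forall>v. (frechet_derivative (u \<circ> cinv c) (at x) v)\<^sup>2 \<le> g c x v v)"

lemma grad_norm_sq_le:
  assumes "short u" "p \<in> points \<A>"
  shows "grad_norm_sq \<A> g u p \<le> 1"
proof -
  obtain c where c: "c \<in> \<A>" "p \<in> cdom c" using assms(2) by (auto simp: points_def)
  interpret c: local_riemannian "cimg c" "g c" by (rule local_riemannian_chart[OF c(1)])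
  note x = chartD(7)[OF c]
  have u: "smooth_fun \<A> u" using assms(1) by (simp add: short_def)
  have "g c (cmap c p) (gradient (g c) (u \<circ> cinv c) (cmap c p)) (gradient (g c) (u \<circ> cinv c) (cmap c p)) \<le> 1"
    by (rule c.gradient_norm_le[OF smooth_fun_chart[OF u c(1)] x]) (use assms(1) c(1) x in \<open>auto simp: short_def\<close>)
  then show ?thesis using grad_norm_sq_chart[OF u c(1) x] chartD(8)[OF c] by simp
qed

subsection \<open>Length of curves\<close>

text \<open>\<open>speed\<close> reads the derivative in a chosen chart; regularity asks for it in
  some chart around the point, and \<open>speed_eq\<close> converts one into the other.\<close>

definition regular_at :: "(real \<Rightarrow> 'm) \<Rightarrow> real \<Rightarrow> bool" where
  "regular_at \<gamma> t \<longleftrightarrow> isCont \<gamma> t \<and>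
     (\<exists>c\<in>\<A>. \<gamma> t \<in> cdom c \<and> (\<exists>v. ((cmap c \<circ> \<gamma>) has_vector_derivative v) (at t)))"

text \<open>Continuity of \<gamma> at t keeps nearby points of the curve in the domain of c, so that
  the chain rule for the transition applies; the transition is an isometry.\<close>

lemma speed_eq:
  assumes "isCont \<gamma> t" "c \<in> \<A>" "\<gamma> t \<in> cdom c" "((cmap c \<circ> \<gamma>) has_vector_derivative v) (at t)"
  shows "speed \<A> g \<gamma> t = sqrt (g c (cmap c (\<gamma> t)) v v)"
proof -
  let ?c = "chart_at \<A> (\<gamma> t)"
  have "\<gamma> t \<in> points \<A>" using assms(2,3) by (auto simp: points_def)
  note c' = chart_at[OF this]
  have x: "cmap c (\<gamma> t) \<in> cmap c ` (cdom c \<inter> cdom ?c)" using c' assms(3) by auto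
  interpret T: local_isometry "cmap c ` (cdom c \<inter> cdom ?c)" "cimg ?c" "g c" "g ?c" "transition c ?c"
    by (rule local_isometry_transition[OF assms(2) c'(1)])
  have "((\<lambda>s. transition c ?c ((cmap c \<circ> \<gamma>) s)) has_derivative (\<lambda>h. T.D ((cmap c \<circ> \<gamma>) t) (h *\<^sub>R v))) (at t)"
    by (rule has_derivative_compose[OF assms(4)[unfolded has_vector_derivative_def] smooth_on_has_derivative[OF T.smooth_T]])
      (use x in simp)
  moreover have "\<forall>\<^sub>F s in at t. transition c ?c ((cmap c \<circ> \<gamma>) s) = (cmap ?c \<circ> \<gamma>) s"
  proof -
    have "\<forall>\<^sub>F s in at t. \<gamma> s \<in> cdom c"
      using assms(1) chartD(1)[OF assms(2)] assms(3) by (auto simp: isCont_def dest: topological_tendstoD)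
    then show ?thesis
      by eventually_elim (simp add: transition_def chartD(8)[OF assms(2)])
  qed
  ultimately have "((cmap ?c \<circ> \<gamma>) has_derivative (\<lambda>h. T.D ((cmap c \<circ> \<gamma>) t) (h *\<^sub>R v))) (at t)"
    by (rule has_derivative_transform_eventually)
      (simp_all add: transition_def chartD(8)[OF assms(2,3)])
  then have "((cmap ?c \<circ> \<gamma>) has_vector_derivative T.D (cmap c (\<gamma> t)) v) (at t)"
    by (simp add: has_vector_derivative_def linear_scale[OF T.linear_D[OF x]])
  then have "vector_derivative (cmap ?c \<circ> \<gamma>) (at t) = T.D (cmap c (\<gamma> t)) v"
    by (rule vector_derivative_at)
  then show ?thesis
    by (simp add: speed_def Let_def T.isometry[OF x] transition_def chartD(8)[OF assms(2,3)])
qed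

text \<open>Compactness of [0, 1] in Bolzano's form: a property inherited by concatenation needs
  checking only on intervals mapped into one chart domain.\<close>

lemma curve_induct:
  assumes "pw_C1_curve \<A> \<gamma>"
    and trans: "\<And>a b c. 0 \<le> a \<Longrightarrow> a \<le> b \<Longrightarrow> b \<le> c \<Longrightarrow> c \<le> 1 \<Longrightarrow> P a b \<Longrightarrow> P b c \<Longrightarrow> P a c"
    and local: "\<And>c a b. c \<in> \<A> \<Longrightarrow> 0 \<le> a \<Longrightarrow> a \<le> b \<Longrightarrow> b \<le> 1 \<Longrightarrow> \<gamma> ` {a..b} \<subseteq> cdom c \<Longrightarrow> P a b"
  shows "P 0 (1::real)"
proof -
  have cont: "continuous_on {0..1} \<gamma>" and pts: "\<gamma> ` {0..1} \<subseteq> points \<A>"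
    using assms(1) by (auto simp: pw_C1_curve_def)
  have "0 \<le> (0::real) \<and> 1 \<le> (1::real) \<longrightarrow> P 0 1"
  proof (rule Bolzano[where P="\<lambda>a b. 0 \<le> a \<and> b \<le> 1 \<longrightarrow> P a b"])
    fix x :: real assume x: "0 \<le> x" "x \<le> 1"
    then obtain c where c: "c \<in> \<A>" "\<gamma> x \<in> cdom c" using pts by (force simp: points_def)
    have "\<forall>\<^sub>F y in at x within {0..1}. \<gamma> y \<in> cdom c"
      using cont x c chartD(1)[OF c(1)] by (auto simp: continuous_on_def dest: topological_tendstoD)
    then obtain d where d: "d > 0" "\<And>y. y \<in> {0..1} \<Longrightarrow> y \<noteq> x \<Longrightarrow> dist y x < d \<Longrightarrow> \<gamma> y \<in> cdom c"
      unfolding eventually_at by blast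
    show "\<exists>d>0. \<forall>a b. a \<le> x \<and> x \<le> b \<and> b - a < d \<longrightarrow> 0 \<le> a \<and> b \<le> 1 \<longrightarrow> P a b"
    proof (intro exI[of _ d] conjI allI impI d(1))
      fix a b assume ab: "a \<le> x \<and> x \<le> b \<and> b - a < d" "0 \<le> a \<and> b \<le> 1"
      have "\<gamma> y \<in> cdom c" if "y \<in> {a..b}" for y
        using d(2)[of y] c(2) ab that by (cases "y = x") (auto simp: dist_real_def)
      then show "P a b" using ab by (intro local[OF c(1)]) auto
    qed
  qed (use trans in auto)
  then show ?thesis by simp
qed

lemma curve_local_derivative:
  assumes "pw_C1_curve \<A> \<gamma>" "c \<in> \<A>" "0 \<le> a" "a \<le> b" "b \<le> 1" "\<gamma> ` {a..b} \<subseteq> cdom c"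
  obtains N D where "finite N" "continuous_on {a..b} (cmap c \<circ> \<gamma>)" "continuous_on ({a..b} - N) D"
    "\<forall>t\<in>{a..b} - N. ((cmap c \<circ> \<gamma>) has_vector_derivative D t) (at t)"
    "\<forall>t\<in>{a<..<b}. isCont \<gamma> t"
    "\<forall>t\<in>{a<..<b} - N. speed \<A> g \<gamma> t = sqrt (g c ((cmap c \<circ> \<gamma>) t) (D t) (D t))"
proof -
  have "(cmap c \<circ> \<gamma>) piecewise_C1_differentiable_on {a..b}"
    using assms unfolding pw_C1_curve_def by blast
  then obtain N D where ND: "finite N" "continuous_on {a..b} (cmap c \<circ> \<gamma>)" "continuous_on ({a..b} - N) D"
    "\<And>t. t \<in> {a..b} - N \<Longrightarrow> ((cmap c \<circ> \<gamma>) has_vector_derivative D t) (at t)"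
    by (auto simp: piecewise_C1_differentiable_on_def C1_differentiable_on_def)
  have cont: "isCont \<gamma> t" if "t \<in> {a<..<b}" for t
  proof -
    have "continuous_on {a<..<b} \<gamma>"
      using assms by (auto simp: pw_C1_curve_def intro: continuous_on_subset)
    then show ?thesis using that by (simp add: continuous_on_eq_continuous_at)
  qed
  have "speed \<A> g \<gamma> t = sqrt (g c ((cmap c \<circ> \<gamma>) t) (D t) (D t))" if "t \<in> {a<..<b} - N" for t
  proof -
    have "t \<in> {a..b}" using that by simp
    then have "\<gamma> t \<in> cdom c" using assms(6) by blast
    then show ?thesis using speed_eq[OF cont assms(2) _ ND(4), of t] that by simp
  qed
  with ND cont that show ?thesis by blast
qed

text \<open>Concatenation keeps the exceptional set finite: it consists of the exceptional
  parameters of the pieces and the division points.\<close>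

lemma curve_regular:
  assumes "pw_C1_curve \<A> \<gamma>"
  obtains N where "finite N" "\<And>t. t \<in> {0<..<1} - N \<Longrightarrow> regular_at \<gamma> t \<and> isCont (speed \<A> g \<gamma>) t"
proof -
  have "\<exists>N. finite N \<and> (\<forall>t\<in>{0<..<1} - N. regular_at \<gamma> t \<and> isCont (speed \<A> g \<gamma>) t)"
  proof (rule curve_induct[OF assms, where P="\<lambda>a b. \<exists>N. finite N \<and> (\<forall>t\<in>{a<..<b} - N. regular_at \<gamma> t \<and> isCont (speed \<A> g \<gamma>) t)"])
    fix a b c :: real
    assume "\<exists>N. finite N \<and> (\<forall>t\<in>{a<..<b} - N. regular_at \<gamma> t \<and> isCont (speed \<A> g \<gamma>) t)"
      "\<exists>N. finite N \<and> (\<forall>t\<in>{b<..<c} - N. regular_at \<gamma> t \<and> isCont (speed \<A> g \<gamma>) t)"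
    then obtain N N' where "finite N" "\<forall>t\<in>{a<..<b} - N. regular_at \<gamma> t \<and> isCont (speed \<A> g \<gamma>) t"
      "finite N'" "\<forall>t\<in>{b<..<c} - N'. regular_at \<gamma> t \<and> isCont (speed \<A> g \<gamma>) t" by metis
    moreover have "t \<in> {a<..<b} - N \<or> t \<in> {b<..<c} - N'" if "t \<in> {a<..<c} - insert b (N \<union> N')" for t
      using that by auto
    ultimately show "\<exists>N. finite N \<and> (\<forall>t\<in>{a<..<c} - N. regular_at \<gamma> t \<and> isCont (speed \<A> g \<gamma>) t)"
      by (intro exI[of _ "insert b (N \<union> N')"]) blast
  next
    fix c and a b :: real
    assume *: "c \<in> \<A>" "0 \<le> a" "a \<le> b" "b \<le> 1" "\<gamma> ` {a..b} \<subseteq> cdom c"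
    obtain N D where ND: "finite N" "continuous_on {a..b} (cmap c \<circ> \<gamma>)" "continuous_on ({a..b} - N) D"
      "\<forall>t\<in>{a..b} - N. ((cmap c \<circ> \<gamma>) has_vector_derivative D t) (at t)"
      "\<forall>t\<in>{a<..<b}. isCont \<gamma> t"
      "\<forall>t\<in>{a<..<b} - N. speed \<A> g \<gamma> t = sqrt (g c ((cmap c \<circ> \<gamma>) t) (D t) (D t))"
      by (rule curve_local_derivative[OF assms *])
    note ND = ND[rule_format]
    interpret c: local_riemannian "cimg c" "g c" by (rule local_riemannian_chart[OF *(1)])
    have "continuous_on ({a<..<b} - N) (\<lambda>t. sqrt (g c ((cmap c \<circ> \<gamma>) t) (D t) (D t)))"
      by (intro continuous_on_real_sqrt c.continuous_on_apply continuous_on_subset[OF ND(2)] continuous_on_subset[OF ND(3)])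
        (use *(5) chartD(7)[OF *(1)] in \<open>auto simp: image_subset_iff\<close>)
    then have "continuous_on ({a<..<b} - N) (speed \<A> g \<gamma>)"
      by (rule continuous_on_eq) (simp add: ND(6))
    moreover have "open ({a<..<b} - N)" using ND(1) by (simp add: open_Diff finite_imp_closed)
    ultimately have "isCont (speed \<A> g \<gamma>) t" if "t \<in> {a<..<b} - N" for t
      using that by (simp add: continuous_on_eq_continuous_at)
    moreover have "regular_at \<gamma> t" if "t \<in> {a<..<b} - N" for t
      unfolding regular_at_def using ND(4)[of t] ND(5)[of t] *(1,5) that by fastforce
    ultimately show "\<exists>N. finite N \<and> (\<forall>t\<in>{a<..<b} - N. regular_at \<gamma> t \<and> isCont (speed \<A> g \<gamma>) t)"
      using ND(1) by blast
  qed
  then show ?thesis using that by blast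
qed

lemma speed_nonneg_regular: "regular_at \<gamma> t \<Longrightarrow> 0 \<le> speed \<A> g \<gamma> t"
proof -
  assume "regular_at \<gamma> t"
  then obtain c v where c: "isCont \<gamma> t" "c \<in> \<A>" "\<gamma> t \<in> cdom c" "((cmap c \<circ> \<gamma>) has_vector_derivative v) (at t)"
    unfolding regular_at_def by blast
  interpret c: local_riemannian "cimg c" "g c" by (rule local_riemannian_chart[OF c(2)])
  show ?thesis using speed_eq[OF c] c.nonneg[OF chartD(7)[OF c(2,3)]] by simp
qed

text \<open>A Borel version s of the speed, corrected on a finite set and zero outside [0, 1].
  Measurability is what adding lengths and affine substitution require.\<close>

lemma curve_length_borel:
  assumes "pw_C1_curve \<A> \<gamma>"
  obtains N s where "finite N" "{0, 1} \<subseteq> N" "s \<in> borel_measurable borel" "\<forall>t. 0 \<le> s t"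
    "\<forall>t. t \<notin> {0..1} \<longrightarrow> s t = 0"
    "\<forall>t\<in>{0..1} - N. regular_at \<gamma> t \<and> s t = speed \<A> g \<gamma> t"
    "curve_length \<A> g \<gamma> = (\<integral>\<^sup>+ t. ennreal (s t) \<partial>lborel)"
proof -
  obtain N where N: "finite N" "\<And>t. t \<in> {0<..<1} - N \<Longrightarrow> regular_at \<gamma> t \<and> isCont (speed \<A> g \<gamma>) t"
    using curve_regular[OF assms] by metis
  define s where "s t = indicator ({0<..<1} - N) t *\<^sub>R speed \<A> g \<gamma> t" for t
  have "open ({0<..<1} - N)" using N(1) by (simp add: open_Diff finite_imp_closed)
  moreover have "continuous_on ({0<..<1} - N) (speed \<A> g \<gamma>)"
    using N(2) by (simp add: continuous_at_imp_continuous_on)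
  ultimately have s: "s \<in> borel_measurable borel"
    unfolding s_def by (intro borel_measurable_continuous_on_indicator) auto
  have eq: "s t = speed \<A> g \<gamma> t" if "t \<in> {0..1} - (N \<union> {0, 1})" for t
    using that by (auto simp: s_def indicator_def)
  have nn: "0 \<le> s t" for t using N(2)[of t] speed_nonneg_regular by (auto simp: s_def indicator_def)
  have zero: "s t = 0" if "t \<notin> {0..1}" for t using that by (auto simp: s_def)
  have "AE t in lborel. t \<notin> N \<union> {0, 1}"
    using N(1) by (intro AE_not_in finite_imp_null_set_lborel) simp
  then have "AE t in lborel. ennreal (speed \<A> g \<gamma> t) * indicator {0..1} t = ennreal (s t)"
    by eventually_elim (use eq zero in \<open>auto simp: indicator_def\<close>)
  then have "curve_length \<A> g \<gamma> = (\<integral>\<^sup>+ t. ennreal (s t) \<partial>lborel)"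
    unfolding curve_length_def by (rule nn_integral_cong_AE)
  with that[of "N \<union> {0, 1}" s] N s nn zero eq show ?thesis by (auto simp: less_le)
qed

text \<open>Serves reversal (m = -1) and concatenation (m = 2). Agreement is demanded only on an
  open set W because a concatenated curve follows each piece on one half of the interval
  only.\<close>

lemma speed_affine:
  assumes "regular_at \<gamma> (m * t + k)" "open W" "t \<in> W" "\<And>s. s \<in> W \<Longrightarrow> \<eta> s = \<gamma> (m * s + k)"
  shows "speed \<A> g \<eta> t = \<bar>m\<bar> * speed \<A> g \<gamma> (m * t + k)"
proof -
  obtain c v where c: "isCont \<gamma> (m * t + k)" "c \<in> \<A>" "\<gamma> (m * t + k) \<in> cdom c"
    "((cmap c \<circ> \<gamma>) has_vector_derivative v) (at (m * t + k))"
    using assms(1) unfolding regular_at_def by blast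
  interpret c: local_riemannian "cimg c" "g c" by (rule local_riemannian_chart[OF c(2)])
  have aff: "((\<lambda>s. m * s + k) has_vector_derivative m) (at t)"
    by (auto intro!: derivative_eq_intros simp flip: has_real_derivative_iff_has_vector_derivative)
  have "((cmap c \<circ> \<gamma>) \<circ> (\<lambda>s. m * s + k) has_vector_derivative m *\<^sub>R v) (at t)"
    by (rule vector_diff_chain_at[OF aff c(4)])
  then have 1: "((cmap c \<circ> \<eta>) has_vector_derivative m *\<^sub>R v) (at t)"
    by (rule has_vector_derivative_transform_within_open[OF _ assms(2,3)]) (simp add: assms(4))
  have "isCont (\<lambda>s. \<gamma> (m * s + k)) t"
    by (rule isCont_o2[where f="\<lambda>s. m * s + k" and g=\<gamma>, OF _ c(1)]) (intro continuous_intros)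
  then have "isCont \<eta> t"
    using assms(2-4) by (subst isCont_cong[where g="\<lambda>s. \<gamma> (m * s + k)"]) (auto simp: eventually_nhds)
  from speed_eq[OF this c(2) _ 1] show ?thesis
    using speed_eq[OF c] c(3) assms(3,4) chartD(7)[OF c(2,3)]
    by (simp add: c.metric_linear real_sqrt_mult)
qed

lemma curve_continuous: "pw_C1_curve \<A> \<gamma> \<Longrightarrow> continuous_on {0..1} \<gamma>"
  by (simp add: pw_C1_curve_def)

text \<open>The parameter is written \<open>- 1 * t + 1\<close> to be an instance of the affine
  substitution \<open>m * t + k\<close>.\<close>

lemma pw_C1_curve_reversepath:
  assumes "pw_C1_curve \<A> \<gamma>"
  shows "pw_C1_curve \<A> (\<lambda>t. \<gamma> (- 1 * t + 1))"
  unfolding pw_C1_curve_def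
proof (intro conjI ballI allI impI)
  show "continuous_on {0..1} (\<lambda>t. \<gamma> (- 1 * t + 1))"
    by (rule continuous_on_compose2[OF curve_continuous[OF assms]]) (auto intro!: continuous_intros)
  show "(\<lambda>t. \<gamma> (- 1 * t + 1)) ` {0..1} \<subseteq> points \<A>"
  proof clarify
    fix t :: real assume "t \<in> {0..1}"
    then have "- 1 * t + 1 \<in> {0..1}" by simp
    then show "\<gamma> (- 1 * t + 1) \<in> points \<A>" using assms unfolding pw_C1_curve_def by blast
  qed
  fix c a b assume c: "c \<in> \<A>" and ab: "0 \<le> a \<and> a \<le> b \<and> b \<le> 1 \<and> (\<lambda>t. \<gamma> (- 1 * t + 1)) ` {a..b} \<subseteq> cdom c"
  have im: "(\<lambda>x. - 1 * x + 1) ` {a..b} = {1 - b..1 - a}" by force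
  then have "\<gamma> ` {1 - b..1 - a} \<subseteq> cdom c"
    using ab by (simp only: im[symmetric] image_image)
  then have "(cmap c \<circ> \<gamma>) piecewise_C1_differentiable_on ((\<lambda>x. - 1 * x + 1) ` {a..b})"
    unfolding im using assms c ab unfolding pw_C1_curve_def by auto
  from piecewise_C1_differentiable_affine[OF this]
  show "(cmap c \<circ> (\<lambda>t. \<gamma> (- 1 * t + 1))) piecewise_C1_differentiable_on {a..b}"
    by (simp add: o_def)
qed

lemma curve_length_reversepath_le:
  assumes "pw_C1_curve \<A> \<gamma>"
  shows "curve_length \<A> g (\<lambda>t. \<gamma> (- 1 * t + 1)) \<le> curve_length \<A> g \<gamma>"
proof -
  obtain N s where s: "finite N" "{0, 1} \<subseteq> N" "s \<in> borel_measurable borel" "\<forall>t. 0 \<le> s t"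
    "\<forall>t. t \<notin> {0..1} \<longrightarrow> s t = 0"
    "\<forall>t\<in>{0..1} - N. regular_at \<gamma> t \<and> s t = speed \<A> g \<gamma> t"
    "curve_length \<A> g \<gamma> = (\<integral>\<^sup>+ t. ennreal (s t) \<partial>lborel)"
    by (rule curve_length_borel[OF assms])
  note s = s[rule_format]
  have "AE t in lborel. t \<notin> (\<lambda>x. 1 - x) ` N"
    using s(1) by (intro AE_not_in finite_imp_null_set_lborel) simp
  then have "AE t in lborel. ennreal (speed \<A> g (\<lambda>t. \<gamma> (- 1 * t + 1)) t) * indicator {0..1} t \<le> ennreal (s (1 + (- 1) * t))"
  proof eventually_elim
    case (elim t)
    have "1 - t \<notin> N" using elim by (metis diff_diff_eq2 add_diff_cancel_left' image_eqI)
    then have "t \<in> {0..1} \<Longrightarrow> speed \<A> g (\<lambda>t. \<gamma> (- 1 * t + 1)) t = s (- 1 * t + 1)"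
      using s(6)[of "- 1 * t + 1"] speed_affine[of \<gamma> "-1" t 1 UNIV "\<lambda>t. \<gamma> (- 1 * t + 1)"] by simp
    then show ?case by (auto simp: indicator_def add.commute)
  qed
  then have "curve_length \<A> g (\<lambda>t. \<gamma> (- 1 * t + 1)) \<le> (\<integral>\<^sup>+ t. ennreal (s (1 + (- 1) * t)) \<partial>lborel)"
    unfolding curve_length_def by (rule nn_integral_mono_AE)
  also have "\<dots> = curve_length \<A> g \<gamma>"
    using nn_integral_real_affine[of "\<lambda>t. ennreal (s t)" "-1" 1] s(3) unfolding s(7) by simp
  finally show ?thesis .
qed

lemma pw_C1_curve_join:
  assumes "pw_C1_curve \<A> \<gamma>\<^sub>1" "pw_C1_curve \<A> \<gamma>\<^sub>2" "\<gamma>\<^sub>1 1 = \<gamma>\<^sub>2 0"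
  shows "pw_C1_curve \<A> (\<lambda>t. if t \<le> 1 / 2 then \<gamma>\<^sub>1 (2 * t) else \<gamma>\<^sub>2 (2 * t - 1))" (is "pw_C1_curve \<A> ?\<eta>")
  unfolding pw_C1_curve_def
proof (intro conjI ballI allI impI)
  have c1: "continuous_on {0..1/2} (\<lambda>t. \<gamma>\<^sub>1 (2 * t))"
    by (rule continuous_on_compose2[OF curve_continuous[OF assms(1)]]) (auto intro!: continuous_intros)
  have c2: "continuous_on {1/2..1} (\<lambda>t. \<gamma>\<^sub>2 (2 * t - 1))"
    by (rule continuous_on_compose2[OF curve_continuous[OF assms(2)]]) (auto intro!: continuous_intros)
  have "continuous_on ({0..1/2} \<union> {1/2..1}) ?\<eta>"
  proof (rule continuous_on_cases[OF _ _ c1 c2], simp_all only: closed_atLeastAtMost, intro allI impI)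
    fix t :: real assume "t \<in> {0..1/2} \<and> \<not> t \<le> 1 / 2 \<or> t \<in> {1/2..1} \<and> t \<le> 1 / 2"
    then have t: "2 * t = 1" by auto
    show "\<gamma>\<^sub>1 (2 * t) = \<gamma>\<^sub>2 (2 * t - 1)" unfolding t using assms(3) by simp
  qed
  moreover have "{0..1/2} \<union> {1/2..1} = {0..1::real}" by auto
  ultimately show "continuous_on {0..1} ?\<eta>" by simp
  show "?\<eta> ` {0..1} \<subseteq> points \<A>"
  proof clarify
    fix t :: real assume t: "t \<in> {0..1}"
    then have "t \<le> 1 / 2 \<Longrightarrow> 2 * t \<in> {0..1}" "\<not> t \<le> 1 / 2 \<Longrightarrow> 2 * t - 1 \<in> {0..1}" by simp_all
    then show "?\<eta> t \<in> points \<A>" using assms(1,2) unfolding pw_C1_curve_def by auto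
  qed
  fix c a b assume c: "c \<in> \<A>" and ab: "0 \<le> a \<and> a \<le> b \<and> b \<le> 1 \<and> ?\<eta> ` {a..b} \<subseteq> cdom c"
  have piece: "(\<lambda>t. cmap c (\<gamma> (2 * t + k))) piecewise_C1_differentiable_on {x..y}"
    if "pw_C1_curve \<A> \<gamma>" "x \<le> y" "0 \<le> 2 * x + k" "2 * y + k \<le> 1" "\<And>t. t \<in> {x..y} \<Longrightarrow> \<gamma> (2 * t + k) \<in> cdom c"
    for \<gamma> x y k
  proof -
    have im: "(\<lambda>t. 2 * t + k) ` {x..y} = {2 * x + k..2 * y + k}"
      using that(2) by (simp add: image_affinity_atLeastAtMost)
    have "\<gamma> ` {2 * x + k..2 * y + k} \<subseteq> cdom c"
      unfolding im[symmetric] using that(5) by auto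
    then have "(cmap c \<circ> \<gamma>) piecewise_C1_differentiable_on ((\<lambda>t. 2 * t + k) ` {x..y})"
      unfolding im using that c unfolding pw_C1_curve_def by auto
    from piecewise_C1_differentiable_affine[OF this] show ?thesis by (simp add: o_def)
  qed
  have dom: "?\<eta> t \<in> cdom c" if "t \<in> {a..b}" for t using ab that by blast
  have dom1: "\<gamma>\<^sub>1 (2 * t) \<in> cdom c" if "t \<in> {a..b}" "t \<le> 1 / 2" for t using dom[OF that(1)] that(2) by simp
  have dom2: "\<gamma>\<^sub>2 (2 * t - 1) \<in> cdom c" if "t \<in> {a..b}" "1 / 2 \<le> t" for t
  proof (cases "t \<le> 1 / 2")
    case True
    then have t: "2 * t = 1" using that(2) by simp
    show ?thesis using dom[OF that(1)] True assms(3) unfolding t by simp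
  qed (use dom[OF that(1)] in simp)
  note p1 = piece[OF assms(1), where k=0, simplified]
  note p2 = piece[OF assms(2), where k="-1", simplified]
  consider "b \<le> 1 / 2" | "1 / 2 \<le> a" | "a \<le> 1 / 2" "1 / 2 \<le> b" by linarith
  then show "(cmap c \<circ> ?\<eta>) piecewise_C1_differentiable_on {a..b}"
  proof cases
    case 1
    then have "(\<lambda>t. cmap c (\<gamma>\<^sub>1 (2 * t))) piecewise_C1_differentiable_on {a..b}"
      using dom1 ab by (intro p1) auto
    then show ?thesis by (rule piecewise_C1_differentiable_on_cong) (use 1 in auto)
  next
    case 2
    then have "(\<lambda>t. cmap c (\<gamma>\<^sub>2 (2 * t - 1))) piecewise_C1_differentiable_on {a..b}"
      using dom2 ab by (intro p2) auto
    then show ?thesis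
    proof (rule piecewise_C1_differentiable_on_cong)
      fix t assume "t \<in> {a..b}"
      then show "cmap c (\<gamma>\<^sub>2 (2 * t - 1)) = (cmap c \<circ> ?\<eta>) t"
      proof (cases "t \<le> 1 / 2")
        \<comment> \<open>An interval starting at 1/2 meets the first branch in that single point,
          where the two curves join.\<close>
        case True
        then have "2 * t = 1" using 2 \<open>t \<in> {a..b}\<close> by simp
        then show ?thesis using True assms(3) by (simp only: o_def if_True) simp
      qed simp
    qed
  next
    case 3
    have "(\<lambda>t. if t \<le> 1 / 2 then cmap c (\<gamma>\<^sub>1 (2 * t)) else cmap c (\<gamma>\<^sub>2 (2 * t - 1))) piecewise_C1_differentiable_on {a..b}"
      using dom1 dom2 3 ab assms(3) by (intro piecewise_C1_differentiable_cases p1 p2) auto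
    then show ?thesis by (rule piecewise_C1_differentiable_on_cong) auto
  qed
qed

lemma curve_length_join_le:
  assumes "pw_C1_curve \<A> \<gamma>\<^sub>1" "pw_C1_curve \<A> \<gamma>\<^sub>2"
  shows "curve_length \<A> g (\<lambda>t. if t \<le> 1 / 2 then \<gamma>\<^sub>1 (2 * t) else \<gamma>\<^sub>2 (2 * t - 1))
    \<le> curve_length \<A> g \<gamma>\<^sub>1 + curve_length \<A> g \<gamma>\<^sub>2" (is "curve_length \<A> g ?\<eta> \<le> _")
proof -
  obtain N s where s: "finite N" "{0, 1} \<subseteq> N" "s \<in> borel_measurable borel" "\<forall>t. 0 \<le> s t"
    "\<forall>t. t \<notin> {0..1} \<longrightarrow> s t = 0"
    "\<forall>t\<in>{0..1} - N. regular_at \<gamma>\<^sub>1 t \<and> s t = speed \<A> g \<gamma>\<^sub>1 t"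
    "curve_length \<A> g \<gamma>\<^sub>1 = (\<integral>\<^sup>+ t. ennreal (s t) \<partial>lborel)"
    by (rule curve_length_borel[OF assms(1)])
  note s = s[rule_format]
  obtain N' s' where s': "finite N'" "{0, 1} \<subseteq> N'" "s' \<in> borel_measurable borel" "\<forall>t. 0 \<le> s' t"
    "\<forall>t. t \<notin> {0..1} \<longrightarrow> s' t = 0"
    "\<forall>t\<in>{0..1} - N'. regular_at \<gamma>\<^sub>2 t \<and> s' t = speed \<A> g \<gamma>\<^sub>2 t"
    "curve_length \<A> g \<gamma>\<^sub>2 = (\<integral>\<^sup>+ t. ennreal (s' t) \<partial>lborel)"
    by (rule curve_length_borel[OF assms(2)])
  note s' = s'[rule_format]
  have "AE t in lborel. t \<notin> insert (1 / 2) ((\<lambda>x. x / 2) ` N \<union> (\<lambda>x. (x + 1) / 2) ` N')"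
    using s(1) s'(1) by (intro AE_not_in finite_imp_null_set_lborel) simp
  then have "AE t in lborel. ennreal (speed \<A> g ?\<eta> t) * indicator {0..1} t
      \<le> 2 * ennreal (s (0 + 2 * t)) + 2 * ennreal (s' (- 1 + 2 * t))"
  proof eventually_elim
    case (elim t)
    have n: "2 * t \<notin> N" "2 * t - 1 \<notin> N'" "t \<noteq> 1 / 2"
      using elim image_eqI[of t "\<lambda>x. x / 2" "2 * t" N] image_eqI[of t "\<lambda>x. (x + 1) / 2" "2 * t - 1" N'] by auto
    consider "t \<notin> {0..1}" | "0 \<le> t" "t < 1 / 2" | "1 / 2 < t" "t \<le> 1" using n(3) by force
    then show ?case
    proof cases
      case 2
      then have "speed \<A> g ?\<eta> t = 2 * s (2 * t)"
        using s(6)[of "2 * t"] n(1) speed_affine[of \<gamma>\<^sub>1 2 t 0 "{..<1/2}" ?\<eta>] by simp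
      then show ?thesis using s(4)[of "2 * t"] by (simp add: ennreal_mult indicator_def)
    next
      case 3
      then have "speed \<A> g ?\<eta> t = 2 * s' (2 * t - 1)"
        using s'(6)[of "2 * t - 1"] n(2) speed_affine[of \<gamma>\<^sub>2 2 t "- 1" "{1/2<..}" ?\<eta>] by simp
      then show ?thesis using s'(4)[of "2 * t - 1"] by (simp add: ennreal_mult indicator_def)
    qed simp
  qed
  then have "curve_length \<A> g ?\<eta> \<le> (\<integral>\<^sup>+ t. 2 * ennreal (s (0 + 2 * t)) + 2 * ennreal (s' (- 1 + 2 * t)) \<partial>lborel)"
    unfolding curve_length_def by (rule nn_integral_mono_AE)
  also have "\<dots> = 2 * (\<integral>\<^sup>+ t. ennreal (s (0 + 2 * t)) \<partial>lborel) + 2 * (\<integral>\<^sup>+ t. ennreal (s' (- 1 + 2 * t)) \<partial>lborel)"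
    using s(3) s'(3) by (subst nn_integral_add) (auto simp: nn_integral_cmult)
  \<comment> \<open>The factor 2 of the doubled speed is the Jacobian of the substitution on each
    half.\<close>
  also have "\<dots> = curve_length \<A> g \<gamma>\<^sub>1 + curve_length \<A> g \<gamma>\<^sub>2"
    using nn_integral_real_affine[of "\<lambda>t. ennreal (s t)" 2 0] nn_integral_real_affine[of "\<lambda>t. ennreal (s' t)" 2 "- 1"]
      s(3) s'(3) unfolding s(7) s'(7) by simp
  finally show ?thesis .
qed

subsection \<open>The Riemannian distance\<close>

abbreviation "dst \<equiv> riemannian_dist \<A> g"

lemma dist_le_curve_length:
  "pw_C1_curve \<A> \<gamma> \<Longrightarrow> \<gamma> 0 = p \<Longrightarrow> \<gamma> 1 = q \<Longrightarrow> dst p q \<le> curve_length \<A> g \<gamma>"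
  unfolding riemannian_dist_def by (rule INF_lower) simp

lemma dist_less_curve:
  assumes "dst p q < e"
  obtains \<gamma> where "pw_C1_curve \<A> \<gamma>" "\<gamma> 0 = p" "\<gamma> 1 = q" "curve_length \<A> g \<gamma> < e"
  using assms unfolding riemannian_dist_def INF_less_iff by auto

lemma dist_sym_le: "dst q p \<le> dst p q"
proof (rule dense_ge)
  fix e assume "dst p q < e"
  then obtain \<gamma> where \<gamma>: "pw_C1_curve \<A> \<gamma>" "\<gamma> 0 = p" "\<gamma> 1 = q" "curve_length \<A> g \<gamma> < e"
    by (rule dist_less_curve)
  have "dst q p \<le> curve_length \<A> g (\<lambda>t. \<gamma> (- 1 * t + 1))"
    by (rule dist_le_curve_length[OF pw_C1_curve_reversepath[OF \<gamma>(1)]]) (simp_all add: \<gamma>)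
  also note curve_length_reversepath_le[OF \<gamma>(1)]
  also note less_imp_le[OF \<gamma>(4)]
  finally show "dst q p \<le> e" .
qed

lemma dist_sym: "dst p q = dst q p"
  by (intro antisym dist_sym_le)

lemma dist_triangle: "dst p r \<le> dst p q + dst q r"
\<comment> \<open>With an infinite summand nothing is to be shown, and the strict inequalities below
  would fail.\<close>
proof (cases "dst p q = top \<or> dst q r = top")
  case False
  show ?thesis
  proof (rule ennreal_le_epsilon)
    fix e :: real assume e: "0 < e"
    have less: "x < x + ennreal (e / 2)" if "x \<noteq> top" for x
      using that e by (cases x) (simp_all add: ennreal_less_iff flip: ennreal_plus)
    have "dst p q < dst p q + ennreal (e / 2)" "dst q r < dst q r + ennreal (e / 2)"
      using False less by auto
    obtain \<gamma> where \<gamma>: "pw_C1_curve \<A> \<gamma>" "\<gamma> 0 = p" "\<gamma> 1 = q" "curve_length \<A> g \<gamma> < dst p q + ennreal (e / 2)"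
      using \<open>dst p q < _\<close> by (rule dist_less_curve)
    obtain \<gamma>' where \<gamma>': "pw_C1_curve \<A> \<gamma>'" "\<gamma>' 0 = q" "\<gamma>' 1 = r" "curve_length \<A> g \<gamma>' < dst q r + ennreal (e / 2)"
      using \<open>dst q r < _\<close> by (rule dist_less_curve)
    have "dst p r \<le> curve_length \<A> g (\<lambda>t. if t \<le> 1 / 2 then \<gamma> (2 * t) else \<gamma>' (2 * t - 1))"
      by (rule dist_le_curve_length[OF pw_C1_curve_join[OF \<gamma>(1) \<gamma>'(1)]]) (simp_all add: \<gamma> \<gamma>')
    also note curve_length_join_le[OF \<gamma>(1) \<gamma>'(1)]
    also have "curve_length \<A> g \<gamma> + curve_length \<A> g \<gamma>' \<le> (dst p q + ennreal (e / 2)) + (dst q r + ennreal (e / 2))"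
      using \<gamma>(4) \<gamma>'(4) by (intro add_mono less_imp_le)
    also have "\<dots> = dst p q + dst q r + (ennreal (e / 2) + ennreal (e / 2))"
      by (simp add: ac_simps)
    also have "ennreal (e / 2) + ennreal (e / 2) = ennreal e"
      using e by (simp flip: ennreal_plus)
    finally show "dst p r \<le> dst p q + dst q r + ennreal e" .
  qed
qed auto

text \<open>Explicit upper bounds for the distance come from coordinate segments; K bounds the
  metric length of the constant velocity v along the segment. The case v = 0 gives distance 0 from a
  point to itself.\<close>

lemma dist_segment_le:
  assumes "c \<in> \<A>" "\<And>t. 0 \<le> t \<Longrightarrow> t \<le> 1 \<Longrightarrow> x + t *\<^sub>R v \<in> cimg c"
    "\<And>t. 0 \<le> t \<Longrightarrow> t \<le> 1 \<Longrightarrow> g c (x + t *\<^sub>R v) v v \<le> K\<^sup>2" "0 \<le> K"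
  shows "dst (cinv c x) (cinv c (x + v)) \<le> ennreal K"
proof -
  define \<gamma> where "\<gamma> t = cinv c (x + t *\<^sub>R v)" for t
  have line: "((\<lambda>t. x + t *\<^sub>R v) has_vector_derivative v) (at t)" for t
    by (auto intro!: derivative_eq_intros)
  have curve: "pw_C1_curve \<A> \<gamma>"
    unfolding pw_C1_curve_def
  proof (intro conjI ballI allI impI)
    show "continuous_on {0..1} \<gamma>"
      unfolding \<gamma>_def using assms(2)
      by (intro continuous_on_compose2[OF chartD(4)[OF assms(1)]] continuous_intros) auto
    show "\<gamma> ` {0..1} \<subseteq> points \<A>"
      using assms(2) cinv_in_points[OF assms(1)] by (auto simp: \<gamma>_def)
    fix d a b assume d: "d \<in> \<A>" and ab: "0 \<le> a \<and> a \<le> b \<and> b \<le> 1 \<and> \<gamma> ` {a..b} \<subseteq> cdom d"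
    interpret T: local_isometry "cmap c ` (cdom c \<inter> cdom d)" "cimg d" "g c" "g d" "transition c d"
      by (rule local_isometry_transition[OF assms(1) d])
    have ov: "x + t *\<^sub>R v \<in> cmap c ` (cdom c \<inter> cdom d)" if "t \<in> {a..b}" for t
      unfolding chart_image_Int[OF chart[OF assms(1)]] using that ab assms(2)[of t] by (auto simp: \<gamma>_def)
    have eq: "cmap d \<circ> \<gamma> = (\<lambda>t. transition c d (x + t *\<^sub>R v))"
      by (auto simp: \<gamma>_def transition_def)
    have "(cmap d \<circ> \<gamma>) C1_differentiable_on {a..b}"
      unfolding C1_differentiable_on_def eq
    proof (intro exI conjI ballI)
      fix t assume "t \<in> {a..b}"
      from has_derivative_compose[OF line[of t, unfolded has_vector_derivative_def]
          smooth_on_has_derivative[OF T.smooth_T ov[OF this]]]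
      show "((\<lambda>t. transition c d (x + t *\<^sub>R v)) has_vector_derivative T.D (x + t *\<^sub>R v) v) (at t)"
        by (simp add: has_vector_derivative_def linear_scale[OF T.linear_D[OF ov[OF \<open>t \<in> {a..b}\<close>]]])
    next
      show "continuous_on {a..b} (\<lambda>t. T.D (x + t *\<^sub>R v) v)"
        by (intro continuous_on_compose2[OF smooth_on_imp_continuous_on[OF smooth_on_frechet_derivative[OF T.smooth_T]]]
            continuous_intros) (use ov in auto)
    qed
    then show "(cmap d \<circ> \<gamma>) piecewise_C1_differentiable_on {a..b}"
      by (rule C1_differentiable_imp_piecewise)
  qed
  have sp: "speed \<A> g \<gamma> t \<le> K" if t: "t \<in> {0<..<1}" for t
  proof -
    have "x + t *\<^sub>R v \<in> cimg c" using assms(2)[of t] t by simp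
    note C = chartD(5,6)[OF assms(1) this]
    have "continuous_on {0<..<1} \<gamma>"
      using curve by (auto simp: pw_C1_curve_def intro: continuous_on_subset)
    then have "isCont \<gamma> t" using t by (simp add: continuous_on_eq_continuous_at)
    moreover have "((cmap c \<circ> \<gamma>) has_vector_derivative v) (at t)"
      by (rule has_vector_derivative_transform_within_open[OF line, of "{0<..<1}"])
        (use t assms(2) chartD(6)[OF assms(1)] in \<open>auto simp: \<gamma>_def\<close>)
    ultimately have "speed \<A> g \<gamma> t = sqrt (g c (cmap c (\<gamma> t)) v v)"
      using C by (intro speed_eq assms(1)) (simp_all add: \<gamma>_def)
    then show ?thesis
      using C assms(3)[of t] assms(4) t by (simp add: \<gamma>_def real_le_lsqrt)
  qed
  have "AE t in lborel. t \<notin> {0, 1::real}"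
    by (intro AE_not_in finite_imp_null_set_lborel) simp
  then have "AE t in lborel. ennreal (speed \<A> g \<gamma> t) * indicator {0..1} t \<le> ennreal K * indicator {0..1} t"
    by eventually_elim (use sp in \<open>auto simp: indicator_def less_le intro!: ennreal_leI\<close>)
  then have "curve_length \<A> g \<gamma> \<le> (\<integral>\<^sup>+ t. ennreal K * indicator {0..1::real} t \<partial>lborel)"
    unfolding curve_length_def by (rule nn_integral_mono_AE)
  also have "\<dots> = ennreal K" by (simp add: nn_integral_cmult)
  finally have "curve_length \<A> g \<gamma> \<le> ennreal K" .
  moreover have "dst (cinv c x) (cinv c (x + v)) \<le> curve_length \<A> g \<gamma>"
    by (rule dist_le_curve_length[OF curve]) (simp_all add: \<gamma>_def)
  ultimately show ?thesis by (rule order_trans[rotated])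
qed

end

subsection \<open>Functions with gradient at most one\<close>

text \<open>The derivative may be unbounded near the exceptional points, so its integrability is not
  automatic. If the right-hand side is infinite the claim is trivial; otherwise the derivative is
  Lebesgue integrable, and the gauge integral in the fundamental theorem is its Lebesgue
  integral.\<close>

lemma ftc_le_nn_integral:
  fixes \<phi> :: "real \<Rightarrow> real"
  assumes "finite N" "a \<le> b" "\<And>t. t \<in> {a<..<b} - N \<Longrightarrow> (\<phi> has_vector_derivative \<phi>' t) (at t)"
    "continuous_on {a..b} \<phi>" "continuous_on ({a<..<b} - N) \<phi>'"
  shows "ennreal \<bar>\<phi> b - \<phi> a\<bar> \<le> (\<integral>\<^sup>+ t. ennreal \<bar>\<phi>' t\<bar> * indicator ({a<..<b} - N) t \<partial>lborel)"
proof -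
  define w where "w t = indicator ({a<..<b} - N) t *\<^sub>R \<phi>' t" for t
  have "open ({a<..<b} - N)" using assms(1) by (simp add: open_Diff finite_imp_closed)
  then have w: "w \<in> borel_measurable borel"
    unfolding w_def using assms(5) by (intro borel_measurable_continuous_on_indicator) auto
  have eq: "(\<integral>\<^sup>+ t. ennreal \<bar>\<phi>' t\<bar> * indicator ({a<..<b} - N) t \<partial>lborel) = (\<integral>\<^sup>+ t. norm (w t) \<partial>lborel)"
    by (intro nn_integral_cong) (auto simp: w_def indicator_def)
  show ?thesis
  proof (cases "(\<integral>\<^sup>+ t. norm (w t) \<partial>lborel) = \<infinity>")
    case False
    then have int: "integrable lborel w"
      using w by (intro integrableI_bounded) (auto simp: less_top)
    have "(\<phi>' has_integral (\<phi> b - \<phi> a)) {a..b}"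
      by (rule fundamental_theorem_of_calculus_interior_strong[OF assms(1-3,4)])
    then have "(w has_integral (\<phi> b - \<phi> a)) {a..b}"
      by (rule has_integral_spike_finite[of "N \<union> {a, b}", rotated 2]) (use assms(1) in \<open>auto simp: w_def indicator_def\<close>)
    then have "(w has_integral (\<phi> b - \<phi> a)) UNIV"
      by (rule has_integral_on_superset) (auto simp: w_def)
    then have "\<phi> b - \<phi> a = integral\<^sup>L lborel w"
      using has_integral_integral_lborel[OF int] has_integral_unique by blast
    then show ?thesis
      unfolding eq using integral_norm_bound_ennreal[OF int] by simp
  qed (simp add: eq)
qed

context riemannian
begin

lemma short_smooth: "short u \<Longrightarrow> c \<in> \<A> \<Longrightarrow> smooth_on (cimg c) (u \<circ> cinv c)"
  by (simp add: short_def smooth_fun_def)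

lemma short_bound:
  assumes "short u" "c \<in> \<A>" "x \<in> cimg c"
  shows "(frechet_derivative (u \<circ> cinv c) (at x) v)\<^sup>2 \<le> g c x v v"
  using assms by (simp add: short_def)

text \<open>Along a curve in one chart the derivative of u is at most the speed; integrating and
  concatenating over charts bounds the increment of u by the length.\<close>

lemma short_le_dist:
  assumes u: "short u"
  shows "ennreal \<bar>u q - u p\<bar> \<le> dst p q"
proof (rule dense_ge)
  fix e assume "dst p q < e"
  then obtain \<gamma> where \<gamma>: "pw_C1_curve \<A> \<gamma>" "\<gamma> 0 = p" "\<gamma> 1 = q" "curve_length \<A> g \<gamma> < e"
    by (rule dist_less_curve)
  obtain N s where s: "finite N" "{0, 1} \<subseteq> N" "s \<in> borel_measurable borel" "\<forall>t. 0 \<le> s t"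
    "\<forall>t. t \<notin> {0..1} \<longrightarrow> s t = 0"
    "\<forall>t\<in>{0..1} - N. regular_at \<gamma> t \<and> s t = speed \<A> g \<gamma> t"
    "curve_length \<A> g \<gamma> = (\<integral>\<^sup>+ t. ennreal (s t) \<partial>lborel)"
    by (rule curve_length_borel[OF \<gamma>(1)])
  note s = s[rule_format]
  have [measurable]: "s \<in> borel_measurable borel" by (rule s(3))
  have "ennreal \<bar>u (\<gamma> 1) - u (\<gamma> 0)\<bar> \<le> (\<integral>\<^sup>+ t. ennreal (s t) * indicator {0..1} t \<partial>lborel)"
  proof (rule curve_induct[OF \<gamma>(1), where P="\<lambda>a b. ennreal \<bar>u (\<gamma> b) - u (\<gamma> a)\<bar> \<le> (\<integral>\<^sup>+ t. ennreal (s t) * indicator {a..b} t \<partial>lborel)"])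
    fix a b c :: real
    assume abc: "a \<le> b" "b \<le> c" and *: "ennreal \<bar>u (\<gamma> b) - u (\<gamma> a)\<bar> \<le> (\<integral>\<^sup>+ t. ennreal (s t) * indicator {a..b} t \<partial>lborel)"
      "ennreal \<bar>u (\<gamma> c) - u (\<gamma> b)\<bar> \<le> (\<integral>\<^sup>+ t. ennreal (s t) * indicator {b..c} t \<partial>lborel)"
    have "ennreal \<bar>u (\<gamma> c) - u (\<gamma> a)\<bar> \<le> ennreal \<bar>u (\<gamma> b) - u (\<gamma> a)\<bar> + ennreal \<bar>u (\<gamma> c) - u (\<gamma> b)\<bar>"
      by (simp flip: ennreal_plus)
    also have "\<dots> \<le> (\<integral>\<^sup>+ t. ennreal (s t) * indicator {a..b} t \<partial>lborel) + (\<integral>\<^sup>+ t. ennreal (s t) * indicator {b..c} t \<partial>lborel)"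
      using * by (rule add_mono)
    also have "\<dots> = (\<integral>\<^sup>+ t. ennreal (s t) * indicator {a..b} t + ennreal (s t) * indicator {b..c} t \<partial>lborel)"
      by (subst nn_integral_add) auto
    also have "\<dots> \<le> (\<integral>\<^sup>+ t. ennreal (s t) * indicator {a..c} t \<partial>lborel)"
    proof (rule nn_integral_mono_AE)
      \<comment> \<open>The common endpoint b is counted twice, so the inequality is claimed only
        almost everywhere.\<close>
      have "AE t in lborel. t \<notin> {b}" by (intro AE_not_in finite_imp_null_set_lborel) simp
      then show "AE t in lborel. ennreal (s t) * indicator {a..b} t + ennreal (s t) * indicator {b..c} t
          \<le> ennreal (s t) * indicator {a..c} t"
        by eventually_elim (use abc in \<open>auto simp: indicator_def\<close>)
    qed
    finally show "ennreal \<bar>u (\<gamma> c) - u (\<gamma> a)\<bar> \<le> (\<integral>\<^sup>+ t. ennreal (s t) * indicator {a..c} t \<partial>lborel)" .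
  next
    fix c and a b :: real
    assume *: "c \<in> \<A>" "0 \<le> a" "a \<le> b" "b \<le> 1" "\<gamma> ` {a..b} \<subseteq> cdom c"
    obtain N' D where ND: "finite N'" "continuous_on {a..b} (cmap c \<circ> \<gamma>)" "continuous_on ({a..b} - N') D"
      "\<forall>t\<in>{a..b} - N'. ((cmap c \<circ> \<gamma>) has_vector_derivative D t) (at t)"
      "\<forall>t\<in>{a<..<b}. isCont \<gamma> t"
      "\<forall>t\<in>{a<..<b} - N'. speed \<A> g \<gamma> t = sqrt (g c ((cmap c \<circ> \<gamma>) t) (D t) (D t))"
      by (rule curve_local_derivative[OF \<gamma>(1) *])
    note ND = ND[rule_format]
    let ?y = "cmap c \<circ> \<gamma>" and ?f = "u \<circ> cinv c"
    have im: "?y t \<in> cimg c" "?f (?y t) = u (\<gamma> t)" if "t \<in> {a..b}" for t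
      using *(5) that chartD(7,8)[OF *(1)] by (auto simp: image_subset_iff)
    note sm = short_smooth[OF u *(1)]
    define \<phi>' where "\<phi>' t = frechet_derivative ?f (at (?y t)) (D t)" for t
    interpret L: bilinear_family "cimg c" "\<lambda>x a (b::real). b *\<^sub>R frechet_derivative ?f (at x) a"
      using smooth_on_linear_frechet[OF sm] smooth_on_frechet_derivative[OF sm] chartD(2)[OF *(1)]
      by unfold_locales (auto simp: bilinear_def linear_iff algebra_simps intro!: smooth_on_mult smooth_on_const)
    have "ennreal \<bar>?f (?y b) - ?f (?y a)\<bar>
        \<le> (\<integral>\<^sup>+ t. ennreal \<bar>\<phi>' t\<bar> * indicator ({a<..<b} - N') t \<partial>lborel)"
    proof (rule ftc_le_nn_integral[OF ND(1) *(3)])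
      fix t assume t: "t \<in> {a<..<b} - N'"
      have "((\<lambda>t. ?f (?y t)) has_derivative (\<lambda>h. frechet_derivative ?f (at (?y t)) (h *\<^sub>R D t))) (at t)"
        using t by (intro has_derivative_compose[OF ND(4)[unfolded has_vector_derivative_def]
              smooth_on_has_derivative[OF sm im(1)]]) auto
      then show "((\<lambda>t. ?f (?y t)) has_vector_derivative \<phi>' t) (at t)"
        using linear_scale[OF smooth_on_linear_frechet[OF sm im(1)[of t]]] t
        by (simp add: has_vector_derivative_def \<phi>'_def)
    next
      show "continuous_on {a..b} (\<lambda>t. ?f (?y t))"
        by (rule continuous_on_compose2[OF smooth_on_imp_continuous_on[OF sm] ND(2)]) (use im in auto)
      have "continuous_on ({a<..<b} - N') (\<lambda>t. 1 *\<^sub>R frechet_derivative ?f (at (?y t)) (D t))"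
        by (intro L.continuous_on_apply continuous_on_subset[OF ND(2)] continuous_on_subset[OF ND(3)] continuous_on_const)
          (use im in auto)
      then show "continuous_on ({a<..<b} - N') \<phi>'" unfolding \<phi>'_def by simp
    qed
    also have "\<dots> \<le> (\<integral>\<^sup>+ t. ennreal (s t) * indicator {a..b} t \<partial>lborel)"
    proof (rule nn_integral_mono_AE)
      have "AE t in lborel. t \<notin> N" by (intro AE_not_in finite_imp_null_set_lborel s(1))
      then show "AE t in lborel. ennreal \<bar>\<phi>' t\<bar> * indicator ({a<..<b} - N') t \<le> ennreal (s t) * indicator {a..b} t"
      proof eventually_elim
        case (elim t)
        have "\<bar>\<phi>' t\<bar> \<le> s t" if t: "t \<in> {a<..<b} - N'"
        proof -
          have "\<bar>\<phi>' t\<bar> \<le> sqrt (g c (?y t) (D t) (D t))"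
            unfolding \<phi>'_def using short_bound[OF u *(1) im(1)[of t], of "D t"] t by (simp add: real_le_rsqrt)
          then show ?thesis using ND(6)[OF t] s(6)[of t] t elim *(2,4) by auto
        qed
        then show ?case by (auto simp: indicator_def intro!: ennreal_leI)
      qed
    qed
    finally show "ennreal \<bar>u (\<gamma> b) - u (\<gamma> a)\<bar> \<le> (\<integral>\<^sup>+ t. ennreal (s t) * indicator {a..b} t \<partial>lborel)"
      using im(2)[of a] im(2)[of b] *(3) by simp
  qed
  also have "\<dots> \<le> curve_length \<A> g \<gamma>"
    unfolding s(7) by (intro nn_integral_mono) (auto simp: indicator_def)
  also have "\<dots> \<le> e" using \<gamma>(4) by simp
  finally show "ennreal \<bar>u q - u p\<bar> \<le> e" by (simp add: \<gamma>)
qed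

text \<open>Functions glued from local formulas are known in one convenient chart per point only;
  the bound spreads to all charts because transitions are isometries.\<close>

lemma shortI:
  assumes "\<And>p. p \<in> points \<A> \<Longrightarrow> \<exists>c\<in>\<A>. \<exists>V f. open V \<and> V \<subseteq> cimg c \<and> p \<in> cdom c \<and> cmap c p \<in> V \<and>
    smooth_on V f \<and> (\<forall>x\<in>V. \<forall>v. (frechet_derivative f (at x) v)\<^sup>2 \<le> g c x v v) \<and> (\<forall>x\<in>V. u (cinv c x) = f x)"
  shows "short u"
proof -
  have local: "\<exists>W. open W \<and> x \<in> W \<and> smooth_on W (u \<circ> cinv d) \<and>
      (\<forall>v. (frechet_derivative (u \<circ> cinv d) (at x) v)\<^sup>2 \<le> g d x v v)" if d: "d \<in> \<A>" and x: "x \<in> cimg d" for d x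
  proof -
    obtain c V f where c: "c \<in> \<A>" "open V" "V \<subseteq> cimg c" "cinv d x \<in> cdom c" "cmap c (cinv d x) \<in> V"
      "smooth_on V f" "\<forall>x\<in>V. \<forall>v. (frechet_derivative f (at x) v)\<^sup>2 \<le> g c x v v" "\<forall>x\<in>V. u (cinv c x) = f x"
      using assms[OF cinv_in_points[OF d x]] by blast
    interpret T: local_isometry "cmap d ` (cdom d \<inter> cdom c)" "cimg c" "g d" "g c" "transition d c"
      by (rule local_isometry_transition[OF d c(1)])
    define W where "W = cmap d ` (cdom d \<inter> cdom c) \<inter> transition d c -` V"
    have W: "open W"
      unfolding W_def
      by (rule continuous_open_preimage[OF smooth_on_imp_continuous_on[OF T.smooth_T] T.dom.open_dom c(2)])
    have xW: "x \<in> W" "transition d c x \<in> V" "x \<in> cmap d ` (cdom d \<inter> cdom c)"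
      using c(4,5) x by (auto simp: W_def chart_image_Int[OF chart[OF d]] transition_def)
    have smT: "smooth_on W (transition d c)"
      by (rule smooth_on_subset[OF T.smooth_T]) (simp add: W_def)
    have sm: "smooth_on W (\<lambda>y. f (transition d c y))"
      by (rule smooth_on_compose[OF W c(2) _ c(6) smT]) (auto simp: W_def)
    have eq: "f (transition d c y) = (u \<circ> cinv d) y" if "y \<in> W" for y
      using that c(8) transition_in(2)[OF chart[OF d] chart[OF c(1)], of y] by (auto simp: W_def)
    have "smooth_on W (u \<circ> cinv d)"
      by (subst smooth_on_cong[OF W eq[symmetric]]) (simp_all add: sm)
    moreover have "frechet_derivative (u \<circ> cinv d) (at x) v = frechet_derivative f (at (transition d c x)) (T.D x v)" for v
    proof -
      have "((\<lambda>y. f (transition d c y)) has_derivative (\<lambda>v. frechet_derivative f (at (transition d c x)) (T.D x v))) (at x)"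
        by (rule has_derivative_compose[OF smooth_on_has_derivative[OF T.smooth_T xW(3)] smooth_on_has_derivative[OF c(6) xW(2)]])
      from frechet_derivative_eqI[OF has_derivative_transform_within_open[OF this W xW(1) eq]]
      show ?thesis by (simp add: o_def)
    qed
    ultimately show ?thesis
      using W xW c(7) T.isometry[OF xW(3)] by auto
  qed
  show ?thesis
    unfolding short_def smooth_fun_def
  proof (intro conjI ballI allI)
    fix c assume "c \<in> \<A>"
    then show "smooth_on (cimg c) (u \<circ> cinv c)" using local by (intro smooth_on_local) blast
  qed (use local in blast)
qed

definition short_test :: "('m \<Rightarrow> real) set" where
  "short_test = {u. test_function \<A> u \<and> short u}"

text \<open>Makes the family in the supremum \<open>reach\<close> nonempty and its value
  nonnegative.\<close>

lemma short_test_zero: "(\<lambda>_. 0) \<in> short_test"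
proof -
  have "short (\<lambda>_. 0)"
    unfolding short_def smooth_fun_def
    using local_riemannian.nonneg[OF local_riemannian_chart] by (auto simp: o_def intro: smooth_on_const)
  then show ?thesis by (auto simp: short_test_def test_function_def short_def intro!: exI[of _ "{}"])
qed

lemma short_test_support:
  assumes "u \<in> short_test"
  obtains K where "compact K" "K \<subseteq> points \<A>" "\<And>p. p \<in> points \<A> - K \<Longrightarrow> u p = 0"
  using assms by (auto simp: short_test_def test_function_def)

lemma short_testI:
  assumes "short u" "compact K" "K \<subseteq> points \<A>" "\<And>p. p \<in> points \<A> - K \<Longrightarrow> u p = 0"
  shows "u \<in> short_test"
  using assms unfolding short_test_def test_function_def short_def by blast

lemma short_test_compose:
  assumes u: "u \<in> short_test"
    and \<theta>: "smooth_on UNIV \<theta>" "\<And>x. (\<theta> has_real_derivative \<theta>' x) (at x)" "\<And>x. 0 \<le> \<theta>' x" "\<And>x. \<theta>' x \<le> 1" "\<theta> 0 = 0"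
  shows "(\<lambda>p. \<theta> (u p)) \<in> short_test"
proof -
  have su: "short u" using u by (simp add: short_test_def)
  obtain K where K: "compact K" "K \<subseteq> points \<A>" "\<And>p. p \<in> points \<A> - K \<Longrightarrow> u p = 0"
    using short_test_support[OF u] by metis
  show ?thesis
  proof (rule short_testI[OF _ K(1,2)])
    show "\<theta> (u p) = 0" if "p \<in> points \<A> - K" for p using K(3)[OF that] \<theta>(5) by simp
    show "short (\<lambda>p. \<theta> (u p))"
      unfolding short_def smooth_fun_def
    proof (intro conjI ballI allI)
      fix c assume c: "c \<in> \<A>"
      note sm = short_smooth[OF su c]
      have "smooth_on (cimg c) (\<lambda>x. \<theta> ((u \<circ> cinv c) x))"
        by (rule smooth_on_compose[OF chartD(2)[OF c] open_UNIV _ \<theta>(1) sm]) simp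
      then show "smooth_on (cimg c) ((\<lambda>p. \<theta> (u p)) \<circ> cinv c)" by (simp add: o_def)
      fix x v assume x: "x \<in> cimg c"
      let ?d = "frechet_derivative (u \<circ> cinv c) (at x) v" and ?t = "\<theta>' ((u \<circ> cinv c) x)"
      have "((\<lambda>x. \<theta> ((u \<circ> cinv c) x)) has_derivative (\<lambda>v. ?t * frechet_derivative (u \<circ> cinv c) (at x) v)) (at x)"
        by (rule has_derivative_compose[OF smooth_on_has_derivative[OF sm x] \<theta>(2)[unfolded has_field_derivative_def]])
      then have "frechet_derivative ((\<lambda>p. \<theta> (u p)) \<circ> cinv c) (at x) v = ?t * ?d"
        by (simp add: o_def frechet_derivative_eqI)
      then have "(frechet_derivative ((\<lambda>p. \<theta> (u p)) \<circ> cinv c) (at x) v)\<^sup>2 = ?t\<^sup>2 * ?d\<^sup>2"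
        by (simp add: power_mult_distrib)
      also have "\<dots> \<le> 1 * g c x v v"
        using \<theta>(3,4)[of "(u \<circ> cinv c) x"] short_bound[OF su c x, of v]
        by (intro mult_mono power_le_one) auto
      finally show "(frechet_derivative ((\<lambda>p. \<theta> (u p)) \<circ> cinv c) (at x) v)\<^sup>2 \<le> g c x v v" by simp
    qed
  qed
qed

text \<open>The smooth maximum \<open>\<tau> ln ((e\<^sup>u\<^sup>/\<^sup>\<tau> + e\<^sup>w\<^sup>/\<^sup>\<tau>) / 2)\<close>: its differential is a convex combination of \<open>du\<close> and \<open>dw\<close>.\<close>

lemma short_test_max:
  assumes u: "u \<in> short_test" and w: "w \<in> short_test" and "\<tau> > 0"
  obtains m where "m \<in> short_test" "\<And>p. u p - \<tau> \<le> m p" "\<And>p. w p - \<tau> \<le> m p"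
proof -
  have su: "short u" and sw: "short w" using u w by (auto simp: short_test_def)
  obtain K where K: "compact K" "K \<subseteq> points \<A>" "\<And>p. p \<in> points \<A> - K \<Longrightarrow> u p = 0"
    using short_test_support[OF u] by metis
  obtain K' where K': "compact K'" "K' \<subseteq> points \<A>" "\<And>p. p \<in> points \<A> - K' \<Longrightarrow> w p = 0"
    using short_test_support[OF w] by metis
  \<comment> \<open>Dividing by 2 makes M vanish at (0, 0), which keeps the support compact; the
    price is \<tau> ln 2 < \<tau> in the lower bound.\<close>
  define M where "M a b = \<tau> * ln ((exp (a / \<tau>) + exp (b / \<tau>)) / 2)" for a b
  have pos: "0 < exp (a / \<tau>) + exp (b / \<tau>)" for a b by (simp add: add_pos_pos)
  have ge: "a - \<tau> \<le> M a b" "b - \<tau> \<le> M a b" for a b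
  proof -
    have "ln (exp (a / \<tau>) / 2) \<le> ln ((exp (a / \<tau>) + exp (b / \<tau>)) / 2)" "ln (exp (b / \<tau>) / 2) \<le> ln ((exp (a / \<tau>) + exp (b / \<tau>)) / 2)"
      using pos by (subst ln_le_cancel_iff; simp)+
    then have "a / \<tau> - 1 \<le> ln ((exp (a / \<tau>) + exp (b / \<tau>)) / 2)" "b / \<tau> - 1 \<le> ln ((exp (a / \<tau>) + exp (b / \<tau>)) / 2)"
      using ln_2_less_1 by (simp_all add: ln_div)
    from mult_left_mono[OF this(1), of \<tau>] mult_left_mono[OF this(2), of \<tau>]
    show "a - \<tau> \<le> M a b" "b - \<tau> \<le> M a b" using assms(3) by (simp_all add: M_def right_diff_distrib)
  qed
  have "(\<lambda>p. M (u p) (w p)) \<in> short_test"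
  proof (rule short_testI[of _ "K \<union> K'"])
    show "M (u p) (w p) = 0" if "p \<in> points \<A> - (K \<union> K')" for p
      using K(3) K'(3) that by (simp add: M_def)
    show "short (\<lambda>p. M (u p) (w p))"
      unfolding short_def smooth_fun_def
    proof (intro conjI ballI allI)
      fix c assume c: "c \<in> \<A>"
      let ?f = "u \<circ> cinv c" and ?h = "w \<circ> cinv c"
      note smu = short_smooth[OF su c] and smw = short_smooth[OF sw c] and o = chartD(2)[OF c]
      have "smooth_on (cimg c) (\<lambda>x. \<tau> * ln ((exp (?f x / \<tau>) + exp (?h x / \<tau>)) / 2))"
        by (intro smooth_on_mult smooth_on_const o smooth_on_compose[OF o open_greaterThan _ smooth_on_ln]
            smooth_on_divide smooth_on_add smooth_on_compose[OF o open_UNIV _ smooth_on_exp] smu smw)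
          (use assms(3) pos in auto)
      then show "smooth_on (cimg c) ((\<lambda>p. M (u p) (w p)) \<circ> cinv c)" by (simp add: o_def M_def)
      fix x v assume x: "x \<in> cimg c"
      define A B where "A = exp (?f x / \<tau>)" and "B = exp (?h x / \<tau>)"
      have AB: "A > 0" "B > 0" by (simp_all add: A_def B_def)
      let ?d = "frechet_derivative ?f (at x)" and ?e = "frechet_derivative ?h (at x)"
      have d: "(?f has_derivative ?d) (at x)" "(?h has_derivative ?e) (at x)"
        by (rule smooth_on_has_derivative[OF smu x], rule smooth_on_has_derivative[OF smw x])
      have "((\<lambda>x. \<tau> * ln ((exp (?f x / \<tau>) + exp (?h x / \<tau>)) / 2)) has_derivative
          (\<lambda>v. (A * ?d v + B * ?e v) / (A + B))) (at x)"
      proof -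
        have 1: "((\<lambda>x. (exp (?f x / \<tau>) + exp (?h x / \<tau>)) / 2) has_derivative
            (\<lambda>v. (A * ?d v + B * ?e v) / \<tau> / 2)) (at x)"
          using assms(3) by (auto intro!: derivative_eq_intros d simp del: o_apply simp: A_def B_def add_divide_distrib)
        have "(ln has_real_derivative 1 / ((A + B) / 2)) (at ((exp (?f x / \<tau>) + exp (?h x / \<tau>)) / 2))"
          unfolding A_def B_def by (rule DERIV_ln_divide) (use pos in simp)
        note has_derivative_mult_right[OF has_derivative_compose[OF 1 this[unfolded has_field_derivative_def]], of \<tau>]
        moreover have "\<tau> * (1 / (C / 2) * (X / \<tau> / 2)) = X / C" for C X
          using assms(3) by simp
        ultimately show ?thesis by (simp only:)
      qed
      then have eq: "frechet_derivative ((\<lambda>p. M (u p) (w p)) \<circ> cinv c) (at x) v = (A * ?d v + B * ?e v) / (A + B)"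
        by (simp add: o_def M_def frechet_derivative_eqI)
      have "\<bar>?d v\<bar> \<le> sqrt (g c x v v)" "\<bar>?e v\<bar> \<le> sqrt (g c x v v)"
        using short_bound[OF su c x, of v] short_bound[OF sw c x, of v] by (simp_all add: real_le_rsqrt)
      then have "A * \<bar>?d v\<bar> \<le> A * sqrt (g c x v v)" "B * \<bar>?e v\<bar> \<le> B * sqrt (g c x v v)"
        using AB by simp_all
      moreover have "\<bar>A * ?d v + B * ?e v\<bar> \<le> A * \<bar>?d v\<bar> + B * \<bar>?e v\<bar>"
        using AB abs_triangle_ineq[of "A * ?d v" "B * ?e v"] by (simp add: abs_mult)
      ultimately have "\<bar>A * ?d v + B * ?e v\<bar> \<le> sqrt (g c x v v) * (A + B)"
        by (simp add: algebra_simps)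
      then have "\<bar>(A * ?d v + B * ?e v) / (A + B)\<bar> \<le> sqrt (g c x v v)"
        using AB by (simp add: abs_divide divide_le_eq)
      then have "((A * ?d v + B * ?e v) / (A + B))\<^sup>2 \<le> (sqrt (g c x v v))\<^sup>2"
        by (metis abs_ge_zero power2_abs power_mono)
      then show "(frechet_derivative ((\<lambda>p. M (u p) (w p)) \<circ> cinv c) (at x) v)\<^sup>2 \<le> g c x v v"
        unfolding eq using local_riemannian.nonneg[OF local_riemannian_chart[OF c] x] by simp
    qed
  qed (use K K' in auto)
  then show ?thesis using that ge by blast
qed

text \<open>The allowance is halved at each step, one half for the maximum formed so far and one
  half for the new smooth maximum; hence the induction is over all \<delta>.\<close>

lemma short_test_finite_max:
  assumes "finite I" "I \<subseteq> short_test" "\<delta> > 0"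
  obtains w where "w \<in> short_test" "\<And>u p. u \<in> I \<Longrightarrow> u p - \<delta> \<le> w p"
proof -
  have "\<exists>w\<in>short_test. \<forall>u\<in>I. \<forall>p. u p - \<delta> \<le> w p"
    using assms
  proof (induction I arbitrary: \<delta>)
    case empty
    then show ?case using short_test_zero by blast
  next
    case (insert u I)
    then obtain w where w: "w \<in> short_test" "\<forall>u\<in>I. \<forall>p. u p - \<delta> / 2 \<le> w p"
      by (metis half_gt_zero insert_subset)
    obtain m where m: "m \<in> short_test" "\<And>p. u p - \<delta> / 2 \<le> m p" "\<And>p. w p - \<delta> / 2 \<le> m p"
      using short_test_max[of u w "\<delta> / 2"] w insert.prems by auto
    have "v p - \<delta> \<le> m p" if "v \<in> insert u I" for v p
    proof (cases "v = u")
      case True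
      then show ?thesis using m(2)[of p] insert.prems(2) by simp
    next
      case False
      then have "v p - \<delta> / 2 \<le> w p" using w(2) that by blast
      then show ?thesis using m(3)[of p] by simp
    qed
    then show ?case using m(1) by blast
  qed
  then show ?thesis using that by blast
qed

end

subsection \<open>Coordinate ellipsoids\<close>

context local_riemannian
begin

text \<open>The form attains a minimum on the compact unit sphere; homogeneity does the
  rest.\<close>

lemma metric_ge_norm:
  assumes x: "x \<in> U"
  obtains m where "m > 0" "\<And>v. m * (norm v)\<^sup>2 \<le> G x v v"
proof -
  have cont: "continuous_on (sphere 0 1) (\<lambda>v. G x v v)"
    using x by (intro continuous_on_apply continuous_on_const continuous_on_id) auto
  have "(axis undefined 1 :: real^'n) \<in> sphere 0 1" by simp
  then obtain v0 where v0: "v0 \<in> sphere 0 1" "\<And>v. v \<in> sphere 0 1 \<Longrightarrow> G x v0 v0 \<le> G x v v"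
    using continuous_attains_inf[OF compact_sphere _ cont] by blast
  show ?thesis
  proof (rule that[of "G x v0 v0"])
    show "G x v0 v0 > 0" using v0(1) by (intro pos[OF x]) auto
    fix v :: "real^'n"
    show "G x v0 v0 * (norm v)\<^sup>2 \<le> G x v v"
    proof (cases "v = 0")
      case False
      have "G x v0 v0 \<le> G x (v /\<^sub>R norm v) (v /\<^sub>R norm v)" using False by (intro v0(2)) simp
      also have "\<dots> = G x v v / (norm v)\<^sup>2"
        using x by (simp add: metric_linear power2_eq_square divide_inverse)
      finally show ?thesis using False by (simp add: field_simps)
    qed (simp add: metric_linear x)
  qed
qed

text \<open>Balls of the metric frozen at x0, with s the square of the radius. Their defining
  function is a quadratic polynomial, hence smooth with explicit differential, unlike the Riemannian
  distance.\<close>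

abbreviation "ellipsoid x0 s \<equiv> {x. G x0 (x - x0) (x - x0) \<le> s}"

lemma continuous_on_metric_at:
  "x0 \<in> U \<Longrightarrow> continuous_on S (\<lambda>x. G x0 (x - x0) (x - x0))"
  by (intro continuous_on_apply continuous_intros) auto

lemma compact_ellipsoid:
  assumes "x0 \<in> U"
  shows "compact (ellipsoid x0 s)"
proof -
  obtain m where m: "m > 0" "\<And>v. m * (norm v)\<^sup>2 \<le> G x0 v v" using metric_ge_norm[OF assms] by metis
  have "closed (ellipsoid x0 s)"
    by (intro closed_Collect_le continuous_on_metric_at[OF assms] continuous_on_const)
  moreover have "ellipsoid x0 s \<subseteq> cball x0 (sqrt (s / m))"
  proof
    fix x assume "x \<in> ellipsoid x0 s"
    then have "m * (norm (x - x0))\<^sup>2 \<le> s" using m(2)[of "x - x0"] by simp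
    then have "(norm (x - x0))\<^sup>2 \<le> s / m" using m(1) by (simp add: field_simps)
    then have "norm (x - x0) \<le> sqrt (s / m)" by (rule real_le_rsqrt)
    then show "x \<in> cball x0 (sqrt (s / m))" by (simp add: dist_norm norm_minus_commute)
  qed
  ultimately show ?thesis using bounded_subset[OF bounded_cball] compact_eq_bounded_closed by blast
qed

lemma metric_comparable:
  assumes x0: "x0 \<in> U"
  obtains \<rho> where "\<rho> > 0" "\<And>x. x \<in> ellipsoid x0 (\<rho>\<^sup>2) \<Longrightarrow> x \<in> U"
    "\<And>x v. x \<in> ellipsoid x0 (\<rho>\<^sup>2) \<Longrightarrow> G x0 v v \<le> 4 * G x v v"
    "\<And>x v. x \<in> ellipsoid x0 (\<rho>\<^sup>2) \<Longrightarrow> G x v v \<le> 4 * G x0 v v"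
proof -
  obtain m where m: "m > 0" "\<And>v. m * (norm v)\<^sup>2 \<le> G x0 v v" using metric_ge_norm[OF x0] by metis
  define \<phi> where "\<phi> x = (\<Sum>i\<in>Basis. \<Sum>j\<in>Basis. \<bar>G x i j - G x0 i j\<bar>)" for x
  have "continuous_on U \<phi>"
    unfolding \<phi>_def by (intro continuous_intros smooth_on_imp_continuous_on[OF smooth])
  then have "isCont \<phi> x0" using x0 open_dom by (simp add: continuous_on_eq_continuous_at)
  then obtain r where r: "r > 0" "\<And>x. dist x x0 < r \<Longrightarrow> dist (\<phi> x) (\<phi> x0) < m / 2"
    using m(1) unfolding continuous_at_eps_delta by (metis half_gt_zero)
  obtain r' where r': "r' > 0" "ball x0 r' \<subseteq> U" using openE[OF open_dom x0] by metis
  define \<rho> where "\<rho> = sqrt m * min r r' / 2"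
  have \<rho>: "\<rho> > 0" using m r r' by (simp add: \<rho>_def)
  have near: "dist x x0 < min r r'" if "x \<in> ellipsoid x0 (\<rho>\<^sup>2)" for x
  proof -
    have "m * (norm (x - x0))\<^sup>2 \<le> \<rho>\<^sup>2" using m(2)[of "x - x0"] that by simp
    also have "\<dots> = m * (min r r' / 2)\<^sup>2" using m(1) by (simp add: \<rho>_def power_mult_distrib power_divide)
    finally have "(norm (x - x0))\<^sup>2 \<le> (min r r' / 2)\<^sup>2" using m(1) by simp
    then have "norm (x - x0) \<le> min r r' / 2" by (rule power2_le_imp_le) (use r r' in auto)
    then show ?thesis using r r' by (simp add: dist_norm min_def split: if_splits)
  qed
  have bound: "x \<in> U \<and> \<bar>G x v v - G x0 v v\<bar> \<le> G x0 v v / 2" if x: "x \<in> ellipsoid x0 (\<rho>\<^sup>2)" for x v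
  proof
    show xU: "x \<in> U" using near[OF x] r'(2) by (auto simp: dist_commute)
    have "\<phi> x0 = 0" by (simp add: \<phi>_def)
    then have \<phi>x: "\<phi> x \<le> m / 2" using r(2)[of x] near[OF x] by (simp add: dist_real_def)
    have "G x v v - G x0 v v = (\<Sum>i\<in>Basis. \<Sum>j\<in>Basis. ((v \<bullet> i) * (v \<bullet> j)) * (G x i j - G x0 i j))"
      using bilinear_Basis_expansion[OF bilinear[OF xU], of v v] bilinear_Basis_expansion[OF bilinear[OF x0], of v v]
      by (simp add: right_diff_distrib sum_subtractf)
    also have "\<bar>\<dots>\<bar> \<le> (\<Sum>i\<in>Basis. \<Sum>j\<in>Basis. (norm v)\<^sup>2 * \<bar>G x i j - G x0 i j\<bar>)"
    proof (intro order_trans[OF sum_abs] sum_mono)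
      fix i j :: "real^'n" assume "i \<in> Basis" "j \<in> Basis"
      then have "\<bar>v \<bullet> i\<bar> * \<bar>v \<bullet> j\<bar> \<le> norm v * norm v"
        by (intro mult_mono Basis_le_norm) auto
      then show "\<bar>((v \<bullet> i) * (v \<bullet> j)) * (G x i j - G x0 i j)\<bar> \<le> (norm v)\<^sup>2 * \<bar>G x i j - G x0 i j\<bar>"
        by (simp add: abs_mult power2_eq_square mult_right_mono)
    qed
    also have "\<dots> = (norm v)\<^sup>2 * \<phi> x" by (simp add: \<phi>_def sum_distrib_left)
    also have "\<dots> \<le> (norm v)\<^sup>2 * (m / 2)" using \<phi>x by (intro mult_left_mono) auto
    also have "\<dots> \<le> G x0 v v / 2" using m(2)[of v] by (simp add: mult.commute)
    finally show "\<bar>G x v v - G x0 v v\<bar> \<le> G x0 v v / 2" .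
  qed
  show ?thesis
  proof (rule that[OF \<rho>])
    fix x v assume x: "x \<in> ellipsoid x0 (\<rho>\<^sup>2)"
    show "x \<in> U" using bound[OF x] by blast
    show "G x0 v v \<le> 4 * G x v v" "G x v v \<le> 4 * G x0 v v"
      using conjunct2[OF bound[OF x, of v]] nonneg[OF x0, of v] unfolding abs_le_iff by linarith+
  qed
qed

lemma bump_exists:
  assumes x0: "x0 \<in> U" and "\<sigma> > 0"
    and comp: "\<And>x. x \<in> ellipsoid x0 (4 * \<sigma>\<^sup>2) \<Longrightarrow> x \<in> U" "\<And>x v. x \<in> ellipsoid x0 (4 * \<sigma>\<^sup>2) \<Longrightarrow> G x0 v v \<le> 4 * G x v v"
  obtains \<psi> where "smooth_on UNIV \<psi>"
    "\<And>x v. x \<in> ellipsoid x0 (4 * \<sigma>\<^sup>2) \<Longrightarrow> (frechet_derivative \<psi> (at x) v)\<^sup>2 \<le> G x v v"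
    "\<And>x. x \<notin> ellipsoid x0 (\<sigma>\<^sup>2) \<Longrightarrow> \<psi> x = 0" "\<sigma> / 16 \<le> \<psi> x0"
proof -
  obtain \<theta> \<theta>' where \<theta>: "smooth_on UNIV \<theta>" "\<And>x. (\<theta> has_real_derivative \<theta>' x) (at x)"
    "\<And>x. 0 \<le> \<theta>' x" "\<And>x. \<theta>' x \<le> 1" "\<theta> 0 = 0" "\<And>x. x \<ge> \<sigma>\<^sup>2 \<Longrightarrow> \<theta> x = \<theta> (\<sigma>\<^sup>2)" "\<sigma>\<^sup>2 - \<sigma>\<^sup>2 / 2 \<le> \<theta> (\<sigma>\<^sup>2)"
  proof -
    have "0 < \<sigma>\<^sup>2 / 2" "\<sigma>\<^sup>2 / 2 \<le> \<sigma>\<^sup>2" using assms(2) by auto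
    from smooth_truncation_exists[OF this] that show ?thesis by metis
  qed
  \<comment> \<open>Where Q \<le> 4 \<sigma>^2, Cauchy-Schwarz bounds the differential of Q at v by
    2 * 2\<sigma> * 2|v| = 8 \<sigma> |v|; A normalises this to slope one. The height is then at
    least A \<sigma>^2 / 2 = \<sigma> / 16.\<close>
  define A where "A = 1 / (8 * \<sigma>)"
  define Q where "Q x = G x0 (x - x0) (x - x0)" for x
  have Q: "smooth_on UNIV Q"
    unfolding Q_def using x0
    by (intro smooth_on_apply smooth_on_const smooth_on_diff smooth_on_ident) auto
  have dQ: "(Q has_derivative (\<lambda>v. 2 * G x0 (x - x0) v)) (at x)" for x
  proof -
    have d: "((\<lambda>x. x - x0) has_derivative (\<lambda>v. v)) (at x)" by (auto intro!: derivative_eq_intros)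
    show ?thesis
      using has_derivative_apply[OF has_derivative_const[of x0] x0 d d] sym[OF x0, of _ "x - x0"]
      by (simp add: Q_def[abs_def] linear_0[OF dmetric_linear'[OF x0]])
  qed
  define \<psi> where "\<psi> x = A * (\<theta> (\<sigma>\<^sup>2) - \<theta> (Q x))" for x
  have d\<psi>: "frechet_derivative \<psi> (at x) v = - A * \<theta>' (Q x) * (2 * G x0 (x - x0) v)" for x v
  proof -
    have "((\<lambda>x. \<theta> (Q x)) has_derivative (\<lambda>v. \<theta>' (Q x) * (2 * G x0 (x - x0) v))) (at x)"
      by (rule has_derivative_compose[OF dQ \<theta>(2)[unfolded has_field_derivative_def]])
    then have "(\<psi> has_derivative (\<lambda>v. A * (0 - \<theta>' (Q x) * (2 * G x0 (x - x0) v)))) (at x)"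
      unfolding \<psi>_def by (intro has_derivative_mult_right has_derivative_diff has_derivative_const)
    then show ?thesis by (simp add: frechet_derivative_eqI)
  qed
  show ?thesis
  proof (rule that[of \<psi>])
    show "smooth_on UNIV \<psi>"
      unfolding \<psi>_def
      by (intro smooth_on_mult smooth_on_diff smooth_on_const open_UNIV smooth_on_compose[OF _ _ _ \<theta>(1) Q]) auto
    show "\<psi> x = 0" if "x \<notin> ellipsoid x0 (\<sigma>\<^sup>2)" for x
      using \<theta>(6)[of "Q x"] that by (simp add: \<psi>_def Q_def)
    have "Q x0 = 0" by (simp add: Q_def metric_linear x0)
    have "\<sigma> / 16 = A * (\<sigma>\<^sup>2 / 2)" using assms(2) by (simp add: A_def power2_eq_square)
    also have "\<dots> \<le> A * \<theta> (\<sigma>\<^sup>2)" using \<theta>(7) assms(2) by (intro mult_left_mono) (auto simp: A_def)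
    finally show "\<sigma> / 16 \<le> \<psi> x0" using \<open>Q x0 = 0\<close> \<theta>(5) by (simp add: \<psi>_def)
    fix x v assume x: "x \<in> ellipsoid x0 (4 * \<sigma>\<^sup>2)"
    have "(G x0 (x - x0) v)\<^sup>2 \<le> G x0 (x - x0) (x - x0) * G x0 v v"
      by (rule psd_Cauchy_Schwarz[OF bilinear[OF x0] sym[OF x0] nonneg[OF x0]])
    also have "\<dots> \<le> (4 * \<sigma>\<^sup>2) * (4 * G x v v)"
      using x comp(2)[OF x, of v] nonneg[OF x0] by (intro mult_mono) auto
    finally have CS: "(G x0 (x - x0) v)\<^sup>2 \<le> (4 * \<sigma>\<^sup>2) * (4 * G x v v)" .
    have "(frechet_derivative \<psi> (at x) v)\<^sup>2 = (4 * A\<^sup>2) * ((\<theta>' (Q x))\<^sup>2 * (G x0 (x - x0) v)\<^sup>2)"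
      unfolding d\<psi> by (simp add: power_mult_distrib)
    also have "\<dots> \<le> (4 * A\<^sup>2) * (1 * ((4 * \<sigma>\<^sup>2) * (4 * G x v v)))"
      using \<theta>(3,4)[of "Q x"] CS nonneg[OF comp(1)[OF x], of v] by (intro mult_left_mono mult_mono power_le_one) auto
    also have "\<dots> = G x v v" using assms(2) by (simp add: A_def power_divide power_mult_distrib)
    finally show "(frechet_derivative \<psi> (at x) v)\<^sup>2 \<le> G x v v" .
  qed
qed

end

subsection \<open>Complete manifolds carry large functions with gradient at most one\<close>

text \<open>
  If \<open>N p = sup u(p)\<close>, taken over the compactly supported \<open>u\<close> with \<open>\<bar>du\<bar> \<le> 1\<close>, is finite, then it
  decreases at a definite rate from every point \<open>p\<close> to some point of a small shell around it:
  otherwise the smooth maximum of finitely many \<open>u\<close>, truncated so as to be constant on the shell and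
  continued inside by this constant plus a bump, would exceed \<open>N p\<close> at \<open>p\<close>.
\<close>

context riemannian
begin

text \<open>w is constant on the shell between Q = \<sigma>^2 and Q = 4 \<sigma>^2, and the bump
  vanishes there, so the two formulas agree on the shell. Switching at the intermediate level 2
  \<sigma>^2 leaves a collar on both sides, whence every point has a neighbourhood on which a single
  formula holds.\<close>

lemma short_test_glue:
  assumes w: "w \<in> short_test" and c: "c \<in> \<A>" "x0 \<in> cimg c" and \<sigma>: "\<sigma> > 0"
    and Q: "Q = (\<lambda>x. g c x0 (x - x0) (x - x0))"
    and comp: "\<And>x. Q x \<le> 4 * \<sigma>\<^sup>2 \<Longrightarrow> x \<in> cimg c" "\<And>x v. Q x \<le> 4 * \<sigma>\<^sup>2 \<Longrightarrow> g c x0 v v \<le> 4 * g c x v v"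
    and const: "\<And>x. \<sigma>\<^sup>2 \<le> Q x \<Longrightarrow> Q x \<le> 4 * \<sigma>\<^sup>2 \<Longrightarrow> w (cinv c x) = \<kappa>"
  obtains v where "v \<in> short_test" "\<kappa> + \<sigma> / 16 \<le> v (cinv c x0)"
proof -
  interpret c: local_riemannian "cimg c" "g c" by (rule local_riemannian_chart[OF c(1)])
  have sw: "short w" using w by (simp add: short_test_def)
  obtain K where K: "compact K" "K \<subseteq> points \<A>" "\<And>p. p \<in> points \<A> - K \<Longrightarrow> w p = 0"
    using short_test_support[OF w] by metis
  obtain \<psi> where \<psi>: "smooth_on UNIV \<psi>" "\<And>x v. Q x \<le> 4 * \<sigma>\<^sup>2 \<Longrightarrow> (frechet_derivative \<psi> (at x) v)\<^sup>2 \<le> g c x v v"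
    "\<And>x. \<not> Q x \<le> \<sigma>\<^sup>2 \<Longrightarrow> \<psi> x = 0" "\<sigma> / 16 \<le> \<psi> x0"
    using c.bump_exists[OF c(2) \<sigma>] comp unfolding Q by force
  define v where "v q = (if q \<in> cdom c \<and> Q (cmap c q) < 2 * \<sigma>\<^sup>2 then \<kappa> + \<psi> (cmap c q) else w q)" for q
  define L where "L = cinv c ` {x. Q x \<le> 2 * \<sigma>\<^sup>2}"
  have \<sigma>2: "0 < \<sigma>\<^sup>2" using \<sigma> by simp
  have sub: "{x. Q x \<le> 2 * \<sigma>\<^sup>2} \<subseteq> cimg c"
  proof clarify
    fix x assume "Q x \<le> 2 * \<sigma>\<^sup>2"
    then have "Q x \<le> 4 * \<sigma>\<^sup>2" using \<sigma>2 by linarith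
    then show "x \<in> cimg c" by (rule comp(1))
  qed
  have "compact {x. Q x \<le> 2 * \<sigma>\<^sup>2}" unfolding Q by (rule c.compact_ellipsoid[OF c(2)])
  then have L: "compact L"
    unfolding L_def by (rule compact_continuous_image[OF continuous_on_subset[OF chartD(4)[OF c(1)] sub]])
  have Lp: "L \<subseteq> points \<A>" using sub cinv_in_points[OF c(1)] by (auto simp: L_def)
  have outside: "v q = w q" if "q \<notin> L" for q
  proof -
    have "\<not> (q \<in> cdom c \<and> Q (cmap c q) < 2 * \<sigma>\<^sup>2)"
    proof
      assume "q \<in> cdom c \<and> Q (cmap c q) < 2 * \<sigma>\<^sup>2"
      then have "cinv c (cmap c q) \<in> L" by (auto simp: L_def)
      then show False using that chartD(8)[OF c(1)] \<open>q \<in> cdom c \<and> _\<close> by simp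
    qed
    then show ?thesis unfolding v_def by (rule if_not_P)
  qed
  have inside: "v (cinv c x) = \<kappa> + \<psi> x" if "Q x < 4 * \<sigma>\<^sup>2" for x
  proof (cases "Q x < 2 * \<sigma>\<^sup>2")
    case True
    then show ?thesis using chartD(5,6)[OF c(1) comp(1)[of x]] that by (simp add: v_def)
  next
    case False
    then have "\<psi> x = 0" "w (cinv c x) = \<kappa>" using \<psi>(3)[of x] const[of x] \<sigma>2 that by auto
    then show ?thesis using False chartD(6)[OF c(1) comp(1)[of x]] that by (simp add: v_def)
  qed
  have "short v"
  proof (rule shortI)
    fix p assume p: "p \<in> points \<A>"
    show "\<exists>c\<in>\<A>. \<exists>V f. open V \<and> V \<subseteq> cimg c \<and> p \<in> cdom c \<and> cmap c p \<in> V \<and>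
      smooth_on V f \<and> (\<forall>x\<in>V. \<forall>v. (frechet_derivative f (at x) v)\<^sup>2 \<le> g c x v v) \<and> (\<forall>x\<in>V. v (cinv c x) = f x)"
    proof (cases "p \<in> L")
      case True
      then obtain x where x: "p = cinv c x" "Q x \<le> 2 * \<sigma>\<^sup>2" by (auto simp: L_def)
      then have xc: "x \<in> cimg c" "Q x < 4 * \<sigma>\<^sup>2" using sub \<sigma>2 by (blast, linarith)
      have "open {x. Q x < 4 * \<sigma>\<^sup>2}"
        unfolding Q by (intro open_Collect_less c.continuous_on_metric_at[OF c(2)] continuous_on_const)
      moreover have "smooth_on {x. Q x < 4 * \<sigma>\<^sup>2} (\<lambda>x. \<kappa> + \<psi> x)"
        using smooth_on_subset[OF smooth_on_add[OF open_UNIV smooth_on_const \<psi>(1)]] by blast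
      moreover have "frechet_derivative (\<lambda>x. \<kappa> + \<psi> x) (at y) = frechet_derivative \<psi> (at y)" for y
        using has_derivative_add[OF has_derivative_const[of \<kappa>] smooth_on_has_derivative[OF \<psi>(1), of y]]
        by (simp add: frechet_derivative_eqI)
      ultimately show ?thesis
        using x xc chartD(5,6)[OF c(1) xc(1)] comp(1) \<psi>(2) inside
        by (intro bexI[OF _ c(1)] exI[of _ "{x. Q x < 4 * \<sigma>\<^sup>2}"] exI[of _ "\<lambda>x. \<kappa> + \<psi> x"]) auto
    next
      case False
      obtain d where d: "d \<in> \<A>" "p \<in> cdom d" using p by (auto simp: points_def)
      define V where "V = cmap d ` (cdom d \<inter> - L)"
      have V: "open V" "V \<subseteq> cimg d"
        unfolding V_def using L by (auto intro!: open_chart_overlap chart d compact_imp_closed simp: cimg_def)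
      have "v (cinv d x) = w (cinv d x)" if "x \<in> V" for x
        using that by (intro outside) (auto simp: V_def chart_image_Int[OF chart[OF d(1)]])
      then show ?thesis
        using d V False smooth_on_subset[OF short_smooth[OF sw d(1)] V(2)] short_bound[OF sw d(1)]
        by (intro bexI[OF _ d(1)] exI[of _ V] exI[of _ "w \<circ> cinv d"]) (auto simp: V_def)
    qed
  qed
  then have "v \<in> short_test"
    using short_testI[of v "K \<union> L"] K L Lp outside by auto
  moreover have "Q x0 = 0" unfolding Q by (simp add: c.metric_linear c(2))
  then have "\<kappa> + \<sigma> / 16 \<le> v (cinv c x0)" using inside[of x0] \<psi>(4) \<sigma>2 by simp
  ultimately show ?thesis using that by blast
qed

text \<open>This is N of the remark above. A real supremum is meaningful only for bounded sets: the
  assumption \<open>bdd\<close> below is made for contradiction and refuted in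
  \<open>short_test_unbounded\<close>.\<close>

definition reach :: "'m \<Rightarrow> real" where
  "reach p = (SUP u\<in>short_test. u p)"

context
  assumes bdd: "\<And>p. p \<in> points \<A> \<Longrightarrow> bdd_above ((\<lambda>u. u p) ` short_test)"
begin

lemma le_reach: "p \<in> points \<A> \<Longrightarrow> u \<in> short_test \<Longrightarrow> u p \<le> reach p"
  unfolding reach_def by (rule cSUP_upper[OF _ bdd])

lemma reach_nonneg: "p \<in> points \<A> \<Longrightarrow> 0 \<le> reach p"
  using le_reach[OF _ short_test_zero] by simp

lemma less_reachE:
  assumes "t < reach p"
  obtains u where "u \<in> short_test" "t < u p"
proof (rule ccontr)
  assume "\<not> thesis"
  then have "\<And>u. u \<in> short_test \<Longrightarrow> u p \<le> t" using that by force
  then have "reach p \<le> t" unfolding reach_def by (intro cSUP_least) (use short_test_zero in blast)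
  then show False using assms by simp
qed

text \<open>A supremum of functions with Lipschitz constant one has Lipschitz constant one; a
  negative difference is sent to 0 by \<open>ennreal\<close>.\<close>

lemma reach_le_dist:
  assumes "p \<in> points \<A>" "q \<in> points \<A>"
  shows "ennreal (reach p - reach q) \<le> dst p q"
proof (rule dense_ge)
  fix e assume e: "dst p q < e"
  show "ennreal (reach p - reach q) \<le> e"
  proof (rule ccontr)
    assume ne: "\<not> ennreal (reach p - reach q) \<le> e"
    then obtain r where r: "e = ennreal r" "0 \<le> r" by (cases e) auto
    have "r < reach p - reach q" using ne r by (simp add: not_le ennreal_less_iff)
    then obtain u where u: "u \<in> short_test" "reach q + r < u p" using less_reachE[of "reach q + r" p] by auto
    have "u q \<le> reach q" by (rule le_reach[OF assms(2) u(1)])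
    then have "r < \<bar>u q - u p\<bar>" using u(2) by simp
    then have "e \<le> ennreal \<bar>u q - u p\<bar>" unfolding r by (intro ennreal_leI) simp
    also have "\<dots> \<le> dst p q" using u(1) by (intro short_le_dist) (simp add: short_test_def)
    finally show False using e by simp
  qed
qed

text \<open>The constants: points of the ellipsoid are within 4 \<sigma> of p, so without descent at
  rate 128 \<open>reach\<close> stays above reach p - \<sigma>/32 there. Maximum and truncation lose
  \<delta> = \<sigma>/256 each, the bump gains \<sigma>/16, and reach p would be exceeded by 3
  \<sigma>/128.\<close>

lemma reach_descent:
  assumes p: "p \<in> points \<A>"
  shows "\<exists>q\<in>points \<A>. reach q < reach p \<and> dst p q \<le> ennreal (128 * (reach p - reach q))"
proof (rule ccontr)
  assume no: "\<not> ?thesis"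
  obtain c where c: "c \<in> \<A>" "p \<in> cdom c" using p by (auto simp: points_def)
  interpret c: local_riemannian "cimg c" "g c" by (rule local_riemannian_chart[OF c(1)])
  define x0 where "x0 = cmap c p"
  have x0: "x0 \<in> cimg c" "cinv c x0 = p" using chartD(7,8)[OF c] by (auto simp: x0_def)
  define Q where "Q = (\<lambda>x. g c x0 (x - x0) (x - x0))"
  obtain \<rho> where \<rho>: "\<rho> > 0" "\<And>x. Q x \<le> \<rho>\<^sup>2 \<Longrightarrow> x \<in> cimg c" "\<And>x v. Q x \<le> \<rho>\<^sup>2 \<Longrightarrow> g c x0 v v \<le> 4 * g c x v v"
    "\<And>x v. Q x \<le> \<rho>\<^sup>2 \<Longrightarrow> g c x v v \<le> 4 * g c x0 v v"
    using c.metric_comparable[OF x0(1)] unfolding Q_def by auto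
  define \<sigma> where "\<sigma> = \<rho> / 2"
  have \<sigma>: "\<sigma> > 0" "\<rho>\<^sup>2 = 4 * \<sigma>\<^sup>2" using \<rho>(1) by (auto simp: \<sigma>_def power_divide)
  note comp = \<rho>(2-4)[unfolded \<sigma>(2)]
  have Q0: "0 \<le> Q x" for x unfolding Q_def by (rule c.nonneg[OF x0(1)])
  have dist: "dst p (cinv c x) \<le> ennreal (4 * \<sigma>)" if x: "Q x \<le> 4 * \<sigma>\<^sup>2" for x
  proof -
    let ?v = "x - x0"
    have Qt: "Q (x0 + t *\<^sub>R ?v) \<le> 4 * \<sigma>\<^sup>2" if "0 \<le> t" "t \<le> 1" for t
    proof -
      have "Q (x0 + t *\<^sub>R ?v) = t\<^sup>2 * Q x"
        unfolding Q_def add_diff_cancel_left' using x0(1)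
        by (simp add: c.metric_linear(3,4) power2_eq_square)
      also have "\<dots> \<le> 1 * Q x" using that Q0 by (intro mult_right_mono power_le_one) auto
      finally show ?thesis using x by simp
    qed
    have "dst (cinv c x0) (cinv c (x0 + ?v)) \<le> ennreal (4 * \<sigma>)"
    proof (rule dist_segment_le[OF c(1)])
      fix t :: real assume t: "0 \<le> t" "t \<le> 1"
      show "x0 + t *\<^sub>R ?v \<in> cimg c" by (rule comp(1)[OF Qt[OF t]])
      have "g c (x0 + t *\<^sub>R ?v) ?v ?v \<le> 4 * Q x" unfolding Q_def by (rule comp(3)[OF Qt[OF t]])
      also have "\<dots> \<le> (4 * \<sigma>)\<^sup>2" using x by (simp add: power_mult_distrib)
      finally show "g c (x0 + t *\<^sub>R ?v) ?v ?v \<le> (4 * \<sigma>)\<^sup>2" .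
    qed (use \<sigma> in simp)
    then show ?thesis using x0 by simp
  qed
  \<comment> \<open>The drop \<sigma>/32 is the distance bound 4 \<sigma> divided by the excluded
    rate 128.\<close>
  define t0 where "t0 = reach p - \<sigma> / 32"
  have big: "t0 < reach (cinv c x)" if x: "Q x \<le> 4 * \<sigma>\<^sup>2" for x
  proof (rule ccontr)
    assume "\<not> t0 < reach (cinv c x)"
    then have 1: "\<sigma> \<le> 32 * (reach p - reach (cinv c x))" by (simp add: t0_def)
    have "dst p (cinv c x) \<le> ennreal (128 * (reach p - reach (cinv c x)))"
      by (rule order_trans[OF dist[OF x]]) (use 1 in \<open>intro ennreal_leI, simp\<close>)
    moreover have "reach (cinv c x) < reach p" using 1 \<sigma> by simp
    ultimately show False using no cinv_in_points[OF c(1) comp(1)[OF x]] by blast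
  qed
  \<comment> \<open>\<open>reach\<close> is only a supremum, but on the compact shell finitely many
    functions suffice for one of them to exceed t0 at each point.\<close>
  define Sh where "Sh = {x. Q x \<le> 4 * \<sigma>\<^sup>2} \<inter> {x. \<sigma>\<^sup>2 \<le> Q x}"
  have "closed {x. \<sigma>\<^sup>2 \<le> Q x}"
    unfolding Q_def by (intro closed_Collect_le c.continuous_on_metric_at[OF x0(1)] continuous_on_const)
  then have Sh: "compact Sh"
    unfolding Sh_def using c.compact_ellipsoid[OF x0(1), of "4 * \<sigma>\<^sup>2"] unfolding Q_def
    by (rule compact_Int_closed[rotated])
  define P where "P u = {x \<in> cimg c. t0 < u (cinv c x)}" for u
  have "open (P u)" if "u \<in> short_test" for u
  proof -
    have "continuous_on (cimg c) (u \<circ> cinv c)"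
      using that by (intro smooth_on_imp_continuous_on[OF short_smooth] c(1)) (simp add: short_test_def)
    from continuous_open_preimage[OF this c.open_dom open_greaterThan[of t0]]
    show ?thesis by (simp add: P_def vimage_def Int_def)
  qed
  moreover have "Sh \<subseteq> (\<Union>u\<in>short_test. P u)"
  proof
    fix x assume "x \<in> Sh"
    then have x: "Q x \<le> 4 * \<sigma>\<^sup>2" by (simp add: Sh_def)
    obtain u where "u \<in> short_test" "t0 < u (cinv c x)" using less_reachE[OF big[OF x]] by blast
    then show "x \<in> (\<Union>u\<in>short_test. P u)" using comp(1)[OF x] by (auto simp: P_def)
  qed
  ultimately obtain I where I: "I \<subseteq> short_test" "finite I" "Sh \<subseteq> (\<Union>u\<in>I. P u)"
    using compactE_image[OF Sh] by metis
  define \<delta> where "\<delta> = \<sigma> / 256"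
  have \<delta>: "\<delta> > 0" using \<sigma> by (simp add: \<delta>_def)
  obtain w0 where w0: "w0 \<in> short_test" "\<And>u p. u \<in> I \<Longrightarrow> u p - \<delta> \<le> w0 p"
    using short_test_finite_max[OF I(2,1) \<delta>] by metis
  have w0_ge: "t0 - \<delta> \<le> w0 (cinv c x)" if xSh: "x \<in> Sh" for x
  proof -
    obtain u where "u \<in> I" "x \<in> P u" using I(3) xSh by blast
    then show ?thesis using w0(2)[of u "cinv c x"] by (simp add: P_def)
  qed
  have "\<exists>w\<in>short_test. \<exists>\<kappa>\<ge>t0 - 2 * \<delta>. \<forall>x\<in>Sh. w (cinv c x) = \<kappa>"
  proof (cases "\<delta> \<le> t0 - \<delta>")
    case True
    obtain \<theta> \<theta>' where \<theta>: "smooth_on UNIV \<theta>" "\<And>x. (\<theta> has_real_derivative \<theta>' x) (at x)"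
      "\<And>x. 0 \<le> \<theta>' x" "\<And>x. \<theta>' x \<le> 1" "\<theta> 0 = 0" "\<And>x. x \<ge> t0 - \<delta> \<Longrightarrow> \<theta> x = \<theta> (t0 - \<delta>)" "t0 - \<delta> - \<delta> \<le> \<theta> (t0 - \<delta>)"
      using smooth_truncation_exists[OF \<delta> True] by metis
    have "(\<lambda>q. \<theta> (w0 q)) \<in> short_test" by (rule short_test_compose[OF w0(1) \<theta>(1-5)])
    then show ?thesis
      using \<theta>(6)[OF w0_ge] \<theta>(7) by (intro bexI[of _ "\<lambda>q. \<theta> (w0 q)"] exI[of _ "\<theta> (t0 - \<delta>)"]) auto
  next
    \<comment> \<open>Here t0 - 2 \<delta> is negative, so the zero function serves with \<kappa> =
      0.\<close>
    case False
    then show ?thesis using \<delta> by (intro bexI[OF _ short_test_zero] exI[of _ 0]) auto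
  qed
  then obtain w \<kappa> where w: "w \<in> short_test" "t0 - 2 * \<delta> \<le> \<kappa>" "\<And>x. x \<in> Sh \<Longrightarrow> w (cinv c x) = \<kappa>" by blast
  obtain v where "v \<in> short_test" "\<kappa> + \<sigma> / 16 \<le> v (cinv c x0)"
    by (rule short_test_glue[OF w(1) c(1) x0(1) \<sigma>(1) Q_def comp(1,2)]) (use w(3) in \<open>auto simp: Sh_def\<close>)
  then have "\<kappa> + \<sigma> / 16 \<le> reach p" using le_reach[OF p] x0(2) by force
  then show False using w(2) \<sigma>(1) by (simp add: t0_def \<delta>_def)
qed

end

end

text \<open>Caristi's argument: greedy descent yields a Cauchy sequence from whose limit no descent is possible.\<close>

lemma no_descent_in_complete_space:
  fixes d :: "'a \<Rightarrow> 'a \<Rightarrow> ennreal" and N :: "'a \<Rightarrow> real"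
  assumes "X \<noteq> {}" "C > 0"
    and refl: "\<And>p. p \<in> X \<Longrightarrow> d p p = 0" and sym: "\<And>p q. d p q = d q p" and triangle: "\<And>p q r. d p r \<le> d p q + d q r"
    and nonneg: "\<And>p. p \<in> X \<Longrightarrow> 0 \<le> N p"
    and lip: "\<And>p q. p \<in> X \<Longrightarrow> q \<in> X \<Longrightarrow> ennreal (N p - N q) \<le> d p q"
    and complete: "\<And>s. range s \<subseteq> X \<Longrightarrow> (\<And>e. e > 0 \<Longrightarrow> \<exists>M. \<forall>m\<ge>M. \<forall>n\<ge>M. d (s m) (s n) < e) \<Longrightarrow>
      \<exists>p\<in>X. (\<lambda>n. d (s n) p) \<longlonglongrightarrow> 0"
    and descent: "\<And>p. p \<in> X \<Longrightarrow> \<exists>q\<in>X. N q < N p \<and> d p q \<le> ennreal (C * (N p - N q))"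
  shows False
proof -
  define S where "S p = {q \<in> X. N q < N p \<and> d p q \<le> ennreal (C * (N p - N q))}" for p
  \<comment> \<open>Descent composes, the allowances C (N p - N q) being additive along a
    chain.\<close>
  have trans: "q' \<in> S p" if "q \<in> S p" "q' \<in> S q" for p q q'
  proof -
    have "d p q' \<le> ennreal (C * (N p - N q)) + ennreal (C * (N q - N q'))"
      using triangle[of p q' q] that add_mono[of "d p q" _ "d q q'"] unfolding S_def by (blast intro: order_trans)
    also have "\<dots> = ennreal (C * (N p - N q'))"
      using that assms(2) by (subst ennreal_plus[symmetric]) (auto simp: S_def algebra_simps)
    finally show ?thesis using that by (auto simp: S_def)
  qed
  define m where "m p = (INF q\<in>S p. N q)" for p
  have bdd: "bdd_below (N ` S p)" for p by (rule bdd_belowI[of _ 0]) (auto simp: S_def nonneg)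
  \<comment> \<open>The greedy choice: each step covers at least half of the drop still possible
    within \<open>S p\<close>.\<close>
  have "\<exists>q. q \<in> S p \<and> N q \<le> (N p + m p) / 2" if p: "p \<in> X" for p
  proof -
    obtain q where q: "q \<in> S p" using descent[OF p] by (auto simp: S_def)
    have "m p \<le> N q" unfolding m_def by (rule cINF_lower[OF bdd q])
    then have "m p < (N p + m p) / 2" using q by (simp add: S_def)
    then show ?thesis
      using cINF_less_iff[OF _ bdd, of p "(N p + m p) / 2"] q unfolding m_def by (force intro: less_imp_le)
  qed
  then obtain nxt where nxt: "\<And>p. p \<in> X \<Longrightarrow> nxt p \<in> S p \<and> N (nxt p) \<le> (N p + m p) / 2" by metis
  obtain p0 where p0: "p0 \<in> X" using assms(1) by blast
  define s where "s n = (nxt ^^ n) p0" for n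
  have s0: "s n \<in> X" for n
    by (induction n) (use p0 nxt in \<open>auto simp: s_def S_def\<close>)
  have sS: "s (Suc n) \<in> S (s n)" "N (s (Suc n)) \<le> (N (s n) + m (s n)) / 2" for n
    using nxt[OF s0[of n]] by (auto simp: s_def)
  have mono: "s (n + Suc k) \<in> S (s n)" for n k
    by (induction k) (use sS trans in auto)
  have less: "s j \<in> S (s i)" if "i < j" for i j
    using mono[of i "j - Suc i"] that by simp
  have dec: "decseq (\<lambda>n. N (s n))"
    by (intro decseq_SucI) (use sS(1) in \<open>auto simp: S_def less_imp_le\<close>)
  obtain L where L: "(\<lambda>n. N (s n)) \<longlonglongrightarrow> L" "\<And>i. L \<le> N (s i)"
    using decseq_convergent[OF dec, of 0] nonneg s0 by metis
  have "\<exists>p\<in>X. (\<lambda>n. d (s n) p) \<longlonglongrightarrow> 0"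
  proof (rule complete)
    show "range s \<subseteq> X" using s0 by auto
    fix e :: ennreal assume "e > 0"
    then obtain r where r: "0 < r" "ennreal r < e"
    proof (cases e)
      case (real x)
      then show ?thesis using that[of "x / 2"] \<open>e > 0\<close> by (simp add: ennreal_less_iff)
    qed (use that[of 1] in simp)
    have r0: "r / C > 0" using assms(2) r by simp
    obtain M where M: "\<And>n. n \<ge> M \<Longrightarrow> \<bar>N (s n) - L\<bar> < r / C"
      using LIMSEQ_D[OF L(1) r0] by auto
    have small: "d (s i) (s j) < e" if "M \<le> i" "i < j" for i j
    proof -
      have "N (s i) - N (s j) \<le> r / C" using M[OF that(1)] L(2)[of j] by simp
      then have "C * (N (s i) - N (s j)) \<le> r" using assms(2) by (simp add: field_simps)
      then have "ennreal (C * (N (s i) - N (s j))) \<le> ennreal r" by (rule ennreal_leI)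
      then show ?thesis using less[OF that(2)] r(2) by (auto simp: S_def)
    qed
    show "\<exists>M. \<forall>m\<ge>M. \<forall>n\<ge>M. d (s m) (s n) < e"
    proof (intro exI[of _ M] allI impI)
      fix i j assume ij: "M \<le> i" "M \<le> j"
      consider "i < j" | "j < i" | "i = j" by linarith
      then show "d (s i) (s j) < e"
        using small[of i j] small[of j i] sym[of "s i" "s j"] refl[OF s0[of i]] \<open>e > 0\<close> ij by cases auto
    qed
  qed
  then obtain p where p: "p \<in> X" "(\<lambda>n. d (s n) p) \<longlonglongrightarrow> 0" by blast
  \<comment> \<open>The Lipschitz bound on N carries the limit of the values over to the limit
    point.\<close>
  have "ennreal (N p - L) \<le> 0"
  proof (rule LIMSEQ_le)
    show "(\<lambda>n. ennreal (N p - N (s n))) \<longlonglongrightarrow> ennreal (N p - L)"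
      by (intro tendsto_ennrealI tendsto_intros L(1))
    show "(\<lambda>n. d (s n) p) \<longlonglongrightarrow> 0" by (rule p(2))
    show "\<exists>M. \<forall>n\<ge>M. ennreal (N p - N (s n)) \<le> d (s n) p"
      using lip[OF p(1) s0] sym by simp
  qed
  then have NpL: "N p \<le> L" by (simp add: ennreal_eq_0_iff)
  have to_p: "d (s n) p \<le> ennreal (C * (N (s n) - L))" for n
  proof (rule ennreal_le_epsilon)
    fix e :: real assume "e > 0"
    then have "\<forall>\<^sub>F m in sequentially. d (s m) p < ennreal e"
      by (intro order_tendstoD(2)[OF p(2)]) simp
    then have "\<forall>\<^sub>F m in sequentially. d (s m) p < ennreal e \<and> n < m"
      using eventually_gt_at_top[of n] by (rule eventually_conj)
    then obtain k where k: "d (s k) p < ennreal e" "n < k"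
      by (metis (mono_tags, lifting) eventually_happens' sequentially_bot)
    have "d (s n) p \<le> d (s n) (s k) + d (s k) p" by (rule triangle)
    also have "\<dots> \<le> ennreal (C * (N (s n) - N (s k))) + ennreal e"
      using less[OF k(2)] k(1) by (intro add_mono) (auto simp: S_def)
    also have "\<dots> \<le> ennreal (C * (N (s n) - L)) + ennreal e"
      using L(2)[of k] assms(2) by (intro add_right_mono ennreal_leI) simp
    finally show "d (s n) p \<le> ennreal (C * (N (s n) - L)) + ennreal e" .
  qed
  \<comment> \<open>A descent from p to q would be a descent from every s n as well, so the greedy
    choice would push L down to at most N q, contradicting N q < N p \<le> L.\<close>
  obtain q where q: "q \<in> S p" using descent[OF p(1)] by (auto simp: S_def)
  have "q \<in> S (s n)" for n
  proof -
    have "d (s n) q \<le> ennreal (C * (N (s n) - L)) + ennreal (C * (N p - N q))"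
      using triangle[of "s n" q p] add_mono[OF to_p[of n], of "d p q"] q unfolding S_def by (blast intro: order_trans)
    also have "\<dots> = ennreal (C * (N (s n) - L) + C * (N p - N q))"
      using q L(2)[of n] assms(2) by (subst ennreal_plus) (auto simp: S_def)
    also have "\<dots> \<le> ennreal (C * (N (s n) - N q))"
      using NpL assms(2) by (intro ennreal_leI) (simp add: algebra_simps)
    finally show ?thesis using q NpL L(2)[of n] by (auto simp: S_def)
  qed
  then have mq: "m (s n) \<le> N q" for n unfolding m_def by (rule cINF_lower[OF bdd])
  have "N (s (Suc n)) \<le> (N (s n) + N q) / 2" for n
    by (rule order_trans[OF sS(2)]) (use mq[of n] in simp)
  then have "L \<le> (L + N q) / 2"
    by (intro LIMSEQ_le[OF LIMSEQ_Suc[OF L(1)], of "\<lambda>n. (N (s n) + N q) / 2"] tendsto_intros L(1)) auto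
  then show False using q NpL by (simp add: S_def)
qed

theorem (in riemannian) short_test_unbounded:
  assumes "complete_manifold \<A> g" "points \<A> \<noteq> {}"
  obtains p where "p \<in> points \<A>" "\<And>R. \<exists>u\<in>short_test. R < u p"
proof -
  have "\<not> (\<forall>p\<in>points \<A>. bdd_above ((\<lambda>u. u p) ` short_test))"
  proof
    assume "\<forall>p\<in>points \<A>. bdd_above ((\<lambda>u. u p) ` short_test)"
    then have b: "\<And>p. p \<in> points \<A> \<Longrightarrow> bdd_above ((\<lambda>u. u p) ` short_test)" by (rule bspec)
    show False
    proof (rule no_descent_in_complete_space[where d=dst and N=reach and X="points \<A>" and C=128])
      show "dst p p = 0" if p: "p \<in> points \<A>" for p
      proof -
        obtain c where c: "c \<in> \<A>" "p \<in> cdom c" using p by (auto simp: points_def)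
        interpret c: local_riemannian "cimg c" "g c" by (rule local_riemannian_chart[OF c(1)])
        note C = chartD(7,8)[OF c]
        have "dst (cinv c (cmap c p)) (cinv c (cmap c p + 0)) \<le> ennreal 0"
          by (rule dist_segment_le[OF c(1)]) (use C in \<open>auto simp: c.metric_linear\<close>)
        then show ?thesis using C by simp
      qed
      show "\<exists>p\<in>points \<A>. (\<lambda>n. dst (s n) p) \<longlonglongrightarrow> 0"
        if "range s \<subseteq> points \<A>" "\<And>e. e > 0 \<Longrightarrow> \<exists>M. \<forall>m\<ge>M. \<forall>n\<ge>M. dst (s m) (s n) < e" for s
        using assms(1) that unfolding complete_manifold_def by blast
      show "dst p q = dst q p" for p q by (rule dist_sym)
      show "dst p r \<le> dst p q + dst q r" for p q r by (rule dist_triangle)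
    qed (use assms(2) reach_nonneg[OF b] reach_le_dist[OF b] reach_descent[OF b] in auto)
  qed
  then have "\<exists>p. p \<in> points \<A> \<and> \<not> bdd_above ((\<lambda>u. u p) ` short_test)"
    unfolding Ball_def not_all not_imp .
  then obtain p where p: "p \<in> points \<A>" "\<not> bdd_above ((\<lambda>u. u p) ` short_test)"
    by (elim exE conjE)
  have "\<exists>u\<in>short_test. R < u p" for R
    using p(2) unfolding bdd_above_def by (force simp: not_le)
  with p(1) that show ?thesis by blast
qed

subsection \<open>Change of variables for arbitrary finite index types\<close>

text \<open>
  The change of variables theorem of the library requires a well-ordered index type. Every finite
  type \<open>'n\<close> has the well-ordered copy \<open>'n wo_copy\<close>, to which integrals are transported.
\<close>

typedef ('n::finite) wo_copy = "{..<CARD('n)}" by (rule exI[of _ 0]) simp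

instantiation wo_copy :: (finite) wellorder
begin

definition "x \<le> y \<longleftrightarrow> Rep_wo_copy x \<le> Rep_wo_copy y"
definition "x < y \<longleftrightarrow> Rep_wo_copy x < Rep_wo_copy y"

instance
proof
  fix P :: "'a wo_copy \<Rightarrow> bool" and a
  assume step: "\<And>x. (\<And>y. y < x \<Longrightarrow> P y) \<Longrightarrow> P x"
  show "P a"
    by (induction "Rep_wo_copy a" arbitrary: a rule: less_induct) (auto intro: step simp: less_wo_copy_def)
qed (auto simp: less_eq_wo_copy_def less_wo_copy_def Rep_wo_copy_inject)

end

instance wo_copy :: (finite) finite
proof
  have "(UNIV :: 'a wo_copy set) = Abs_wo_copy ` {..<CARD('a)}"
    by (rule type_definition.Abs_image[OF type_definition_wo_copy, symmetric])
  then show "finite (UNIV :: 'a wo_copy set)" by (metis finite_imageI finite_lessThan)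
qed

lemma wo_copy_bij:
  obtains \<beta> :: "'n::finite \<Rightarrow> 'n wo_copy" where "bij \<beta>"
proof -
  have "card (UNIV :: 'n wo_copy set) = CARD('n)"
    by (simp add: type_definition.card[OF type_definition_wo_copy])
  then show ?thesis using finite_same_card_bij[of "UNIV :: 'n set" "UNIV :: 'n wo_copy set"] that by auto
qed

definition reindex :: "('m \<Rightarrow> 'n) \<Rightarrow> real^'n \<Rightarrow> real^'m" where
  "reindex \<gamma> x = (\<chi> i. x $ \<gamma> i)"

lemma linear_reindex: "linear (reindex \<gamma>)"
  by (rule linearI) (simp_all add: reindex_def vec_eq_iff)

lemma borel_measurable_reindex [measurable]: "reindex \<gamma> \<in> borel_measurable borel"
  by (intro borel_measurable_continuous_onI linear_continuous_on linear_conv_bounded_linear[THEN iffD1] linear_reindex)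

lemma reindex_inverse:
  assumes "bij \<beta>"
  shows "reindex \<beta> (reindex (inv \<beta>) x) = x" "reindex (inv \<beta>) (reindex \<beta> y) = y"
  using assms by (simp_all add: reindex_def vec_eq_iff bij_is_inj inv_f_f surj_f_inv_f bij_is_surj)

lemma prod_Basis_vec:
  fixes v :: "real^'n"
  shows "(\<Prod>b\<in>Basis. v \<bullet> b) = (\<Prod>i\<in>UNIV. v $ i)"
proof -
  have B: "(Basis :: (real^'n) set) = range (\<lambda>i. axis i 1)" by (auto simp: Basis_vec_def)
  have "inj (\<lambda>i::'n. axis i (1::real))" by (auto simp: inj_on_def axis_eq_axis)
  then show ?thesis unfolding B by (simp add: prod.reindex inner_axis)
qed

text \<open>Permuting coordinates maps boxes to boxes with the same side lengths, and boxes
  determine Lebesgue measure.\<close>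

lemma distr_reindex:
  fixes \<beta> :: "'m::finite \<Rightarrow> 'n::finite"
  assumes "bij \<beta>"
  shows "distr lborel borel (reindex \<beta>) = (lborel :: (real^'m) measure)"
proof (rule lborel_eqI[symmetric])
  fix l u :: "real^'m"
  assume le: "\<And>b. b \<in> Basis \<Longrightarrow> l \<bullet> b \<le> u \<bullet> b"
  let ?l = "reindex (inv \<beta>) l" and ?u = "reindex (inv \<beta>) u"
  have le': "l $ i \<le> u $ i" for i using le[of "axis i 1"] by (simp add: inner_axis)
  have "reindex \<beta> -` box l u = box ?l ?u"
  proof (intro set_eqI)
    fix x :: "real^'n"
    have "(\<forall>i. l $ i < x $ \<beta> i \<and> x $ \<beta> i < u $ i) \<longleftrightarrow> (\<forall>j. l $ inv \<beta> j < x $ j \<and> x $ j < u $ inv \<beta> j)"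
      using assms by (metis bij_inv_eq_iff)
    then show "x \<in> reindex \<beta> -` box l u \<longleftrightarrow> x \<in> box ?l ?u" by (simp add: mem_box_cart reindex_def)
  qed
  then have "emeasure (distr lborel borel (reindex \<beta>)) (box l u) = emeasure lborel (box ?l ?u)"
    by (simp add: emeasure_distr)
  also have "\<dots> = (\<Prod>b\<in>Basis. (?u - ?l) \<bullet> b)"
    using le' by (intro emeasure_lborel_box) (auto simp: Basis_vec_def inner_axis reindex_def)
  also have "\<dots> = (\<Prod>b\<in>Basis. (u - l) \<bullet> b)"
    unfolding prod_Basis_vec
    using prod.reindex_bij_betw[OF bij_imp_bij_inv[OF assms], of "\<lambda>i. (u - l) $ i"] by (simp add: reindex_def)
  finally show "emeasure (distr lborel borel (reindex \<beta>)) (box l u) = (\<Prod>b\<in>Basis. (u - l) \<bullet> b)" .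
qed simp

text \<open>Rows and columns are relabelled simultaneously; the summands of the Leibniz formula
  correspond by conjugating permutations with \<gamma>, which preserves signs.\<close>

lemma det_reindex:
  fixes A :: "real^'n^'n" and \<gamma> :: "'m::finite \<Rightarrow> 'n::finite"
  assumes "bij \<gamma>"
  shows "det (\<chi> i j. A $ \<gamma> i $ \<gamma> j) = det A"
proof -
  have inj: "inj_on \<gamma> UNIV" and b: "bij_betw \<gamma> UNIV UNIV" using assms by (auto simp: bij_is_inj)
  have map: "map_permutation UNIV \<gamma> p (\<gamma> i) = \<gamma> (p i)" for p i
    using inj assms by (simp add: map_permutation_def restrict_id_def bij_is_surj)
  have bij: "bij_betw (map_permutation UNIV \<gamma>) {p. p permutes UNIV} {p. p permutes UNIV}"
  proof (rule bij_betw_byWitness[where f'="\<lambda>q. inv \<gamma> \<circ> q \<circ> \<gamma>"])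
    show "\<forall>p\<in>{p. p permutes UNIV}. inv \<gamma> \<circ> map_permutation UNIV \<gamma> p \<circ> \<gamma> = p"
      using inj by (auto simp: fun_eq_iff map)
    show "\<forall>q\<in>{p. p permutes UNIV}. map_permutation UNIV \<gamma> (inv \<gamma> \<circ> q \<circ> \<gamma>) = q"
      using assms by (auto simp: fun_eq_iff map_permutation_def restrict_id_def bij_is_surj surj_f_inv_f)
    show "map_permutation UNIV \<gamma> ` {p. p permutes UNIV} \<subseteq> {p. p permutes UNIV}"
      using map_permutation_permutes[OF b] by auto
    show "(\<lambda>q. inv \<gamma> \<circ> q \<circ> \<gamma>) ` {p. p permutes UNIV} \<subseteq> {p. p permutes UNIV}"
      using assms by (auto simp: permutes_bij intro!: bij_imp_permutes bij_comp bij_imp_bij_inv)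
  qed
  have "det A = (\<Sum>p | p permutes UNIV. of_int (sign (map_permutation UNIV \<gamma> p)) * (\<Prod>i\<in>UNIV. A $ i $ map_permutation UNIV \<gamma> p i))"
    unfolding det_def by (rule sum.reindex_bij_betw[OF bij, symmetric])
  also have "\<dots> = (\<Sum>p | p permutes UNIV. of_int (sign p) * (\<Prod>i\<in>UNIV. A $ \<gamma> i $ \<gamma> (p i)))"
  proof (rule sum.cong[OF refl])
    fix p :: "'m \<Rightarrow> 'm" assume "p \<in> {p. p permutes UNIV}"
    then have "sign (map_permutation UNIV \<gamma> p) = sign p" by (intro sign_map_permutation inj) auto
    moreover have "(\<Prod>i\<in>UNIV. A $ i $ map_permutation UNIV \<gamma> p i) = (\<Prod>i\<in>UNIV. A $ \<gamma> i $ \<gamma> (p i))"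
      by (subst prod.reindex_bij_betw[OF b, symmetric]) (simp add: map)
    ultimately show "of_int (sign (map_permutation UNIV \<gamma> p)) * (\<Prod>i\<in>UNIV. A $ i $ map_permutation UNIV \<gamma> p i)
       = of_int (sign p) * (\<Prod>i\<in>UNIV. A $ \<gamma> i $ \<gamma> (p i))" by simp
  qed
  finally show ?thesis by (simp add: det_def)
qed

text \<open>For nonnegative integrands absolute integrability and integrability coincide, so the
  vector-valued theorem, used with values in \<open>real^1\<close>, yields an equivalence of plain
  integrals.\<close>

lemma has_integral_change_of_variables_nonneg:
  fixes g :: "real^'m::{finite,wellorder} \<Rightarrow> real^'m::_" and f :: "real^'m::_ \<Rightarrow> real"
  assumes "A \<in> sets lebesgue" "\<And>x. x \<in> A \<Longrightarrow> (g has_derivative g' x) (at x within A)" "inj_on g A"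
    and nonneg: "\<And>x. x \<in> A \<Longrightarrow> 0 \<le> f (g x)"
  shows "((\<lambda>x. \<bar>det (matrix (g' x))\<bar> * f (g x)) has_integral I) A \<longleftrightarrow> (f has_integral I) (g ` A)"
proof -
  have "(\<lambda>x. \<bar>det (matrix (g' x))\<bar> * f (g x)) absolutely_integrable_on A \<and>
      integral A (\<lambda>x. \<bar>det (matrix (g' x))\<bar> * f (g x)) = I
    \<longleftrightarrow> f absolutely_integrable_on (g ` A) \<and> integral (g ` A) f = I"
    using has_absolute_integral_change_of_variables[OF assms(1-3), of "\<lambda>y. vec (f y) :: real^1" "vec I"]
    by (simp add: absolutely_integrable_on_1_iff integral_on_1_eq vec_eq_iff)
  then show ?thesis
    using absolutely_integrable_on_iff_nonneg[of A "\<lambda>x. \<bar>det (matrix (g' x))\<bar> * f (g x)"]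
      absolutely_integrable_on_iff_nonneg[of "g ` A" f] nonneg
    by (auto simp: has_integral_iff)
qed

lemma has_integral_of_nn_integral:
  fixes f :: "'a::euclidean_space \<Rightarrow> real"
  assumes "(\<lambda>x. f x * indicator A x) \<in> borel_measurable borel" "\<And>x. x \<in> A \<Longrightarrow> 0 \<le> f x"
    "(\<integral>\<^sup>+x. ennreal (f x) * indicator A x \<partial>lborel) \<noteq> \<infinity>"
  obtains I where "(f has_integral I) A"
proof -
  obtain I where I: "0 \<le> I" "(\<integral>\<^sup>+x. ennreal (f x) * indicator A x \<partial>lborel) = ennreal I"
    using assms(3) by (cases "\<integral>\<^sup>+x. ennreal (f x) * indicator A x \<partial>lborel") auto
  have "(\<integral>\<^sup>+x. ennreal (f x * indicator A x) \<partial>lborel) = ennreal I"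
    unfolding I(2)[symmetric] by (intro nn_integral_cong) (auto simp: indicator_def)
  then have "((\<lambda>x. f x * indicator A x) has_integral I) UNIV"
    using assms(1,2) I(1) by (intro nn_integral_has_integral) (auto simp: indicator_def)
  then have "((\<lambda>x. if x \<in> A then f x else 0) has_integral I) UNIV"
    by (rule has_integral_eq[rotated]) (auto simp: indicator_def)
  then show ?thesis using that by (simp add: has_integral_restrict_UNIV)
qed

text \<open>Either both sides are infinite, or one of them is finite and then possesses an integral,
  which the equivalence transfers to the other side.\<close>

lemma nn_integral_change_of_variables_wellorder:
  fixes g :: "real^'m::{finite,wellorder} \<Rightarrow> real^'m::_" and f :: "real^'m::_ \<Rightarrow> real"
  assumes "A \<in> sets borel" "\<And>x. x \<in> A \<Longrightarrow> (g has_derivative g' x) (at x within A)" "inj_on g A"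
    and nonneg: "\<And>x. x \<in> A \<Longrightarrow> 0 \<le> f (g x)"
    and "(\<lambda>y. f y * indicator (g ` A) y) \<in> borel_measurable borel"
    and "(\<lambda>x. (\<bar>det (matrix (g' x))\<bar> * f (g x)) * indicator A x) \<in> borel_measurable borel"
  shows "(\<integral>\<^sup>+y. ennreal (f y) * indicator (g ` A) y \<partial>lborel)
    = (\<integral>\<^sup>+x. ennreal (\<bar>det (matrix (g' x))\<bar> * f (g x)) * indicator A x \<partial>lborel)" (is "?L = ?R")
proof -
  have "A \<in> sets lebesgue" using assms(1) by simp
  note iff = has_integral_change_of_variables_nonneg[where f=f, OF this assms(2,3) nonneg]
  have eq: "?L = ?R" if "(f has_integral I) (g ` A)" for I
  proof -
    have "?L = ennreal I" by (rule nn_integral_has_integral_lebesgue'[OF _ that]) (use nonneg in auto)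
    moreover have "?R = ennreal I"
      by (rule nn_integral_has_integral_lebesgue'[OF _ iffD2[OF iff that]]) (use nonneg in auto)
    ultimately show ?thesis by simp
  qed
  show ?thesis
  proof (cases "?L = \<infinity> \<and> ?R = \<infinity>")
    case False
    then consider "?L \<noteq> \<infinity>" | "?R \<noteq> \<infinity>" by blast
    then show ?thesis
    proof cases
      case 1
      obtain I where "(f has_integral I) (g ` A)"
        by (rule has_integral_of_nn_integral[OF assms(5) _ 1]) (use nonneg in auto)
      then show ?thesis by (rule eq)
    next
      case 2
      obtain I where "((\<lambda>x. \<bar>det (matrix (g' x))\<bar> * f (g x)) has_integral I) A"
        by (rule has_integral_of_nn_integral[OF assms(6) _ 2]) (use nonneg in auto)
      then show ?thesis using iff eq by blast
    qed
  qed simp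
qed

lemma nn_integral_change_of_variables:
  fixes g :: "real^'n::finite \<Rightarrow> real^'n" and f :: "real^'n \<Rightarrow> real"
  assumes "A \<in> sets borel" "\<And>x. x \<in> A \<Longrightarrow> (g has_derivative g' x) (at x within A)" "inj_on g A"
    and nonneg: "\<And>x. x \<in> A \<Longrightarrow> 0 \<le> f (g x)"
    and mf: "(\<lambda>y. f y * indicator (g ` A) y) \<in> borel_measurable borel"
    and mg: "(\<lambda>x. (\<bar>det (matrix (g' x))\<bar> * f (g x)) * indicator A x) \<in> borel_measurable borel"
  shows "(\<integral>\<^sup>+y. ennreal (f y) * indicator (g ` A) y \<partial>lborel)
    = (\<integral>\<^sup>+x. ennreal (\<bar>det (matrix (g' x))\<bar> * f (g x)) * indicator A x \<partial>lborel)"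
proof -
  obtain \<beta> :: "'n \<Rightarrow> 'n wo_copy" where \<beta>: "bij \<beta>" by (rule wo_copy_bij)
  define R where "R = reindex (inv \<beta>)"
  define R' where "R' = reindex \<beta>"
  have inv: "R' (R x) = x" "R (R' y) = y" for x y
    unfolding R_def R'_def using reindex_inverse[OF \<beta>] by auto
  have [measurable]: "R \<in> borel_measurable borel" "R' \<in> borel_measurable borel"
    unfolding R_def R'_def by measurable
  have lin: "linear R" "linear R'" unfolding R_def R'_def by (rule linear_reindex)+
  have dR: "(R has_derivative R) F" "(R' has_derivative R') F'" for F F'
    using lin by (auto intro!: bounded_linear_imp_has_derivative simp: linear_conv_bounded_linear)
  have lb: "distr lborel borel R' = lborel" unfolding R'_def by (rule distr_reindex[OF \<beta>])
  have transport: "(\<integral>\<^sup>+x. F x \<partial>lborel) = (\<integral>\<^sup>+y. F (R' y) \<partial>lborel)" if "F \<in> borel_measurable borel" for F :: "real^'n \<Rightarrow> ennreal"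
    by (subst lb[symmetric]) (rule nn_integral_distr, use that in auto)
  let ?g = "\<lambda>y. R (g (R' y))" and ?A = "R ` A" and ?g' = "\<lambda>y v. R (g' (R' y) (R' v))"
  have im: "R' y \<in> A \<longleftrightarrow> y \<in> ?A" "R' y \<in> g ` A \<longleftrightarrow> y \<in> ?g ` ?A" for y
    by (metis imageE imageI inv, auto simp: image_image inv intro: rev_image_eqI) (metis imageI inv)
  have imA: "?A = R' -` A \<inter> space borel" using im by auto
  have "?A \<in> sets borel" unfolding imA using assms(1) by (rule measurable_sets[rotated]) measurable
  \<comment> \<open>Conjugation by the relabelling only permutes rows and columns of the Jacobian
    matrix.\<close>
  have det: "det (matrix (?g' y)) = det (matrix (g' (R' y)))" for y
  proof -
    have R'_axis: "R' (axis j 1) = axis (inv \<beta> j) 1" for j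
      using \<beta> by (auto simp: R'_def reindex_def vec_eq_iff axis_def bij_inv_eq_iff)
    have "matrix (?g' y) = (\<chi> i j. matrix (g' (R' y)) $ inv \<beta> i $ inv \<beta> j)"
      by (simp add: vec_eq_iff matrix_def R'_axis) (simp add: R_def reindex_def)
    then show ?thesis using det_reindex[OF bij_imp_bij_inv[OF \<beta>]] by simp
  qed
  have "(\<integral>\<^sup>+y. ennreal (f y) * indicator (g ` A) y \<partial>lborel) = (\<integral>\<^sup>+y. ennreal (f (R' y)) * indicator (?g ` ?A) y \<partial>lborel)"
  proof (subst transport)
    have "(\<lambda>y. ennreal (f y * indicator (g ` A) y)) \<in> borel_measurable borel" using mf by measurable
    then show "(\<lambda>y. ennreal (f y) * indicator (g ` A) y) \<in> borel_measurable borel"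
      by (rule measurable_cong[THEN iffD1, rotated]) (auto simp: indicator_def)
  qed (intro nn_integral_cong, use im in \<open>auto simp: indicator_def\<close>)
  also have "\<dots> = (\<integral>\<^sup>+y. ennreal (\<bar>det (matrix (?g' y))\<bar> * f (R' (?g y))) * indicator ?A y \<partial>lborel)"
  proof (rule nn_integral_change_of_variables_wellorder[OF \<open>?A \<in> sets borel\<close>])
    fix y assume y: "y \<in> ?A"
    then have "R' y \<in> A" using im by simp
    have "R' ` ?A \<subseteq> A" using im by auto
    then have "((\<lambda>y. g (R' y)) has_derivative (\<lambda>v. g' (R' y) (R' v))) (at y within ?A)"
      using has_derivative_in_compose2[of A g g' R' ?A y R'] assms(2) dR(2) y by blast
    then show "(?g has_derivative ?g' y) (at y within ?A)"
      by (rule has_derivative_compose[OF _ dR(1)])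
    show "0 \<le> f (R' (?g y))" using nonneg[OF \<open>R' y \<in> A\<close>] by (simp add: inv)
  next
    show "inj_on ?g ?A"
    proof (rule inj_onI)
      fix x y assume "x \<in> ?A" "y \<in> ?A" "?g x = ?g y"
      then have "g (R' x) = g (R' y)" "R' x \<in> A" "R' y \<in> A" using im by (metis inv(1), auto)
      then show "x = y" using assms(3) by (metis inj_onD inv(2))
    qed
    have "(\<lambda>y. f (R' y) * indicator (g ` A) (R' y)) \<in> borel_measurable borel"
      by (rule measurable_compose[OF _ mf]) measurable
    then show "(\<lambda>y. f (R' y) * indicator (?g ` ?A) y) \<in> borel_measurable borel"
      by (rule measurable_cong[THEN iffD1, rotated]) (use im in \<open>auto simp: indicator_def\<close>)
    have "(\<lambda>y. (\<bar>det (matrix (g' (R' y)))\<bar> * f (g (R' y))) * indicator A (R' y)) \<in> borel_measurable borel"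
      by (rule measurable_compose[OF _ mg]) measurable
    then show "(\<lambda>y. (\<bar>det (matrix (?g' y))\<bar> * f (R' (?g y))) * indicator ?A y) \<in> borel_measurable borel"
      by (rule measurable_cong[THEN iffD1, rotated]) (use im in \<open>auto simp: indicator_def det inv\<close>)
  qed
  also have "\<dots> = (\<integral>\<^sup>+x. ennreal (\<bar>det (matrix (g' x))\<bar> * f (g x)) * indicator A x \<partial>lborel)"
  proof (subst transport)
    have "(\<lambda>x. ennreal ((\<bar>det (matrix (g' x))\<bar> * f (g x)) * indicator A x)) \<in> borel_measurable borel" using mg by measurable
    then show "(\<lambda>x. ennreal (\<bar>det (matrix (g' x))\<bar> * f (g x)) * indicator A x) \<in> borel_measurable borel"
      by (rule measurable_cong[THEN iffD1, rotated]) (auto simp: indicator_def)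
  qed (intro nn_integral_cong, use im in \<open>auto simp: indicator_def det inv\<close>)
  finally show ?thesis .
qed

subsection \<open>The Riemannian volume\<close>

text \<open>Along the segment from the standard inner product to G x all forms are inner products,
  so the determinant never vanishes and keeps the sign it has at the identity matrix.\<close>

lemma (in local_riemannian) det_gram_pos:
  assumes x: "x \<in> U"
  shows "0 < det (gram G x)"
proof (rule ccontr)
  assume "\<not> ?thesis"
  then have neg: "det (gram G x) \<le> 0" by simp
  define M where "M t = (1 - t) *\<^sub>R mat 1 + t *\<^sub>R gram G x" for t :: real
  have "continuous_on {0..1} (\<lambda>t. det (M t))"
    unfolding det_def M_def by (intro continuous_intros)
  moreover have "det (M 1) \<le> 0" "0 \<le> det (M 0)" using neg by (simp_all add: M_def)
  ultimately obtain t where t: "0 \<le> t" "t \<le> 1" "det (M t) = 0"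
    using IVT2'[of "\<lambda>t. det (M t)" 1 0 0] by auto
  define G' where "G' = (\<lambda>y::real^'n. \<lambda>u v. (1 - t) * (u \<bullet> v) + t * G x u v)"
  interpret G': local_riemannian UNIV G'
  proof
    show "bilinear (G' y)" for y
      unfolding G'_def bilinear_def
      by (auto intro!: linearI simp: metric_linear x inner_add_left inner_add_right algebra_simps)
    show "G' y u v = G' y v u" for y u v by (simp add: G'_def inner_commute sym[OF x])
    show "0 < G' y u u" if "u \<noteq> 0" for y u
    proof (cases "t = 0")
      case False
      then have "0 < t * G x u u" using t pos[OF x that] by simp
      moreover have "0 \<le> (1 - t) * (u \<bullet> u)" using t by simp
      ultimately show ?thesis by (simp add: G'_def)
    qed (use that in \<open>simp add: G'_def\<close>)
  qed (simp_all add: G'_def smooth_on_const)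
  have "gram G' x = M t"
    by (simp add: gram_def M_def G'_def vec_eq_iff mat_def inner_axis_axis)
  then show False using G'.det_gram_nonzero[of x] t(3) by simp
qed

context riemannian
begin

definition vol_density :: "('m, 'n) chart \<Rightarrow> real^'n \<Rightarrow> real" where
  "vol_density c x = sqrt (det (gram (g c) x))"

lemma vol_density_pos: "c \<in> \<A> \<Longrightarrow> x \<in> cimg c \<Longrightarrow> 0 < vol_density c x"
  using local_riemannian.det_gram_pos[OF local_riemannian_chart] by (simp add: vol_density_def)

lemma continuous_on_vol_density: "c \<in> \<A> \<Longrightarrow> continuous_on (cimg c) (vol_density c)"
proof -
  assume c: "c \<in> \<A>"
  interpret c: local_riemannian "cimg c" "g c" by (rule local_riemannian_chart[OF c])
  show ?thesis
    unfolding vol_density_def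
    by (intro continuous_on_real_sqrt smooth_on_imp_continuous_on[OF smooth_on_det[OF c.open_dom c.smooth_on_gram]])
qed

lemma vol_density_transition:
  assumes "c \<in> \<A>" "d \<in> \<A>" "x \<in> cmap c ` (cdom c \<inter> cdom d)"
  shows "vol_density c x = \<bar>det (matrix (frechet_derivative (transition c d) (at x)))\<bar> * vol_density d (transition c d x)"
proof -
  interpret T: local_isometry "cmap c ` (cdom c \<inter> cdom d)" "cimg d" "g c" "g d" "transition c d"
    by (rule local_isometry_transition[OF assms(1,2)])
  have "gram (g c) x = transpose (matrix (T.D x)) ** gram (g d) (transition c d x) ** matrix (T.D x)"
    unfolding gram_def T.isometry[OF assms(3)]
    by (rule form_matrix_pullback[OF T.cod.bilinear[OF T.T_in[OF assms(3)]]])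
  then have "det (gram (g c) x) = (det (matrix (T.D x)))\<^sup>2 * det (gram (g d) (transition c d x))"
    by (simp add: det_mul power2_eq_square)
  then show ?thesis by (simp add: vol_density_def real_sqrt_mult)
qed

lemma borel_chart_image:
  assumes "c \<in> \<A>" "B \<in> sets borel" "B \<subseteq> cdom c"
  shows "cmap c ` B \<in> sets borel"
proof -
  have "cmap c ` B = {x \<in> cimg c. cinv c x \<in> B}"
    using chart_image_Int[OF chart[OF assms(1)], of B] assms(3) by (simp add: Int_absorb1)
  also have "\<dots> = cinv c -` B \<inter> space (restrict_space borel (cimg c))" by (auto simp: space_restrict_space)
  also have "\<dots> \<in> sets (restrict_space borel (cimg c))"
    by (rule measurable_sets[OF borel_measurable_continuous_on_restrict[OF chartD(4)[OF assms(1)]] assms(2)])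
  finally show ?thesis
    using chartD(2)[OF assms(1)] by (auto simp: sets_restrict_space)
qed

lemma vol_density_measurable:
  assumes "c \<in> \<A>" "B \<in> sets borel" "B \<subseteq> cimg c"
  shows "(\<lambda>x. vol_density c x * indicator B x) \<in> borel_measurable borel"
  using borel_measurable_continuous_on_indicator[OF assms(2) continuous_on_subset[OF continuous_on_vol_density[OF assms(1)] assms(3)]]
  by (simp add: mult.commute)

definition chart_volume :: "('m, 'n) chart \<Rightarrow> 'm set \<Rightarrow> ennreal" where
  "chart_volume c B = (\<integral>\<^sup>+ x \<in> cmap c ` B. ennreal (vol_density c x) \<partial>lborel)"

text \<open>The Jacobian of the transition is exactly the quotient of the two densities.\<close>

lemma chart_volume_transition:
  assumes "c \<in> \<A>" "d \<in> \<A>" "B \<in> sets borel" "B \<subseteq> cdom c" "B \<subseteq> cdom d"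
  shows "chart_volume c B = chart_volume d B"
proof -
  interpret T: local_isometry "cmap c ` (cdom c \<inter> cdom d)" "cimg d" "g c" "g d" "transition c d"
    by (rule local_isometry_transition[OF assms(1,2)])
  let ?T = "transition c d"
  have sub: "cmap c ` B \<subseteq> cmap c ` (cdom c \<inter> cdom d)" using assms by auto
  have im: "?T ` cmap c ` B = cmap d ` B"
    using assms(4) chartD(8)[OF assms(1)] by (force simp: transition_def image_image)
  have cim: "cmap c ` B \<subseteq> cimg c" "cmap d ` B \<subseteq> cimg d" using assms by (auto simp: cimg_def)
  have eq: "vol_density c x = \<bar>det (matrix (T.D x))\<bar> * vol_density d (?T x)" if "x \<in> cmap c ` B" for x
    using vol_density_transition[OF assms(1,2)] sub that by blast
  have "(\<integral>\<^sup>+y. ennreal (vol_density d y) * indicator (?T ` cmap c ` B) y \<partial>lborel)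
    = (\<integral>\<^sup>+x. ennreal (\<bar>det (matrix (T.D x))\<bar> * vol_density d (?T x)) * indicator (cmap c ` B) x \<partial>lborel)"
  proof (rule nn_integral_change_of_variables)
    show "cmap c ` B \<in> sets borel" by (rule borel_chart_image[OF assms(1,3,4)])
    show "(?T has_derivative T.D x) (at x within cmap c ` B)" if "x \<in> cmap c ` B" for x
      using smooth_on_has_derivative[OF T.smooth_T] sub that by (blast intro: has_derivative_at_withinI)
    show "inj_on ?T (cmap c ` B)"
    proof (rule inj_onI)
      fix x y assume xy: "x \<in> cmap c ` B" "y \<in> cmap c ` B" "?T x = ?T y"
      have "cinv d (?T x) = cinv c x" "cinv d (?T y) = cinv c y"
        using transition_in(2)[OF chart chart, OF assms(1,2)] sub xy by blast+
      then have "cinv c x = cinv c y" using xy(3) by simp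
      then show "x = y" using chartD(6)[OF assms(1)] cim(1) xy(1,2) by (metis subsetD)
    qed
    show "0 \<le> vol_density d (?T x)" if "x \<in> cmap c ` B" for x
      using vol_density_pos[OF assms(2), of "?T x"] cim(2) im that by (blast intro: less_imp_le)
    show "(\<lambda>y. vol_density d y * indicator (?T ` cmap c ` B) y) \<in> borel_measurable borel"
      unfolding im by (rule vol_density_measurable[OF assms(2) borel_chart_image[OF assms(2,3,5)] cim(2)])
    have "(\<lambda>x. vol_density c x * indicator (cmap c ` B) x) \<in> borel_measurable borel"
      by (rule vol_density_measurable[OF assms(1) borel_chart_image[OF assms(1,3,4)] cim(1)])
    then show "(\<lambda>x. \<bar>det (matrix (T.D x))\<bar> * vol_density d (?T x) * indicator (cmap c ` B) x) \<in> borel_measurable borel"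
      by (rule measurable_cong[THEN iffD1, rotated]) (use eq in \<open>auto simp: indicator_def\<close>)
  qed
  also have "\<dots> = chart_volume c B"
    unfolding chart_volume_def by (intro nn_integral_cong) (use eq in \<open>auto simp: indicator_def\<close>)
  finally show ?thesis unfolding im chart_volume_def by simp
qed

abbreviation "pts \<equiv> restrict_space borel (points \<A>)"

lemma sets_pts: "B \<in> sets pts \<longleftrightarrow> B \<in> sets borel \<and> B \<subseteq> points \<A>"
  using open_points[OF atlas] by (auto simp: sets_restrict_space)

lemma space_pts: "space pts = points \<A>"
  by (simp add: space_restrict_space)

text \<open>The measure is the image, under the inverse chart, of Lebesgue measure with the volume
  density cut down to E.\<close>

lemma chart_volume_measure:
  assumes "c \<in> \<A>" "E \<in> sets borel" "E \<subseteq> cdom c"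
  obtains \<kappa> where "sets \<kappa> = sets pts" "\<And>B. B \<in> sets pts \<Longrightarrow> emeasure \<kappa> B = chart_volume c (B \<inter> E)"
proof (cases "points \<A> = {}")
  case True
  then have "sets pts = {{}}" "B \<inter> E = {}" for B
    using sets_pts assms(3) cdom_subset_points[OF assms(1)] by (auto simp: sets_restrict_space)
  then show ?thesis using that[of pts] by (auto simp: chart_volume_def)
next
  case False
  then obtain p0 where p0: "p0 \<in> points \<A>" by blast
  \<comment> \<open>Outside the chart image the inverse is unspecified; sending these points to an
    arbitrary p0 makes T total and measurable, and the density vanishes there.\<close>
  define T where "T x = (if x \<in> cimg c then cinv c x else p0)" for x
  have "T \<in> borel_measurable borel"
    unfolding T_def using chartD(2,4)[OF assms(1)]
    by (intro measurable_If_restrict_space_iff[THEN iffD2] conjI borel_measurable_continuous_on_restrict) auto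
  moreover have "T x \<in> points \<A>" for x using p0 cinv_in_points[OF assms(1)] by (simp add: T_def)
  ultimately have T: "T \<in> borel \<rightarrow>\<^sub>M pts" by (intro measurable_restrict_space2) auto
  have E: "cmap c ` E \<in> sets borel" "cmap c ` E \<subseteq> cimg c"
    using borel_chart_image[OF assms] assms(3) by (auto simp: cimg_def)
  define \<delta> where "\<delta> x = ennreal (vol_density c x * indicator (cmap c ` E) x)" for x
  have \<delta>: "\<delta> \<in> borel_measurable borel"
    unfolding \<delta>_def using vol_density_measurable[OF assms(1) E] by measurable
  let ?\<kappa> = "distr (density lborel \<delta>) pts T"
  show ?thesis
  proof (rule that[of ?\<kappa>])
    fix B assume B: "B \<in> sets pts"
    have TB: "T -` B \<inter> space borel \<in> sets borel" by (rule measurable_sets[OF T B])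
    have "emeasure ?\<kappa> B = emeasure (density lborel \<delta>) (T -` B \<inter> space (density lborel \<delta>))"
      using T B by (intro emeasure_distr) auto
    also have "\<dots> = (\<integral>\<^sup>+x. \<delta> x * indicator (T -` B) x \<partial>lborel)"
      using \<delta> TB by (subst emeasure_density) auto
    also have "\<dots> = chart_volume c (B \<inter> E)"
      unfolding chart_volume_def
    proof (intro nn_integral_cong)
      fix x
      have "x \<in> cmap c ` E \<and> T x \<in> B \<longleftrightarrow> x \<in> cmap c ` (B \<inter> E)"
      proof
        assume "x \<in> cmap c ` E \<and> T x \<in> B"
        then obtain p where p: "p \<in> E" "x = cmap c p" "T x \<in> B" by blast
        then have "T x = p" using assms(3) chartD(7,8)[OF assms(1)] by (auto simp: T_def)
        then show "x \<in> cmap c ` (B \<inter> E)" using p by auto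
      next
        assume "x \<in> cmap c ` (B \<inter> E)"
        then obtain p where p: "p \<in> B" "p \<in> E" "x = cmap c p" by blast
        then have "T x = p" using assms(3) chartD(7,8)[OF assms(1)] by (auto simp: T_def)
        then show "x \<in> cmap c ` E \<and> T x \<in> B" using p by auto
      qed
      then show "\<delta> x * indicator (T -` B) x = ennreal (vol_density c x) * indicator (cmap c ` (B \<inter> E)) x"
        by (auto simp: \<delta>_def indicator_def)
    qed
    finally show "emeasure ?\<kappa> B = chart_volume c (B \<inter> E)" .
  qed simp
qed

text \<open>Countable additivity is borrowed from the measure attached to the chart.\<close>

lemma chart_volume_suminf:
  assumes "c \<in> \<A>" "\<And>n. B n \<in> sets borel" "\<And>n. B n \<subseteq> cdom c" "disjoint_family B"
  shows "(\<Sum>n. chart_volume c (B n)) = chart_volume c (\<Union>n. B n)"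
proof -
  obtain \<kappa> where \<kappa>: "sets \<kappa> = sets pts" "\<And>B. B \<in> sets pts \<Longrightarrow> emeasure \<kappa> B = chart_volume c (B \<inter> cdom c)"
    using chart_volume_measure[OF assms(1) borel_open[OF chartD(1)[OF assms(1)]]] by auto
  have B: "B n \<in> sets pts" for n
    using assms(2,3) cdom_subset_points[OF assms(1)] by (auto simp: sets_pts)
  have "(\<Sum>n. emeasure \<kappa> (B n)) = emeasure \<kappa> (\<Union>n. B n)"
    using B assms(4) \<kappa>(1) by (intro suminf_emeasure) auto
  moreover have "(\<Union>n. B n) \<in> sets pts" using B by auto
  moreover have "B n \<inter> cdom c = B n" "(\<Union>n. B n) \<inter> cdom c = (\<Union>n. B n)" for n using assms(3) by auto
  ultimately show ?thesis using \<kappa>(2) B by simp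
qed

section \<open>Existence and uniqueness of the volume measure\<close>

definition is_volume :: "'m measure \<Rightarrow> bool" where
  "is_volume \<mu> \<longleftrightarrow> sets \<mu> = sets pts \<and>
     (\<forall>c\<in>\<A>. \<forall>B\<in>sets borel. B \<subseteq> cdom c \<longrightarrow> emeasure \<mu> B = chart_volume c B)"

lemma countable_chart_cover:
  assumes "\<A> \<noteq> {}"
  obtains e :: "nat \<Rightarrow> ('m, 'n) chart" where "range e \<subseteq> \<A>" "(\<Union>n. cdom (e n)) = points \<A>"
proof -
  obtain F where F: "F \<subseteq> cdom ` \<A>" "countable F" "\<Union>F = \<Union>(cdom ` \<A>)"
    using Lindelof[of "cdom ` \<A>"] chartD(1) by blast
  obtain C where C: "countable C" "C \<subseteq> \<A>" "F = cdom ` C"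
    using F(1,2) by (metis countable_subset_image)
  obtain c0 where c0: "c0 \<in> \<A>" using assms by blast
  \<comment> \<open>Adding c0 makes the index set nonempty, as an enumeration by the natural numbers
    requires.\<close>
  define e where "e = from_nat_into (insert c0 C)"
  have e: "range e = insert c0 C" unfolding e_def using C(1) by (intro range_from_nat_into) auto
  have "(\<Union>n. cdom (e n)) = \<Union>(cdom ` range e)" by blast
  also have "\<dots> = points \<A>"
    unfolding e using F(3) C c0 by (auto simp: points_def)
  finally show ?thesis by (intro that[of e]) (use e C(2) c0 in auto)
qed

text \<open>A countable chart cover is made disjoint; the chart volumes of the pieces add up to a
  measure, and \<open>chart_volume_transition\<close> shows that any other chart sees the same
  values. Since the pieces lie in chart domains, the prescribed values leave no freedom, which gives
  uniqueness.\<close>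

lemma volume_exists_unique: "\<exists>!\<mu>. is_volume \<mu>"
proof (cases "\<A> = {}")
  case True
  then have p: "points \<A> = {}" by (simp add: points_def)
  then have "sets pts = {{}}" by (auto simp: sets_restrict_space)
  then have "is_volume \<mu> \<longleftrightarrow> sets \<mu> = {{}}" for \<mu> unfolding is_volume_def using True by blast
  moreover have "\<mu> = \<mu>'" if "sets \<mu> = {{}}" "sets \<mu>' = {{}}" for \<mu> \<mu>' :: "'m measure"
    using that by (intro measure_eqI) auto
  ultimately show ?thesis using \<open>sets pts = {{}}\<close> by metis
next
  case False
  obtain e :: "nat \<Rightarrow> ('m, 'n) chart" where e: "range e \<subseteq> \<A>" "(\<Union>n. cdom (e n)) = points \<A>"
    by (rule countable_chart_cover[OF False])
  have eA: "e n \<in> \<A>" for n using e(1) by auto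
  define E where "E = disjointed (\<lambda>n. cdom (e n))"
  have E_sub: "E n \<subseteq> cdom (e n)" for n unfolding E_def by (rule disjointed_subset)
  have E_disj: "disjoint_family E" unfolding E_def by (rule disjoint_family_disjointed)
  have E_UN: "(\<Union>n. E n) = points \<A>" unfolding E_def by (simp add: UN_disjointed_eq e(2))
  have E_borel: "E n \<in> sets borel" for n
    unfolding E_def disjointed_def using chartD(1)[OF eA] by (intro sets.Diff sets.countable_UN) auto
  have split: "B = (\<Union>n. B \<inter> E n)" if "B \<subseteq> points \<A>" for B using that E_UN by auto
  have disj: "disjoint_family (\<lambda>n. B \<inter> E n)" for B using E_disj by (auto simp: disjoint_family_on_def)
  have "\<exists>\<kappa>. sets \<kappa> = sets pts \<and> (\<forall>B\<in>sets pts. emeasure \<kappa> B = chart_volume (e n) (B \<inter> E n))" for n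
    using chart_volume_measure[OF eA[of n] E_borel E_sub] by metis
  then obtain \<kappa> where \<kappa>: "\<And>n. sets (\<kappa> n) = sets pts"
    "\<And>n B. B \<in> sets pts \<Longrightarrow> emeasure (\<kappa> n) B = chart_volume (e n) (B \<inter> E n)" by metis
  define \<mu> where "\<mu> = measure_of (points \<A>) (sets pts) (\<lambda>B. \<Sum>n. emeasure (\<kappa> n) B)"
  have sub: "sets pts \<subseteq> Pow (points \<A>)" using sets_pts by auto
  have sets_\<mu>: "sets \<mu> = sets pts"
    unfolding \<mu>_def using sets.sigma_sets_eq[of pts] by (simp add: sets_measure_of[OF sub] space_pts)
  have em: "emeasure \<mu> B = (\<Sum>n. emeasure (\<kappa> n) B)" if "B \<in> sets pts" for B
  proof (rule emeasure_measure_of[OF \<mu>_def sub])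
    show "positive (sets \<mu>) (\<lambda>B. \<Sum>n. emeasure (\<kappa> n) B)" by (simp add: positive_def)
    show "countably_additive (sets \<mu>) (\<lambda>B. \<Sum>n. emeasure (\<kappa> n) B)"
      unfolding countably_additive_def sets_\<mu>
    proof (intro allI impI)
      fix A :: "nat \<Rightarrow> 'm set"
      assume A: "range A \<subseteq> sets pts" "disjoint_family A"
      \<comment> \<open>The two sums are exchanged by reading the inner one as an integral over
        counting measure.\<close>
      have "(\<Sum>i. \<Sum>n. emeasure (\<kappa> n) (A i)) = (\<Sum>i. \<integral>\<^sup>+n. emeasure (\<kappa> n) (A i) \<partial>count_space UNIV)"
        by (simp add: nn_integral_count_space_nat)
      also have "\<dots> = (\<integral>\<^sup>+n. (\<Sum>i. emeasure (\<kappa> n) (A i)) \<partial>count_space UNIV)"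
        by (rule nn_integral_suminf[symmetric]) simp
      also have "\<dots> = (\<Sum>n. \<Sum>i. emeasure (\<kappa> n) (A i))"
        by (simp add: nn_integral_count_space_nat)
      also have "\<dots> = (\<Sum>n. emeasure (\<kappa> n) (\<Union>i. A i))"
        using A by (intro suminf_cong suminf_emeasure) (simp_all add: \<kappa>(1))
      finally show "(\<Sum>i. \<Sum>n. emeasure (\<kappa> n) (A i)) = (\<Sum>n. emeasure (\<kappa> n) (\<Union>i. A i))" .
    qed
  qed (simp add: sets_\<mu> that)
  have vol: "emeasure \<mu> B = chart_volume c B" if c: "c \<in> \<A>" and B: "B \<in> sets borel" "B \<subseteq> cdom c" for c B
  proof -
    have Bp: "B \<in> sets pts" "B \<subseteq> points \<A>" using B cdom_subset_points[OF c] by (auto simp: sets_pts)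
    have "emeasure \<mu> B = (\<Sum>n. chart_volume (e n) (B \<inter> E n))" using em[OF Bp(1)] \<kappa>(2)[OF Bp(1)] by simp
    also have "\<dots> = (\<Sum>n. chart_volume c (B \<inter> E n))"
      using B E_borel E_sub by (intro suminf_cong chart_volume_transition eA c) auto
    also have "\<dots> = chart_volume c (\<Union>n. B \<inter> E n)"
      using B E_borel disj by (intro chart_volume_suminf c) auto
    finally show ?thesis using split[OF Bp(2)] by simp
  qed
  show ?thesis
  proof (rule ex1I[of _ \<mu>])
    show "is_volume \<mu>" using sets_\<mu> vol by (simp add: is_volume_def)
    fix \<mu>' assume \<mu>': "is_volume \<mu>'"
    show "\<mu>' = \<mu>"
    proof (rule measure_eqI)
      show "sets \<mu>' = sets \<mu>" using \<mu>' sets_\<mu> by (simp add: is_volume_def)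
      fix B assume "B \<in> sets \<mu>'"
      then have B: "B \<in> sets pts" using \<mu>' by (simp add: is_volume_def)
      then have Bn: "B \<inter> E n \<in> sets pts" "B \<inter> E n \<in> sets borel" "B \<inter> E n \<subseteq> cdom (e n)" for n
        using E_borel E_sub by (auto simp: sets_pts)
      have "emeasure \<nu> B = (\<Sum>n. chart_volume (e n) (B \<inter> E n))" if "is_volume \<nu>" for \<nu>
      proof -
        have "emeasure \<nu> B = emeasure \<nu> (\<Union>n. B \<inter> E n)" using split[of B] B sets_pts by simp
        also have "\<dots> = (\<Sum>n. emeasure \<nu> (B \<inter> E n))"
          using that Bn(1) disj by (intro suminf_emeasure[symmetric]) (auto simp: is_volume_def)
        also have "\<dots> = (\<Sum>n. chart_volume (e n) (B \<inter> E n))"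
          using that Bn eA by (intro suminf_cong) (auto simp: is_volume_def)
        finally show ?thesis .
      qed
      then show "emeasure \<mu>' B = emeasure \<mu> B" using \<mu>' \<open>is_volume \<mu>\<close> by simp
    qed
  qed
qed

lemma riemannian_volume: "is_volume (riemannian_volume \<A> g)"
proof -
  have "riemannian_volume \<A> g = (THE \<mu>. is_volume \<mu>)"
    unfolding riemannian_volume_def is_volume_def chart_volume_def vol_density_def ..
  then show ?thesis using theI'[OF volume_exists_unique] by simp
qed

lemma sets_volume: "sets (riemannian_volume \<A> g) = sets pts"
  using riemannian_volume by (simp add: is_volume_def)

lemma space_volume: "space (riemannian_volume \<A> g) = points \<A>"
  using sets_eq_imp_space_eq[OF sets_volume] space_pts by simp

text \<open>The density is strictly positive, and a nonempty open set of coordinates is not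
  negligible.\<close>

lemma volume_open_pos:
  assumes "c \<in> \<A>" "open W" "W \<subseteq> cdom c" "W \<noteq> {}"
  shows "emeasure (riemannian_volume \<A> g) W \<noteq> 0"
proof
  assume "emeasure (riemannian_volume \<A> g) W = 0"
  then have "chart_volume c W = 0"
    using riemannian_volume assms by (simp add: is_volume_def)
  have V: "open (cmap c ` W)" "cmap c ` W \<subseteq> cimg c" "cmap c ` W \<noteq> {}"
    using open_chart_overlap[OF chart[OF assms(1)] assms(2)] assms(3,4) by (auto simp: Int_absorb1 cimg_def)
  have m: "(\<lambda>x. ennreal (vol_density c x * indicator (cmap c ` W) x)) \<in> borel_measurable lborel"
    using vol_density_measurable[OF assms(1) borel_open[OF V(1)] V(2)] by measurable
  have "(\<integral>\<^sup>+ x. ennreal (vol_density c x * indicator (cmap c ` W) x) \<partial>lborel) = 0"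
    using \<open>chart_volume c W = 0\<close> unfolding chart_volume_def
    by (subst (asm) nn_integral_cong[where v="\<lambda>x. ennreal (vol_density c x * indicator (cmap c ` W) x)"])
      (auto simp: indicator_def)
  then have "AE x in lborel. ennreal (vol_density c x * indicator (cmap c ` W) x) = 0"
    using nn_integral_0_iff_AE[OF m] by simp
  then have "AE x in lborel. x \<notin> cmap c ` W"
  proof eventually_elim
    case (elim x)
    show ?case
    proof
      assume "x \<in> cmap c ` W"
      then show False using elim vol_density_pos[OF assms(1), of x] V(2) by (auto simp: ennreal_eq_0_iff)
    qed
  qed
  then have "emeasure lborel (cmap c ` W) = 0"
    using V(1) by (subst (asm) AE_iff_measurable[where N="cmap c ` W"]) auto
  then have "negligible (cmap c ` W)"
    using V(1) by (simp add: negligible_iff_null_sets null_sets_def)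
  then show False using open_not_negligible[OF V(1,3)] by simp
qed

end

section \<open>The weighted volume\<close>

lemma emeasure_exp_density_nonzero:
  assumes "W \<in> sets M" "emeasure M W \<noteq> 0" "(\<lambda>p. ennreal (exp (- f p))) \<in> borel_measurable M"
  shows "emeasure (density M (\<lambda>p. ennreal (exp (- f p)))) W \<noteq> 0"
proof
  assume "emeasure (density M (\<lambda>p. ennreal (exp (- f p)))) W = 0"
  then have "(\<integral>\<^sup>+p. ennreal (exp (- f p)) * indicator W p \<partial>M) = 0"
    by (simp add: emeasure_density[OF assms(3,1)])
  then have "AE p in M. ennreal (exp (- f p)) * indicator W p = 0"
    using assms(1,3) by (subst (asm) nn_integral_0_iff_AE) auto
  then have "AE p in M. p \<notin> W"
    by eventually_elim (auto simp: indicator_def ennreal_eq_0_iff split: if_splits)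
  then have "emeasure M W = 0"
    using assms(1) sets.sets_into_space[OF assms(1)] by (subst (asm) AE_iff_measurable[OF assms(1)]) auto
  then show False using assms(2) by simp
qed

context riemannian
begin

lemma weighted_volume_sets: "sets (weighted_volume \<A> g f) = sets pts"
  by (simp add: weighted_volume_def sets_volume)

lemma weighted_volume_space: "space (weighted_volume \<A> g f) = points \<A>"
  by (simp add: weighted_volume_def space_volume)

lemma borel_measurable_weighted:
  fixes q :: "'m \<Rightarrow> 'c::topological_space"
  assumes "continuous_on (points \<A>) q"
  shows "q \<in> borel_measurable (weighted_volume \<A> g f)"
  using borel_measurable_continuous_on_restrict[OF assms] measurable_cong_sets[OF weighted_volume_sets refl] by blast

lemma weighted_volume_open_pos:
  assumes "continuous_on (points \<A>) f" "open W" "W \<subseteq> points \<A>" "W \<noteq> {}"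
  shows "emeasure (weighted_volume \<A> g f) W \<noteq> 0"
proof -
  obtain p where p: "p \<in> W" using assms(4) by blast
  obtain c where c: "c \<in> \<A>" "p \<in> cdom c" using p assms(3) by (auto simp: points_def)
  have W': "open (W \<inter> cdom c)" "W \<inter> cdom c \<noteq> {}" using assms(2) chartD(1)[OF c(1)] p c(2) by auto
  have sets: "W \<inter> cdom c \<in> sets (riemannian_volume \<A> g)" "W \<in> sets (riemannian_volume \<A> g)"
    using W'(1) assms(2,3) by (auto simp: sets_volume sets_pts)
  have "continuous_on (points \<A>) (\<lambda>p. exp (- f p))" by (intro continuous_intros assms(1))
  then have "(\<lambda>p. exp (- f p)) \<in> borel_measurable (riemannian_volume \<A> g)"
    using borel_measurable_continuous_on_restrict measurable_cong_sets[OF sets_volume refl] by blast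
  then have m: "(\<lambda>p. ennreal (exp (- f p))) \<in> borel_measurable (riemannian_volume \<A> g)" by measurable
  have "emeasure (weighted_volume \<A> g f) (W \<inter> cdom c) \<noteq> 0"
    unfolding weighted_volume_def
    by (rule emeasure_exp_density_nonzero[OF sets(1) volume_open_pos[OF c(1) W'(1) _ W'(2)] m]) auto
  moreover have "emeasure (weighted_volume \<A> g f) (W \<inter> cdom c) \<le> emeasure (weighted_volume \<A> g f) W"
    using sets by (intro emeasure_mono) (auto simp: weighted_volume_def)
  ultimately show ?thesis by auto
qed

end

subsection \<open>Non-existence of stable hypersurfaces\<close>

context hypersurface
begin

text \<open>The integrand is at most 1 - k a^2 on W and at most 1 elsewhere; integration gives the
  bound, the constant 1 being integrable because the weighted volume is finite.\<close>

lemma stable_test_bound: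
  assumes f: "smooth_fun \<A> f" and Ric: "Ric_f_ge \<A> g f k" and "k > 0"
    and stable: "L_f_stable \<S> \<A> g f F \<nu>" and fin: "finite_weighted_volume \<S> \<A> g f F"
    and u: "test_function \<S> u" "riemannian.short \<S> h u"
    and W: "W \<in> sets (restrict_space borel (points \<S>))" "\<And>p. p \<in> W \<Longrightarrow> a \<le> \<bar>u p\<bar>" "a \<ge> 0"
  shows "k * a\<^sup>2 * measure (weighted_volume \<S> h (f \<circ> F)) W \<le> measure (weighted_volume \<S> h (f \<circ> F)) (points \<S>)"
proof -
  interpret S: riemannian \<S> h by unfold_locales (rule riemannian_manifold_induced)
  let ?\<mu> = "weighted_volume \<S> h (f \<circ> F)"
  define Q where "Q p = shape_norm_sq \<S> \<A> g F \<nu> p + Ric_f_normal \<A> g f F \<nu> p" for p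
  define \<iota> where "\<iota> p = grad_norm_sq \<S> h u p - Q p * (u p)\<^sup>2" for p
  have space: "space ?\<mu> = points \<S>" by (rule S.weighted_volume_space)
  interpret \<mu>: finite_measure ?\<mu>
    by (rule finite_measureI) (use fin space in \<open>auto simp: finite_weighted_volume_def\<close>)
  have su: "smooth_fun \<S> u" using u(1) by (simp add: test_function_def)
  have cu: "continuous_on (points \<S>) u" by (rule smooth_fun_continuous_on[OF source_atlas su])
  have cQ: "continuous_on (points \<S>) Q"
    unfolding Q_def by (rule continuous_on_stability_potential[OF f])
  have Qk: "k \<le> Q p" if "p \<in> points \<S>" for p
    unfolding Q_def by (rule stability_potential_ge[OF f Ric that])
  obtain K where K: "compact K" "K \<subseteq> points \<S>" "\<And>p. p \<in> points \<S> - K \<Longrightarrow> u p = 0"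
    using u(1) by (auto simp: test_function_def)
  have cQu: "continuous_on (points \<S>) (\<lambda>p. Q p * (u p)\<^sup>2)" by (intro continuous_intros cQ cu)
  have cont: "continuous_on (points \<S>) \<iota>"
    unfolding \<iota>_def by (intro continuous_intros S.continuous_on_grad_norm_sq[OF su] cQ cu)
  have grad: "grad_norm_sq \<S> h u p \<le> 1" if "p \<in> points \<S>" for p
    by (rule S.grad_norm_sq_le[OF u(2) that])
  have "compact (\<iota> ` K)" by (rule compact_continuous_image[OF continuous_on_subset[OF cont K(2)] K(1)])
  then obtain B where B: "\<And>p. p \<in> K \<Longrightarrow> \<bar>\<iota> p\<bar> \<le> B" using compact_imp_bounded bounded_iff by (metis image_eqI real_norm_def)
  have grad_nn: "0 \<le> grad_norm_sq \<S> h u p" if "p \<in> points \<S>" for p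
  proof -
    note c = chart_at[OF that]
    interpret c: local_riemannian "cimg (chart_at \<S> p)" "h (chart_at \<S> p)" by (rule S.local_riemannian_chart[OF c(1)])
    show ?thesis unfolding grad_norm_sq_def Let_def by (rule c.nonneg[OF S.chartD(7)[OF c]])
  qed
  have bound: "\<bar>\<iota> p\<bar> \<le> max B 1" if "p \<in> points \<S>" for p
  proof (cases "p \<in> K")
    case False
    then have "\<iota> p = grad_norm_sq \<S> h u p" using K(3) that by (simp add: \<iota>_def)
    then show ?thesis using grad[OF that] grad_nn[OF that] by simp
  qed (use B in force)
  \<comment> \<open>For a non-integrable function the integral would be 0 by default and stability
    would say nothing. Boundedness comes from continuity on the compact K and from the gradient
    bound off K.\<close>
  have int: "integrable ?\<mu> \<iota>"
    by (rule \<mu>.integrable_const_bound[where B="max B 1"]) (use bound space S.borel_measurable_weighted[OF cont] in auto)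
  have Wsets: "W \<in> sets ?\<mu>" using W(1) S.weighted_volume_sets by simp
  have int2: "integrable ?\<mu> (\<lambda>p. 1 - k * a\<^sup>2 * indicator W p)"
    using Wsets by (intro Bochner_Integration.integrable_diff integrable_mult_right integrable_const)
      (auto simp: \<mu>.emeasure_finite less_top[symmetric] intro!: integrable_real_indicator)
  have "0 \<le> (\<integral>p. \<iota> p \<partial>?\<mu>)"
    using stable u(1) unfolding L_f_stable_def \<iota>_def Q_def by blast
  also have "\<dots> \<le> (\<integral>p. 1 - k * a\<^sup>2 * indicator W p \<partial>?\<mu>)"
  proof (rule integral_mono[OF int int2])
    fix p assume "p \<in> space ?\<mu>"
    then have p: "p \<in> points \<S>" using space by simp
    have "k * a\<^sup>2 * indicator W p \<le> k * (u p)\<^sup>2"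
    proof (cases "p \<in> W")
      case True
      then have "a\<^sup>2 \<le> (u p)\<^sup>2" using W(2)[OF True] W(3) by (metis abs_of_nonneg power2_abs power_mono)
      then show ?thesis using assms(3) True by simp
    qed (use assms(3) in simp)
    also have "\<dots> \<le> Q p * (u p)\<^sup>2" using Qk[OF p] by (intro mult_right_mono) auto
    finally show "\<iota> p \<le> 1 - k * a\<^sup>2 * indicator W p" using grad[OF p] by (simp add: \<iota>_def)
  qed
  also have "\<dots> = measure ?\<mu> (points \<S>) - k * a\<^sup>2 * measure ?\<mu> W"
    using Wsets space sets.sets_into_space[OF Wsets]
    by (subst Bochner_Integration.integral_diff)
      (auto simp: \<mu>.emeasure_finite less_top[symmetric] Int_absorb2 intro!: integrable_mult_right integrable_real_indicator)
  finally show ?thesis by simp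
qed

lemma no_stable_hypersurface:
  assumes f: "smooth_fun \<A> f" and Ric: "Ric_f_ge \<A> g f k" and "k > 0"
    and stable: "L_f_stable \<S> \<A> g f F \<nu>" and fin: "finite_weighted_volume \<S> \<A> g f F"
    and complete: "complete_manifold \<S> h" and ne: "points \<S> \<noteq> {}"
  shows False
proof -
  interpret S: riemannian \<S> h by unfold_locales (rule riemannian_manifold_induced)
  let ?\<mu> = "weighted_volume \<S> h (f \<circ> F)"
  obtain p where p: "p \<in> points \<S>" "\<And>R. \<exists>u\<in>S.short_test. R < u p"
    using S.short_test_unbounded[OF complete ne] by metis
  obtain c where c: "c \<in> \<S>" "p \<in> cdom c" using p(1) by (auto simp: points_def)
  interpret c: local_riemannian "cimg c" "h c" by (rule S.local_riemannian_chart[OF c(1)])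
  define x0 where "x0 = cmap c p"
  have x0: "x0 \<in> cimg c" "cinv c x0 = p" using source_chartD(7,8)[OF c(1)] c(2) by (auto simp: x0_def)
  define q where "q = (\<lambda>x. h c x0 (x - x0) (x - x0))"
  obtain \<rho> where \<rho>: "\<rho> > 0" "\<And>x. q x \<le> \<rho>\<^sup>2 \<Longrightarrow> x \<in> cimg c"
    "\<And>x v. q x \<le> \<rho>\<^sup>2 \<Longrightarrow> h c x0 v v \<le> 4 * h c x v v"
    "\<And>x v. q x \<le> \<rho>\<^sup>2 \<Longrightarrow> h c x v v \<le> 4 * h c x0 v v"
    using c.metric_comparable[OF x0(1)] unfolding q_def by auto
  define V where "V = {x. q x < \<rho>\<^sup>2}"
  define W where "W = {p \<in> cdom c. cmap c p \<in> V}"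
  have "open V" unfolding V_def q_def by (intro open_Collect_less c.continuous_on_metric_at[OF x0(1)] continuous_on_const)
  then have W: "open W"
    using continuous_open_preimage[OF source_chartD(3,1)[OF c(1)], of V] by (simp add: W_def vimage_def Int_def)
  have "q x0 = 0" by (simp add: q_def c.metric_linear x0(1))
  then have "p \<in> W" using c(2) \<rho>(1) by (simp add: W_def V_def x0_def[symmetric])
  have Wp: "W \<subseteq> points \<S>" using cdom_subset_points[OF c(1)] by (auto simp: W_def)
  \<comment> \<open>W is fixed before u is chosen: a function of Lipschitz constant one that exceeds
    a + 2 \<rho> at p stays above a on all of W.\<close>
  have near: "S.dst p p' \<le> ennreal (2 * \<rho>)" if p': "p' \<in> W" for p'
  proof -
    define x where "x = cmap c p'"
    have x: "q x \<le> \<rho>\<^sup>2" "cinv c x = p'" using p' source_chartD(8)[OF c(1)] by (auto simp: W_def V_def x_def)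
    let ?v = "x - x0"
    have qt: "q (x0 + t *\<^sub>R ?v) \<le> \<rho>\<^sup>2" if "0 \<le> t" "t \<le> 1" for t
    proof -
      have "q (x0 + t *\<^sub>R ?v) = t\<^sup>2 * q x"
        unfolding q_def add_diff_cancel_left' using x0(1) by (simp add: c.metric_linear(3,4) power2_eq_square)
      also have "\<dots> \<le> 1 * q x"
        unfolding q_def using that c.nonneg[OF x0(1)] by (intro mult_right_mono power_le_one) auto
      finally show ?thesis using x by simp
    qed
    have "S.dst (cinv c x0) (cinv c (x0 + ?v)) \<le> ennreal (2 * \<rho>)"
    proof (rule S.dist_segment_le[OF c(1)])
      fix t :: real assume t: "0 \<le> t" "t \<le> 1"
      show "x0 + t *\<^sub>R ?v \<in> cimg c" by (rule \<rho>(2)[OF qt[OF t]])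
      have "h c (x0 + t *\<^sub>R ?v) ?v ?v \<le> 4 * q x" unfolding q_def by (rule \<rho>(4)[OF qt[OF t]])
      also have "\<dots> \<le> (2 * \<rho>)\<^sup>2" using x by (simp add: power_mult_distrib)
      finally show "h c (x0 + t *\<^sub>R ?v) ?v ?v \<le> (2 * \<rho>)\<^sup>2" .
    qed (use \<rho>(1) in simp)
    then show ?thesis using x0 x by simp
  qed
  have "continuous_on (points \<S>) (f \<circ> F)"
    using continuous_on_compose[OF continuous_F continuous_on_subset[OF smooth_fun_continuous_on[OF atlas f]]] F_in
    by blast
  from S.weighted_volume_open_pos[OF this W Wp] have "emeasure ?\<mu> W \<noteq> 0" using \<open>p \<in> W\<close> by blast
  moreover have "emeasure ?\<mu> W \<le> emeasure ?\<mu> (points \<S>)"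
    using Wp open_points[OF source_atlas] by (intro emeasure_mono) (auto simp: S.weighted_volume_sets S.sets_pts)
  ultimately have mW: "0 < measure ?\<mu> W"
    using fin unfolding finite_weighted_volume_def by (simp add: measure_def enn2real_positive_iff zero_less_iff_neq_zero)
  have Wsets: "W \<in> sets S.pts" using W Wp by (simp add: S.sets_pts)
  define m where "m = measure ?\<mu> (points \<S>)"
  have m0: "0 \<le> m" by (simp add: m_def)
  \<comment> \<open>With this a one has k a vol(W) = m + k vol(W) > m, and a \<ge> 1 allows passing
    from a to a^2.\<close>
  define a where "a = m / (k * measure ?\<mu> W) + 1"
  have a: "a \<ge> 1" using m0 mW assms(3) by (simp add: a_def)
  obtain u where u: "u \<in> S.short_test" "a + 2 * \<rho> < u p" using p(2) by blast
  have ua: "a \<le> \<bar>u p'\<bar>" if "p' \<in> W" for p'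
  proof -
    have "ennreal \<bar>u p' - u p\<bar> \<le> ennreal (2 * \<rho>)"
      using S.short_le_dist[of u p' p] near[OF that] u(1) by (auto simp: S.short_test_def)
    then have "\<bar>u p' - u p\<bar> \<le> 2 * \<rho>" using \<rho>(1) by (subst (asm) ennreal_le_iff) auto
    then show ?thesis using u(2) by linarith
  qed
  have "k * a\<^sup>2 * measure ?\<mu> W \<le> m"
    unfolding m_def using u(1) a ua
    by (intro stable_test_bound[OF f Ric assms(3) stable fin _ _ Wsets]) (auto simp: S.short_test_def)
  moreover have "m < k * a * measure ?\<mu> W"
    using mW assms(3) by (simp add: a_def field_simps)
  moreover have "k * a * measure ?\<mu> W \<le> k * a\<^sup>2 * measure ?\<mu> W"
    using a mW assms(3) by (simp add: power2_eq_square)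
  ultimately show False by simp
qed

end

text \<open>Nonemptiness is among the conditions on the hypersurface because the empty atlas
  satisfies all the others vacuously.\<close>

theorem theorem3:
  fixes \<A> :: "('m::{t2_space,second_countable_topology}, 'b::finite) chart set"
    and g :: "('m, 'b) metric" and f :: "'m \<Rightarrow> real" and k :: real
  assumes "CARD('b) = CARD('a::finite) + 1"
    and "complete_smooth_metric_measure_space \<A> g f"
    and "k > 0" and "Ric_f_ge \<A> g f k"
  shows "\<not> (\<exists>(\<S> :: ('s::{t2_space,second_countable_topology}, 'a) chart set) F \<nu>.
           smooth_atlas \<S> \<and> points \<S> \<noteq> {} \<and>
           immersion \<S> \<A> F \<and>
           complete_manifold \<S> (induced_metric \<A> g F) \<and>
           unit_normal \<S> \<A> g F \<nu> \<and>
           f_minimal \<S> \<A> g f F \<nu> \<and>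
           L_f_stable \<S> \<A> g f F \<nu> \<and>
           finite_weighted_volume \<S> \<A> g f F)"
proof (rule notI, elim exE conjE)
  fix \<S> :: "('s, 'a) chart set" and F \<nu>
  assume *: "smooth_atlas \<S>" "points \<S> \<noteq> {}" "immersion \<S> \<A> F"
    "complete_manifold \<S> (induced_metric \<A> g F)" "unit_normal \<S> \<A> g F \<nu>"
    "L_f_stable \<S> \<A> g f F \<nu>" "finite_weighted_volume \<S> \<A> g f F"
  have M: "riemannian_manifold \<A> g" "smooth_fun \<A> f"
    using assms(2) by (auto simp: complete_smooth_metric_measure_space_def)
  interpret hypersurface \<A> g \<S> F \<nu>
    by unfold_locales (use M(1) * assms(1) in auto)
  show False
    by (rule no_stable_hypersurface[OF M(2) assms(4,3) *(6,7,4,2)])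
qed

end
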